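(* Let $q\in(-1,1)$ and let $X^{(q)}=\{X^{(q)}_t\}_{t\ge 0}$ be a $q$-Ornstein--Uhlenbeck process with càdlàg sample paths. For $0\le a<b$ and $\epsilon>0$ let $$N^{(q)}((a,b],\epsilon) := \left|\left\{t\in(a,b]:\ X^{(q)}_{t-}<-\frac{2}{\sqrt{1-q}}+\epsilon,\ X^{(q)}_t>\frac{2}{\sqrt{1-q}}-\epsilon\right\}\right|.$$ Then, as $\epsilon\downarrow 0$, the random variable $N^{(q)}((0,\epsilon^{-3}],\epsilon)$ converges weakly (in distribution) to a Poisson random variable with parameter $$\alpha_q := \frac{1}{18\pi^2}(1-q)^{3/2}\prod_{k=1}^\infty\frac{(1-q^k)^7}{(1+q^k)^4}.$$
   Context: For $a\in\mathbb{R}$ and $q\in(-1,1)$ write $(a;q)_\infty := \prod_{k=0}^\infty(1-aq^k)$ and $(q)_\infty := (q;q)_\infty$ (with $0^0=1$). For $q\in(-1,1)$, the $q$-Ornstein--Uhlenbeck process $X^{(q)}=\{X^{(q)}_t\}_{t\ge 0}$ is the stationary Markov process with state space $\left[-\frac{2}{\sqrt{1-q}},\frac{2}{\sqrt{1-q}}\right]$ whose marginal (stationary) probability density function is $$p^{(q)}(x) = \frac{\sqrt{1-q}\,(q)_\infty}{2\pi}\sqrt{4-(1-q)x^2}\prod_{k=1}^\infty\left[(1+q^k)^2-(1-q)x^2q^k\right],$$ and whose transition probability density function is, for $0\le s<t$ and $x,y\in\left[-\frac{2}{\sqrt{1-q}},\frac{2}{\sqrt{1-q}}\right]$, $$p^{(q)}_{s,t}(x,y)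 = (e^{-2(t-s)};q)_\infty\prod_{k=0}^\infty\frac{1}{\varphi_{q,k}(t-s,x,y)}\cdot p^{(q)}(y),$$ where $$\varphi_{q,k}(\delta,x,y) = (1-e^{-2\delta}q^{2k})^2-(1-q)e^{-\delta}q^k(1+e^{-2\delta}q^{2k})xy+(1-q)e^{-2\delta}q^{2k}(x^2+y^2).$$ This process is known to have a version with sample paths in $D([0,\infty))$, the space of càdlàg functions on $[0,\infty)$, and $X^{(q)}$ is assumed to be in $D([0,\infty))$ with probability one. $X^{(q)}_{t-}$ denotes the left limit at $t$, and $|S|$ denotes the cardinality of a set $S$. *)

theory Defs
  imports "HOL-Probability.Probability"
begin

definition q_pochhammer_inf :: "real \<Rightarrow> real \<Rightarrow> real" where
  "q_pochhammer_inf a q = (\<Prod>k. 1 - a * q ^ k)"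

definition qOU_states :: "real \<Rightarrow> real set" where
  "qOU_states q = {- 2 / sqrt (1 - q) .. 2 / sqrt (1 - q)}"

text \<open>The stationary density, extended by \<open>0\<close> off the state space. The indicator is needed
  because the library's \<^const>\<open>sqrt\<close> is an odd function, hence negative at negative arguments.
  Products over \<open>k \<ge> 1\<close> are written with \<open>Suc k\<close>.\<close>

definition qOU_density :: "real \<Rightarrow> real \<Rightarrow> real" where
  "qOU_density q x = indicator (qOU_states q) x *
     (sqrt (1 - q) * q_pochhammer_inf q q / (2 * pi) * sqrt (4 - (1 - q) * x\<^sup>2) *
      (\<Prod>k. (1 + q ^ Suc k)\<^sup>2 - (1 - q) * x\<^sup>2 * q ^ Suc k))"

definition qOU_phi :: "real \<Rightarrow> nat \<Rightarrow> real \<Rightarrow> real \<Rightarrow> real \<Rightarrow> real" where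
  "qOU_phi q k \<delta> x y =
     (1 - exp (- 2 * \<delta>) * q ^ (2 * k))\<^sup>2
     - (1 - q) * exp (- \<delta>) * q ^ k * (1 + exp (- 2 * \<delta>) * q ^ (2 * k)) * x * y
     + (1 - q) * exp (- 2 * \<delta>) * q ^ (2 * k) * (x\<^sup>2 + y\<^sup>2)"

definition qOU_transition :: "real \<Rightarrow> real \<Rightarrow> real \<Rightarrow> real \<Rightarrow> real \<Rightarrow> real" where
  "qOU_transition q s t x y =
     q_pochhammer_inf (exp (- 2 * (t - s))) q *
     (\<Prod>k. 1 / qOU_phi q k (t - s) x y) * qOU_density q y"

definition natural_filtration :: "'a measure \<Rightarrow> (real \<Rightarrow> 'a \<Rightarrow> real) \<Rightarrow> real \<Rightarrow> 'a measure" where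
  "natural_filtration M X s =
     sigma (space M) {X u -` B \<inter> space M | u B. u \<in> {0..s} \<and> B \<in> sets borel}"

text \<open>Time runs through the nonnegative reals; \<open>X t\<close> is unconstrained for \<open>t < 0\<close>.
  The axiom \<open>markov\<close> is the Markov property with respect to the natural filtration, with
  the prescribed transition densities. The axiom \<open>stationary\<close> is implied by the
  others, the transition densities being homogeneous in time and the marginals constant.\<close>

locale q_ornstein_uhlenbeck = prob_space M
  for M :: "'a measure" and q :: real and X :: "real \<Rightarrow> 'a \<Rightarrow> real" +
  assumes random_variables: "\<And>t. 0 \<le> t \<Longrightarrow> X t \<in> borel_measurable M"
    and states: "\<And>t \<omega>. 0 \<le> t \<Longrightarrow> \<omega> \<in> space M \<Longrightarrow> X t \<omega> \<in> qOU_states q"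
    and stationary: "\<And>h. 0 \<le> h \<Longrightarrow>
      distr M (\<Pi>\<^sub>M t\<in>{0..}. borel) (\<lambda>\<omega>. \<lambda>t\<in>{0..}. X (t + h) \<omega>) =
      distr M (\<Pi>\<^sub>M t\<in>{0..}. borel) (\<lambda>\<omega>. \<lambda>t\<in>{0..}. X t \<omega>)"
    and marginal: "\<And>t. 0 \<le> t \<Longrightarrow> distributed M lborel (X t) (\<lambda>x. ennreal (qOU_density q x))"
    and markov: "\<And>s t B. 0 \<le> s \<Longrightarrow> s < t \<Longrightarrow> B \<in> sets borel \<Longrightarrow>
      AE \<omega> in M. real_cond_exp M (natural_filtration M X s)
          (indicat_real (X t -` B \<inter> space M)) \<omega>
        = (LINT y:B|lborel. qOU_transition q s t (X s \<omega>) y)"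

definition cadlag :: "(real \<Rightarrow> real) \<Rightarrow> bool" where
  "cadlag f \<longleftrightarrow>
     (\<forall>t\<ge>0. continuous (at_right t) f) \<and>
     (\<forall>t>0. \<exists>l. (f \<longlongrightarrow> l) (at_left t))"

text \<open>For a cadlag path and \<open>\<epsilon> < 2 / sqrt (1 - q)\<close> the set below is finite, its elements being
  jump times in a bounded interval with jumps of size bounded away from \<open>0\<close>, so \<^const>\<open>card\<close> is
  the genuine cardinality.\<close>

definition extreme_jump_count ::
    "real \<Rightarrow> (real \<Rightarrow> 'a \<Rightarrow> real) \<Rightarrow> real \<Rightarrow> real \<Rightarrow> real \<Rightarrow> 'a \<Rightarrow> nat" where
  "extreme_jump_count q X a b \<epsilon> \<omega> =
     card {t \<in> {a<..b}. Lim (at_left t) (\<lambda>s. X s \<omega>) < - 2 / sqrt (1 - q) + \<epsilon> \<and>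
                        X t \<omega> > 2 / sqrt (1 - q) - \<epsilon>}"

definition qOU_rate :: "real \<Rightarrow> real" where
  "qOU_rate q = 1 / (18 * pi\<^sup>2) * (1 - q) powr (3 / 2) *
     (\<Prod>k. (1 - q ^ Suc k) ^ 7 / (1 + q ^ Suc k) ^ 4)"

end

theory Submission
  imports Defs
begin

text \<open>Sample the process on a grid of mesh \<open>\<delta>\<close> and count the steps that lead from the
  lower to the upper \<open>\<epsilon>\<close>-corner of the state space. For a fixed cadlag path and a fine enough
  grid, the number of extreme jumps at level \<open>\<epsilon>\<close> lies between this count at any smaller level
  and at \<open>\<epsilon>\<close>, so it suffices to prove the Poisson limit for the grid counts along a suitable
  choice of \<open>\<delta>\<close> for each \<open>\<epsilon>\<close>.

  The \<open>k\<close>-th binomial moment of a grid count sums, over all \<open>k\<close>-sets of steps, the probability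
  that all of them are extreme. Between opposite corners the ratio of transition density and
  stationary density is uniformly bounded in time, tends to \<open>1\<close> for long times, and behaves like
  \<open>\<kappa> \<delta>\<close> for short times. Conditioning only at corner states, the Markov property therefore bounds
  every such probability by a product of factors. With horizon \<open>\<epsilon>\<^sup>-\<^sup>3\<close> and stationary corner
  mass \<open>\<tau> \<epsilon>\<^sup>3\<^sup>/\<^sup>2\<close>, the \<open>k\<close>-sets with a short gap are negligible, and the binomial moments converge
  to \<open>(\<kappa> \<tau>\<^sup>2)\<^sup>k / k!\<close>, the binomial moments of the Poisson law. Expanding the characteristic
  function in binomial moments and using Levy's continuity theorem finishes the proof.\<close>

section \<open>Extreme jumps of cadlag paths\<close>

text \<open>The time scale comes from the edge of the density, which vanishes there like a square
  root: a corner of width \<epsilon> has mass of order \<epsilon>^(3/2), so a step from one corner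
  to the other has probability of order \<delta> \<epsilon>^3. The factor \<delta> stems from 1 -
  exp (-2 \<delta>), the first factor of the q-Pochhammer symbol. On the diagonal the denominators
  \<open>qOU_phi\<close> degenerate for short times and offset it; between opposite edges they stay
  away from 0, and the factor survives. The mesh is chosen last, for given \<epsilon>, merely fine
  enough that the grid count probably equals the true one. No rate for it is available, so the
  moment estimates can use only that \<delta> tends to 0, and short gaps have to be measured in time
  rather than in steps. Paths are cadlag only almost surely, which is why the count is shown
  measurable for the completed measure.\<close>

definition jump_times :: "(real \<Rightarrow> real) \<Rightarrow> real \<Rightarrow> real \<Rightarrow> real \<Rightarrow> real set" where
  "jump_times f a b T = {t \<in> {0<..T}. Lim (at_left t) f < a \<and> f t > b}"

definition step_count :: "(real \<Rightarrow> real) \<Rightarrow> real \<Rightarrow> real \<Rightarrow> real \<Rightarrow> nat \<Rightarrow> nat" where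
  "step_count f a b d m = card {i. i < m \<and> f (real i * d) < a \<and> f (real (Suc i) * d) > b}"

lemma cadlag_left_limit:
  assumes "cadlag f" "0 < t"
  shows "(f \<longlongrightarrow> Lim (at_left t) f) (at_left t)"
proof -
  obtain l where "(f \<longlongrightarrow> l) (at_left t)" using assms unfolding cadlag_def by blast
  then show ?thesis using tendsto_Lim[of "at_left t" f l] by simp
qed

text \<open>At t = 0 no left limit is assumed; the restriction 0 \<le> s empties the left-hand
  clause there, so that compactness of \<open>{0..T}\<close> can be used without treating its left
  end separately.\<close>

lemma cadlag_nbhd:
  assumes "cadlag f" "0 \<le> t" "0 < \<eta>"
  obtains r where "0 < r" "\<And>s. t \<le> s \<Longrightarrow> s < t + r \<Longrightarrow> \<bar>f s - f t\<bar> < \<eta>"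
    "\<And>s. 0 \<le> s \<Longrightarrow> t - r < s \<Longrightarrow> s < t \<Longrightarrow> \<bar>f s - Lim (at_left t) f\<bar> < \<eta>"
proof -
  have "(f \<longlongrightarrow> f t) (at_right t)"
    using assms unfolding cadlag_def continuous_within by blast
  then have "\<forall>\<^sub>F s in at_right t. dist (f s) (f t) < \<eta>"
    using assms(3) by (rule tendstoD)
  then obtain b where b: "t < b" "\<And>s. t < s \<Longrightarrow> s < b \<Longrightarrow> \<bar>f s - f t\<bar> < \<eta>"
    unfolding eventually_at_right_field dist_real_def by blast
  have "\<exists>c<t. \<forall>s. 0 \<le> s \<longrightarrow> c < s \<longrightarrow> s < t \<longrightarrow> \<bar>f s - Lim (at_left t) f\<bar> < \<eta>"
  proof (cases "t = 0")
    case True then show ?thesis by (intro exI[of _ "-1"]) auto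
  next
    case False
    with assms have "\<forall>\<^sub>F s in at_left t. dist (f s) (Lim (at_left t) f) < \<eta>"
      using cadlag_left_limit by (intro tendstoD) auto
    then show ?thesis unfolding eventually_at_left_field dist_real_def by blast
  qed
  then obtain c where c: "c < t" "\<And>s. 0 \<le> s \<Longrightarrow> c < s \<Longrightarrow> s < t \<Longrightarrow> \<bar>f s - Lim (at_left t) f\<bar> < \<eta>"
    by blast
  show thesis
  proof (rule that[of "min (b - t) (t - c)"])
    show "\<bar>f s - f t\<bar> < \<eta>" if "t \<le> s" "s < t + min (b - t) (t - c)" for s
      using that b(2)[of s] assms(3) by (cases "s = t") auto
    show "\<bar>f s - Lim (at_left t) f\<bar> < \<eta>" if "0 \<le> s" "t - min (b - t) (t - c) < s" "s < t" for s
      using that c(2)[of s] by auto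
  qed (use b c in auto)
qed

text \<open>On either side of t, inside \<open>ball t (r t)\<close>, the path stays within \<eta> of
  one value, whereas a jump counted here has size above b - a = 2 \<eta>. So a ball contains no such
  jump except possibly at its centre, and finitely many balls cover \<open>{0..T}\<close>.\<close>

lemma finite_jump_times:
  assumes f: "cadlag f" and ab: "a < b"
  shows "finite (jump_times f a b T)"
proof -
  define \<eta> where "\<eta> = (b - a) / 2"
  have \<eta>: "0 < \<eta>" using ab by (simp add: \<eta>_def)
  have "\<forall>t\<in>{0..T}. \<exists>r>0. (\<forall>s. t \<le> s \<longrightarrow> s < t + r \<longrightarrow> \<bar>f s - f t\<bar> < \<eta>) \<and>
      (\<forall>s. 0 \<le> s \<longrightarrow> t - r < s \<longrightarrow> s < t \<longrightarrow> \<bar>f s - Lim (at_left t) f\<bar> < \<eta>)"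
    using cadlag_nbhd[OF f _ \<eta>] by (metis atLeastAtMost_iff)
  then obtain r where r: "\<And>t. t \<in> {0..T} \<Longrightarrow> 0 < r t"
    "\<And>t s. t \<in> {0..T} \<Longrightarrow> t \<le> s \<Longrightarrow> s < t + r t \<Longrightarrow> \<bar>f s - f t\<bar> < \<eta>"
    "\<And>t s. t \<in> {0..T} \<Longrightarrow> 0 \<le> s \<Longrightarrow> t - r t < s \<Longrightarrow> s < t \<Longrightarrow> \<bar>f s - Lim (at_left t) f\<bar> < \<eta>"
    by metis
  have only: "s = t" if t: "t \<in> {0..T}" and s: "s \<in> ball t (r t)" "s \<in> jump_times f a b T" for s t
  proof (rule ccontr)
    assume "s \<noteq> t"
    have s0: "0 < s" "f s > b" "Lim (at_left s) f < a"
      using s by (auto simp: jump_times_def)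
    have l: "(f \<longlongrightarrow> Lim (at_left s) f) (at_left s)" using cadlag_left_limit[OF f s0(1)] .
    \<comment> \<open>The one-sided value of the path at t on the side where s lies.\<close>
    define c where "c = (if t < s then f t else Lim (at_left t) f)"
    have near: "\<bar>f u - c\<bar> < \<eta>" if "max 0 (if t < s then t else t - r t) < u" "u \<le> s" for u
      using that r(2)[OF t, of u] r(3)[OF t, of u] s \<open>s \<noteq> t\<close> by (auto simp: c_def dist_real_def split: if_splits)
    have "max 0 (if t < s then t else t - r t) < s"
      using s0 s \<open>s \<noteq> t\<close> by (auto simp: dist_real_def)
    then have "\<forall>\<^sub>F u in at_left s. u \<in> {max 0 (if t < s then t else t - r t)<..<s}"
      by (rule eventually_at_left_real)
    then have ev: "\<forall>\<^sub>F u in at_left s. c - \<eta> \<le> f u"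
    proof eventually_elim
      case (elim u)
      then have "\<bar>f u - c\<bar> < \<eta>" by (intro near) auto
      then show ?case by linarith
    qed
    have "c - \<eta> \<le> Lim (at_left s) f"
      using tendsto_lowerbound[OF l ev] by simp
    moreover have "\<bar>f s - c\<bar> < \<eta>" using near[of s] \<open>max 0 _ < s\<close> by simp
    moreover have "2 * \<eta> = b - a" by (simp add: \<eta>_def)
    ultimately show False using s0 by linarith
  qed
  obtain C where C: "C \<subseteq> {0..T}" "finite C" "{0..T} \<subseteq> (\<Union>t\<in>C. ball t (r t))"
  proof (rule compactE_image[of "{0..T}" "{0..T}" "\<lambda>t. ball t (r t)"])
    show "{0..T} \<subseteq> (\<Union>t\<in>{0..T}. ball t (r t))" using r(1) by force
  qed auto
  have "jump_times f a b T \<subseteq> C"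
  proof
    fix s assume s: "s \<in> jump_times f a b T"
    then have "s \<in> {0..T}" by (auto simp: jump_times_def)
    then obtain t where t: "t \<in> C" "s \<in> ball t (r t)" using C(3) by blast
    then have "s = t" using C(1) by (intro only[OF _ t(2) s]) auto
    then show "s \<in> C" using t(1) by simp
  qed
  then show ?thesis using C finite_subset by blast
qed

text \<open>The jump inequalities are strict, so they persist on one-sided neighbourhoods of each
  jump time; since there are finitely many jumps, one mesh size suits all. Two jumps in one cell are
  impossible: the earlier one has value above b at a time when the path must already be below a in
  preparation for the later one.\<close>

lemma card_jump_times_le_step_count:
  assumes f: "cadlag f" and ab: "a < b" and T: "0 < T"
  shows "\<forall>\<^sub>F m in sequentially. card (jump_times f a b T) \<le> step_count f a b (T / real m) m"
proof -
  let ?J = "jump_times f a b T"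
  have "\<exists>r>0. (\<forall>s. 0 \<le> s \<longrightarrow> t - r < s \<longrightarrow> s < t \<longrightarrow> f s < a) \<and> (\<forall>s. t \<le> s \<longrightarrow> s < t + r \<longrightarrow> f s > b)"
    if t: "t \<in> ?J" for t
  proof -
    have t0: "0 < t" "f t > b" "Lim (at_left t) f < a" using t by (auto simp: jump_times_def)
    define \<eta> where "\<eta> = min (f t - b) (a - Lim (at_left t) f)"
    have "0 < \<eta>" "0 \<le> t" using t0 by (auto simp: \<eta>_def)
    from cadlag_nbhd[OF f this(2,1)] obtain r where r: "0 < r"
      "\<And>s. t \<le> s \<Longrightarrow> s < t + r \<Longrightarrow> \<bar>f s - f t\<bar> < \<eta>"
      "\<And>s. 0 \<le> s \<Longrightarrow> t - r < s \<Longrightarrow> s < t \<Longrightarrow> \<bar>f s - Lim (at_left t) f\<bar> < \<eta>" by blast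
    show ?thesis
    proof (intro exI[of _ r] conjI allI impI)
      show "f s < a" if "0 \<le> s" "t - r < s" "s < t" for s
        using r(3)[OF that] by (auto simp: \<eta>_def)
      show "f s > b" if "t \<le> s" "s < t + r" for s
        using r(2)[OF that] by (auto simp: \<eta>_def)
    qed (fact r(1))
  qed
  then obtain r where r: "\<And>t. t \<in> ?J \<Longrightarrow> 0 < r t"
    "\<And>t s. t \<in> ?J \<Longrightarrow> 0 \<le> s \<Longrightarrow> t - r t < s \<Longrightarrow> s < t \<Longrightarrow> f s < a"
    "\<And>t s. t \<in> ?J \<Longrightarrow> t \<le> s \<Longrightarrow> s < t + r t \<Longrightarrow> f s > b" by metis
  have fin: "finite ?J" using finite_jump_times[OF f ab] .
  have lim: "(\<lambda>m. T / real m) \<longlonglongrightarrow> 0" by (rule lim_const_over_n)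
  have "\<forall>\<^sub>F m in sequentially. \<forall>t\<in>?J. T / real m < r t"
    using fin lim r(1) by (intro eventually_ball_finite ballI order_tendstoD) auto
  then show ?thesis using eventually_gt_at_top[of 0]
  proof eventually_elim
    fix m :: nat assume mr: "\<forall>t\<in>?J. T / real m < r t" and m: "0 < m"
    define d where "d = T / real m"
    have d: "0 < d" "real m * d = T" using T m by (auto simp: d_def)
    \<comment> \<open>Index of the grid cell that contains t, open on the left and closed on the
      right: a jump at a grid point belongs to the cell ending there.\<close>
    define ix where "ix t = nat (\<lceil>t / d\<rceil> - 1)" for t
    have ix: "real (ix t) * d < t" "t \<le> real (Suc (ix t)) * d" "ix t < m" if "t \<in> ?J" for t
    proof -
      have t: "0 < t" "t \<le> T" using that by (auto simp: jump_times_def)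
      have "1 \<le> \<lceil>t / d\<rceil>" using t d by (simp add: one_le_ceiling)
      then have e: "real (ix t) = of_int \<lceil>t / d\<rceil> - 1" by (simp add: ix_def)
      have "real (ix t) < t / d" "t / d \<le> real (Suc (ix t))"
        unfolding of_nat_Suc e using ceiling_correct[of "t / d"] by linarith+
      then show A: "real (ix t) * d < t" "t \<le> real (Suc (ix t)) * d"
        using d by (simp_all add: pos_less_divide_eq pos_divide_le_eq)
      then have "real (ix t) * d < real m * d" using t d by simp
      then have "real (ix t) < real m" using d(1) by (rule mult_right_less_imp_less[OF _ less_imp_le])
      then show "ix t < m" by simp
    qed
    have "card ?J \<le> card {i. i < m \<and> f (real i * d) < a \<and> f (real (Suc i) * d) > b}"
    proof (rule card_inj_on_le[of ix])
      have contra: False if "s \<in> ?J" "t \<in> ?J" "ix s = ix t" "s < t" for s t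
      proof -
        have "t - r t < s" using ix(1,2)[OF that(1)] ix(1,2)[OF that(2)] that(3) mr that(2)
          unfolding d_def[symmetric] by (auto simp: algebra_simps)
        then have "f s < a" using r(2)[OF that(2) _ _ that(4)] that by (auto simp: jump_times_def)
        moreover have "f s > b" using that by (auto simp: jump_times_def)
        ultimately show False using ab by simp
      qed
      show "inj_on ix ?J"
        by (rule inj_onI) (metis contra linorder_less_linear)
      show "ix ` ?J \<subseteq> {i. i < m \<and> f (real i * d) < a \<and> f (real (Suc i) * d) > b}"
      proof safe
        fix t assume t: "t \<in> ?J"
        have dr: "d < r t" using mr t by (simp add: d_def)
        show "ix t < m" using ix[OF t] by simp
        show "f (real (ix t) * d) < a"
          using ix[OF t] dr d by (intro r(2)[OF t]) (auto simp: algebra_simps)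
        show "f (real (Suc (ix t)) * d) > b"
          using ix[OF t] dr d by (intro r(3)[OF t]) (auto simp: algebra_simps)
      qed
    qed auto
    then show "card ?J \<le> step_count f a b (T / real m) m" by (simp add: step_count_def d_def)
  qed
qed

text \<open>A step of length below the Lebesgue number e of the covering by oscillation balls lies
  in one ball, and it can be extreme only by a jump at the centre t of that ball. Left limit and
  value at t are then known only up to \<eta> from the two grid values, which is why the levels a, b
  are weaker than a', b'.\<close>

lemma step_count_le_card_jump_times:
  assumes f: "cadlag f" and ab: "a' < a" "a < b" "b < b'" and T: "0 < T"
  shows "\<forall>\<^sub>F m in sequentially. step_count f a' b' (T / real m) m \<le> card (jump_times f a b T)"
proof -
  let ?J = "jump_times f a b T"
  \<comment> \<open>The bound (b - a) / 2 forces t to lie between the two grid points; the other two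
    carry the levels over to the left limit and the value at t.\<close>
  define \<eta> where "\<eta> = min ((b - a) / 2) (min (a - a') (b' - b))"
  have \<eta>: "0 < \<eta>" using ab by (simp add: \<eta>_def)
  have "\<forall>t\<in>{0..T}. \<exists>r>0. (\<forall>s. t \<le> s \<longrightarrow> s < t + r \<longrightarrow> \<bar>f s - f t\<bar> < \<eta>) \<and>
      (\<forall>s. 0 \<le> s \<longrightarrow> t - r < s \<longrightarrow> s < t \<longrightarrow> \<bar>f s - Lim (at_left t) f\<bar> < \<eta>)"
    using cadlag_nbhd[OF f _ \<eta>] by (metis atLeastAtMost_iff)
  then obtain r where r: "\<And>t. t \<in> {0..T} \<Longrightarrow> 0 < r t"
    "\<And>t s. t \<in> {0..T} \<Longrightarrow> t \<le> s \<Longrightarrow> s < t + r t \<Longrightarrow> \<bar>f s - f t\<bar> < \<eta>"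
    "\<And>t s. t \<in> {0..T} \<Longrightarrow> 0 \<le> s \<Longrightarrow> t - r t < s \<Longrightarrow> s < t \<Longrightarrow> \<bar>f s - Lim (at_left t) f\<bar> < \<eta>"
    by metis
  obtain e where e: "0 < e" "\<And>u. u \<in> {0..T} \<Longrightarrow> \<exists>G\<in>(\<lambda>t. ball t (r t)) ` {0..T}. ball u e \<subseteq> G"
  proof -
    have "compact {0..T}" "{0..T} \<subseteq> \<Union> ((\<lambda>t. ball t (r t)) ` {0..T})"
      "\<And>G. G \<in> (\<lambda>t. ball t (r t)) ` {0..T} \<Longrightarrow> open G" using r(1) by (auto intro!: bexI)
    from Heine_Borel_lemma[OF this] that show thesis by metis
  qed
  have found: "\<exists>t\<in>?J. u < t \<and> t \<le> v"
    if uv: "0 \<le> u" "u < v" "v \<le> T" "v - u < e" "f u < a'" "f v > b'" for u v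
  proof -
    obtain t where t: "t \<in> {0..T}" "ball u e \<subseteq> ball t (r t)" using e(2)[of u] uv by auto
    have "u \<in> ball u e" "v \<in> ball u e" using uv e(1) by (auto simp: dist_real_def)
    then have "u \<in> ball t (r t)" "v \<in> ball t (r t)" using t(2) by blast+
    then have uv': "\<bar>u - t\<bar> < r t" "\<bar>v - t\<bar> < r t" by (auto simp: dist_real_def)
    have "\<eta> \<le> (b - a) / 2" unfolding \<eta>_def by (rule min.cobounded1)
    then have \<eta>': "2 * \<eta> \<le> b - a" by (simp add: field_simps)
    have \<eta>'': "\<eta> \<le> a - a'" "\<eta> \<le> b' - b" by (auto simp: \<eta>_def)
    have "u < t"
    proof (rule ccontr)
      assume "\<not> u < t"
      then have "\<bar>f u - f t\<bar> < \<eta>" "\<bar>f v - f t\<bar> < \<eta>" using uv uv' by (auto intro!: r(2)[OF t(1)])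
      then show False using uv ab \<eta>' \<eta>'' by linarith
    qed
    then have lu: "\<bar>f u - Lim (at_left t) f\<bar> < \<eta>" using uv uv' by (intro r(3)[OF t(1)]) auto
    have "t \<le> v"
    proof (rule ccontr)
      assume "\<not> t \<le> v"
      then have "\<bar>f v - Lim (at_left t) f\<bar> < \<eta>" using uv uv' by (intro r(3)[OF t(1)]) auto
      then show False using uv ab lu \<eta>' \<eta>'' by linarith
    qed
    then have "\<bar>f v - f t\<bar> < \<eta>" using uv' by (intro r(2)[OF t(1)]) auto
    then have "t \<in> ?J" using lu \<eta>'' uv t \<open>u < t\<close> \<open>t \<le> v\<close>
      by (auto simp: jump_times_def abs_less_iff)
    then show ?thesis using \<open>u < t\<close> \<open>t \<le> v\<close> by blast
  qed
  have lim: "(\<lambda>m. T / real m) \<longlonglongrightarrow> 0" by (rule lim_const_over_n)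
  have "\<forall>\<^sub>F m in sequentially. T / real m < e"
    using lim e(1) by (intro order_tendstoD) auto
  then show ?thesis using eventually_gt_at_top[of 0]
  proof eventually_elim
    fix m :: nat assume me: "T / real m < e" and m: "0 < m"
    define d where "d = T / real m"
    have d: "0 < d" "real m * d = T" "d < e" using T m me by (auto simp: d_def)
    let ?I = "{i. i < m \<and> f (real i * d) < a' \<and> f (real (Suc i) * d) > b'}"
    have "\<exists>t\<in>?J. real i * d < t \<and> t \<le> real (Suc i) * d" if i: "i \<in> ?I" for i
    proof (rule found)
      have "real (Suc i) * d \<le> real m * d" using i d by (intro mult_right_mono) auto
      then show "real (Suc i) * d \<le> T" using d by simp
    qed (use i d in \<open>auto simp: algebra_simps\<close>)
    then have "\<exists>h. \<forall>i\<in>?I. h i \<in> ?J \<and> real i * d < h i \<and> h i \<le> real (Suc i) * d"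
      by (intro bchoice) blast
    then obtain h where h: "\<And>i. i \<in> ?I \<Longrightarrow> h i \<in> ?J \<and> real i * d < h i \<and> h i \<le> real (Suc i) * d"
      by blast
    have "card ?I \<le> card ?J"
    proof (rule card_inj_on_le[of h])
      show "inj_on h ?I"
      proof (rule inj_onI)
        fix i j assume ij: "i \<in> ?I" "j \<in> ?I" "h i = h j"
        have "real i * d < real (Suc j) * d" "real j * d < real (Suc i) * d"
          using h[OF ij(1)] h[OF ij(2)] ij(3) by (metis le_less_trans less_le_trans)+
        then have "real i < real (Suc j)" "real j < real (Suc i)"
          using d(1) by (metis less_imp_le mult_right_less_imp_less)+
        then show "i = j" by simp
      qed
    qed (use h finite_jump_times[OF f ab(2)] in auto)
    then show "step_count f a' b' (T / real m) m \<le> card ?J" by (simp add: step_count_def d_def)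
  qed
qed

lemma step_count_mono:
  assumes "a' \<le> a" "b \<le> b'"
  shows "step_count f a' b' d m \<le> step_count f a b d m"
  unfolding step_count_def using assms by (intro card_mono) auto

section \<open>Sums over well separated index sets\<close>

lemma power_add_ge_linear:
  fixes x s :: real
  assumes "0 \<le> x" "0 \<le> s"
  shows "x ^ Suc k + real (Suc k) * s * x ^ k \<le> (x + s) ^ Suc k"
proof (induction k)
  case (Suc k)
  have "x ^ Suc (Suc k) + real (Suc (Suc k)) * s * x ^ Suc k
      \<le> (x ^ Suc k + real (Suc k) * s * x ^ k) * (x + s)"
    using assms by (simp add: algebra_simps)
  also have "\<dots> \<le> (x + s) ^ Suc k * (x + s)"
    using assms by (intro mult_right_mono Suc.IH) auto
  finally show ?case by (simp add: mult.commute)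
qed simp

lemma power_diff_le_linear:
  fixes x y :: real
  assumes "0 \<le> x" "x \<le> y"
  shows "y ^ Suc k \<le> x ^ Suc k + real (Suc k) * (y - x) * y ^ k"
proof (induction k)
  case (Suc k)
  have "y ^ Suc (Suc k) \<le> y * (x ^ Suc k + real (Suc k) * (y - x) * y ^ k)"
    using mult_left_mono[OF Suc.IH, of y] assms by simp
  also have "\<dots> = x ^ Suc (Suc k) + (y - x) * x ^ Suc k + real (Suc k) * (y - x) * y ^ Suc k"
    by (simp add: algebra_simps)
  also have "\<dots> \<le> x ^ Suc (Suc k) + (y - x) * y ^ Suc k + real (Suc k) * (y - x) * y ^ Suc k"
    using assms by (intro add_mono mult_left_mono power_mono) auto
  also have "\<dots> = x ^ Suc (Suc k) + real (Suc (Suc k)) * (y - x) * y ^ Suc k"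
    by (simp add: algebra_simps)
  finally show ?case .
qed simp

text \<open>A left Riemann sum of an increasing function, compared with the integral of u^k from x
  to j + x.\<close>

lemma sum_power_shift_le:
  fixes x :: real
  assumes "0 \<le> x"
  shows "real (Suc k) * (\<Sum>l<j. (real l + x) ^ k) \<le> (real j + x) ^ Suc k"
proof (induction j)
  case (Suc j)
  have "real (Suc k) * (\<Sum>l<Suc j. (real l + x) ^ k)
      \<le> (real j + x) ^ Suc k + real (Suc k) * 1 * (real j + x) ^ k"
    using Suc.IH by (simp add: distrib_left)
  also have "\<dots> \<le> ((real j + x) + 1) ^ Suc k"
    using assms by (intro power_add_ge_linear) auto
  finally show ?case by (simp add: add_ac)
qed (use assms in simp)

text \<open>The same comparison from below, for the positive part of u - x. The terms l = 1, ..., n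
  - 1 form a right Riemann sum over \<open>{0..n - 1}\<close>, which explains the loss of 1.\<close>

lemma sum_power_shift_ge:
  fixes x :: real
  assumes "0 \<le> x"
  shows "(max 0 (real n - 1 - x)) ^ Suc k \<le> real (Suc k) * (\<Sum>l<n. (max 0 (real l - x)) ^ k)"
proof (induction n)
  case 0
  then show ?case using assms by (simp add: max_def)
next
  case (Suc n)
  define y where "y = max 0 (real n - x)"
  define z where "z = max 0 (real n - 1 - x)"
  have yz: "0 \<le> z" "z \<le> y" "y - z \<le> 1" by (auto simp: y_def z_def max_def)
  have "y ^ Suc k \<le> z ^ Suc k + real (Suc k) * (y - z) * y ^ k"
    by (rule power_diff_le_linear) (use yz in auto)
  also have "\<dots> \<le> z ^ Suc k + real (Suc k) * 1 * y ^ k"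
    using yz by (intro add_left_mono mult_right_mono mult_left_mono) auto
  also have "\<dots> \<le> real (Suc k) * (\<Sum>l<n. (max 0 (real l - x)) ^ k) + real (Suc k) * 1 * y ^ k"
    using Suc.IH by (simp add: z_def)
  finally have "y ^ Suc k \<le> real (Suc k) * (\<Sum>l<Suc n. (max 0 (real l - x)) ^ k)"
    by (simp add: distrib_left y_def)
  then show ?case by (simp add: y_def)
qed

text \<open>In the application \<open>a k j\<close> is the probability that step \<open>j\<close> is extreme, summed over all ways
  of choosing \<open>k\<close> further extreme steps before it. The bound for \<open>a (Suc k) j\<close> splits off the
  last of these, \<open>l\<close>; a gap \<open>j - l \<le> g\<close> is short and costs an additional factor.\<close>

lemma renewal_upper_bound:
  fixes a :: "nat \<Rightarrow> nat \<Rightarrow> real"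
  assumes nonneg: "0 \<le> P" "1 \<le> h" "0 \<le> C"
    and base: "\<And>j. a 0 j \<le> P"
    and rec: "\<And>k j. a (Suc k) j \<le> P * (\<Sum>l<j. (h + (if j - l \<le> g then C else 0)) * a k l)"
  shows "a k j \<le> P ^ Suc k * h ^ k * (real j + real k * (real g * C)) ^ k / fact k"
proof (induction k arbitrary: j)
  case 0
  then show ?case using base by simp
next
  case (Suc k)
  \<comment> \<open>Total excess weight of the at most g short gaps. Each further gap shifts the
    time variable by s, and \<open>power_add_ge_linear\<close> absorbs the excess into the next
    power.\<close>
  define s where "s = real g * C"
  define K where "K = P ^ Suc k * h ^ k / fact k"
  define x where "x = real j + real k * s"
  have s: "0 \<le> s" "0 \<le> x" and K: "0 \<le> K" using nonneg by (simp_all add: s_def K_def x_def)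
  have IH: "a k l \<le> K * (real l + real k * s) ^ k" for l
    using Suc.IH[of l] by (simp add: K_def s_def)
  have "(\<Sum>l<j. (h + (if j - l \<le> g then C else 0)) * a k l)
      \<le> (\<Sum>l<j. (h + (if j - l \<le> g then C else 0)) * (K * (real l + real k * s) ^ k))"
    using IH nonneg by (intro sum_mono mult_left_mono) auto
  also have "\<dots> = h * K * (\<Sum>l<j. (real l + real k * s) ^ k)
      + (\<Sum>l<j. if j - l \<le> g then C * (K * (real l + real k * s) ^ k) else 0)"
    unfolding sum_distrib_left sum.distrib[symmetric] by (intro sum.cong refl) (simp add: algebra_simps)
  also have "(\<Sum>l<j. if j - l \<le> g then C * (K * (real l + real k * s) ^ k) else 0)
      = (\<Sum>l\<in>{l. l < j \<and> j - l \<le> g}. C * (K * (real l + real k * s) ^ k))"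
    by (subst sum.inter_filter[symmetric]) auto
  also have "\<dots> \<le> (\<Sum>l\<in>{l. l < j \<and> j - l \<le> g}. C * (K * x ^ k))"
    using nonneg K s by (intro sum_mono mult_left_mono power_mono) (auto simp: x_def)
  also have "\<dots> = real (card {l. l < j \<and> j - l \<le> g}) * (C * (K * x ^ k))" by simp
  also have "\<dots> \<le> real g * (C * (K * x ^ k))"
  proof (intro mult_right_mono)
    have "card {l. l < j \<and> j - l \<le> g} \<le> card {j - g..<j}" by (intro card_mono) auto
    then show "real (card {l. l < j \<and> j - l \<le> g}) \<le> real g" by simp
  qed (use nonneg K s in auto)
  \<comment> \<open>Because 1 \<le> h, the short-gap term may carry the factor h as well, and a
    common power of h comes out.\<close>
  also have "\<dots> \<le> h * (real g * (C * (K * x ^ k)))"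
    using mult_right_mono[of 1 h "real g * (C * (K * x ^ k))"] nonneg K s by simp
  also have "h * K * (\<Sum>l<j. (real l + real k * s) ^ k) + h * (real g * (C * (K * x ^ k)))
     = h * K / real (Suc k) * (real (Suc k) * (\<Sum>l<j. (real l + real k * s) ^ k) + real (Suc k) * s * x ^ k)"
    by (simp add: s_def field_simps del: of_nat_Suc)
  also have "\<dots> \<le> h * K / real (Suc k) * (x ^ Suc k + real (Suc k) * s * x ^ k)"
    using sum_power_shift_le[of "real k * s" k j] nonneg K s
    by (intro mult_left_mono add_right_mono) (auto simp: x_def)
  also have "\<dots> \<le> h * K / real (Suc k) * (x + s) ^ Suc k"
    using nonneg K s by (intro mult_left_mono power_add_ge_linear) auto
  finally have "(\<Sum>l<j. (h + (if j - l \<le> g then C else 0)) * a k l) \<le> h * K / real (Suc k) * (x + s) ^ Suc k"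
    by simp
  from mult_left_mono[OF this nonneg(1)]
  have "a (Suc k) j \<le> P * (h * K / real (Suc k) * (x + s) ^ Suc k)" using rec order_trans by blast
  also have "x + s = real j + real (Suc k) * (real g * C)" by (simp add: x_def s_def algebra_simps)
  finally show ?case by (simp add: K_def field_simps)
qed

lemma renewal_sum_upper_bound:
  fixes a :: "nat \<Rightarrow> nat \<Rightarrow> real"
  assumes nonneg: "0 \<le> P" "1 \<le> h" "0 \<le> C"
    and base: "\<And>j. a 0 j \<le> P"
    and rec: "\<And>k j. a (Suc k) j \<le> P * (\<Sum>l<j. (h + (if j - l \<le> g then C else 0)) * a k l)"
  shows "(\<Sum>j<m. a k j) \<le> P ^ Suc k * h ^ k * (real m + real k * (real g * C)) ^ Suc k / fact (Suc k)"
proof -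
  let ?x = "real k * (real g * C)"
  have "(\<Sum>j<m. a k j) \<le> (\<Sum>j<m. P ^ Suc k * h ^ k * (real j + ?x) ^ k / fact k)"
    by (intro sum_mono renewal_upper_bound assms)
  also have "\<dots> = P ^ Suc k * h ^ k / fact (Suc k) * (real (Suc k) * (\<Sum>j<m. (real j + ?x) ^ k))"
    by (simp add: sum_distrib_left sum_divide_distrib[symmetric] field_simps del: of_nat_Suc)
  also have "\<dots> \<le> P ^ Suc k * h ^ k / fact (Suc k) * (real m + ?x) ^ Suc k"
    using nonneg by (intro mult_left_mono sum_power_shift_le) auto
  finally show ?thesis by simp
qed

text \<open>Short gaps are simply discarded, so every gap costs g steps, plus the one lost in
  \<open>sum_power_shift_ge\<close>; this accounts for the multiples of \<open>Suc g\<close>. The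
  positive part covers indices j too small to hold k such gaps.\<close>

lemma renewal_lower_bound:
  fixes a :: "nat \<Rightarrow> nat \<Rightarrow> real"
  assumes nonneg: "0 \<le> P" "0 \<le> h"
    and base: "\<And>j. P \<le> a 0 j"
    and rec: "\<And>k j. P * (\<Sum>l<j. if j - l \<le> g then 0 else h * a k l) \<le> a (Suc k) j"
  shows "P ^ Suc k * h ^ k * (max 0 (real j - real k * real (Suc g))) ^ k / fact k \<le> a k j"
proof (induction k arbitrary: j)
  case 0
  then show ?case using base by simp
next
  case (Suc k)
  define K where "K = P ^ Suc k * h ^ k / fact k"
  define x where "x = real k * real (Suc g)"
  have K: "0 \<le> K" "0 \<le> x" using nonneg by (simp_all add: K_def x_def)
  have IH: "K * (max 0 (real l - x)) ^ k \<le> a k l" for l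
    using Suc.IH[of l] by (simp add: K_def x_def)
  have "h * K / real (Suc k) * (max 0 (real j - (x + real (Suc g)))) ^ Suc k
      \<le> h * K / real (Suc k) * (max 0 (real (j - g) - 1 - x)) ^ Suc k"
    using nonneg K by (intro mult_left_mono power_mono) (auto simp: max_def)
  also have "\<dots> \<le> h * K / real (Suc k) * (real (Suc k) * (\<Sum>l<j - g. (max 0 (real l - x)) ^ k))"
    using nonneg K by (intro mult_left_mono sum_power_shift_ge) auto
  also have "\<dots> = (\<Sum>l<j - g. h * (K * (max 0 (real l - x)) ^ k))"
    by (simp add: sum_distrib_left mult.assoc del: of_nat_Suc)
  also have "\<dots> \<le> (\<Sum>l<j - g. h * a k l)"
    using IH nonneg by (intro sum_mono mult_left_mono) auto
  also have "\<dots> = (\<Sum>l<j. if j - l \<le> g then 0 else h * a k l)"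
    by (intro sum.mono_neutral_cong_left) auto
  finally have "h * K / real (Suc k) * (max 0 (real j - (x + real (Suc g)))) ^ Suc k \<le> \<dots>" .
  from mult_left_mono[OF this nonneg(1)]
  have "P * (h * K / real (Suc k) * (max 0 (real j - (x + real (Suc g)))) ^ Suc k) \<le> a (Suc k) j"
    using rec order_trans by blast
  moreover have "x + real (Suc g) = real (Suc k) * real (Suc g)" by (simp add: x_def algebra_simps)
  ultimately show ?case by (simp add: K_def field_simps)
qed

lemma renewal_sum_lower_bound:
  fixes a :: "nat \<Rightarrow> nat \<Rightarrow> real"
  assumes nonneg: "0 \<le> P" "0 \<le> h"
    and base: "\<And>j. P \<le> a 0 j"
    and rec: "\<And>k j. P * (\<Sum>l<j. if j - l \<le> g then 0 else h * a k l) \<le> a (Suc k) j"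
  shows "P ^ Suc k * h ^ k * (max 0 (real m - 1 - real k * real (Suc g))) ^ Suc k / fact (Suc k)
    \<le> (\<Sum>j<m. a k j)"
proof -
  let ?x = "real k * real (Suc g)"
  have "P ^ Suc k * h ^ k * (max 0 (real m - 1 - ?x)) ^ Suc k / fact (Suc k)
      = P ^ Suc k * h ^ k / fact (Suc k) * (max 0 (real m - 1 - ?x)) ^ Suc k" by simp
  also have "\<dots> \<le> P ^ Suc k * h ^ k / fact (Suc k) * (real (Suc k) * (\<Sum>j<m. (max 0 (real j - ?x)) ^ k))"
    using nonneg by (intro mult_left_mono sum_power_shift_ge) auto
  also have "\<dots> = (\<Sum>j<m. P ^ Suc k * h ^ k * (max 0 (real j - ?x)) ^ k / fact k)"
    by (simp add: sum_distrib_left sum_divide_distrib[symmetric] field_simps del: of_nat_Suc)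
  also have "\<dots> \<le> (\<Sum>j<m. a k j)"
    by (intro sum_mono renewal_lower_bound assms)
  finally show ?thesis .
qed

section \<open>Poisson convergence from binomial moments\<close>

text \<open>With z = \<open>iexp t - 1\<close> the binomial theorem expands (1 + z)^D. The bound m
  makes this a finite sum, so expectation and sum commute; the result is written as a series so that
  m may later vary with n.\<close>

lemma (in prob_space) char_bounded_nat_binomial_moments:
  assumes [measurable]: "D \<in> measurable M (count_space UNIV)" and bd: "\<And>\<omega>. \<omega> \<in> space M \<Longrightarrow> D \<omega> \<le> m"
  shows "char (distr M borel (\<lambda>\<omega>. real (D \<omega>))) t =
    (\<Sum>k. complex_of_real (expectation (\<lambda>\<omega>. real (D \<omega> choose k))) * (iexp t - 1) ^ k)"
proof -
  define z where "z = iexp t - 1"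
  have exp_eq: "iexp (t * real (D \<omega>)) = (\<Sum>k\<le>m. complex_of_real (real (D \<omega> choose k)) * z ^ k)"
    if "\<omega> \<in> space M" for \<omega>
  proof -
    have "iexp (t * real (D \<omega>)) = (z + 1) ^ D \<omega>"
      by (simp add: z_def exp_of_nat_mult[symmetric] mult_ac)
    also have "\<dots> = (\<Sum>k\<le>D \<omega>. complex_of_real (real (D \<omega> choose k)) * z ^ k)"
      by (simp add: binomial_ring)
    also have "\<dots> = (\<Sum>k\<le>m. complex_of_real (real (D \<omega> choose k)) * z ^ k)"
      using bd[OF that] by (intro sum.mono_neutral_left) (auto simp: binomial_eq_0)
    finally show ?thesis .
  qed
  have int: "integrable M (\<lambda>\<omega>. real (D \<omega> choose k))" for k
  proof (rule integrable_const_bound[where B="2 ^ m"])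
    show "AE \<omega> in M. norm (real (D \<omega> choose k)) \<le> 2 ^ m"
    proof (rule AE_I2)
      fix \<omega> assume "\<omega> \<in> space M"
      then have "(2::nat) ^ D \<omega> \<le> 2 ^ m" using bd by (intro power_increasing) auto
      then have "(D \<omega> choose k) \<le> 2 ^ m" using binomial_le_pow2 by (rule order_trans[rotated])
      then have "real (D \<omega> choose k) \<le> real (2 ^ m)" by (rule of_nat_mono)
      then show "norm (real (D \<omega> choose k)) \<le> 2 ^ m" by simp
    qed
  qed measurable
  have zero: "expectation (\<lambda>\<omega>. real (D \<omega> choose k)) = 0" if "k \<notin> {..m}" for k
  proof -
    have "expectation (\<lambda>\<omega>. real (D \<omega> choose k)) = expectation (\<lambda>\<omega>. 0)"
      using that bd by (intro Bochner_Integration.integral_cong) (fastforce simp: binomial_eq_0)+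
    then show ?thesis by simp
  qed
  have "char (distr M borel (\<lambda>\<omega>. real (D \<omega>))) t = (CLINT \<omega>|M. iexp (t * real (D \<omega>)))"
    unfolding char_def by (subst integral_distr) auto
  also have "\<dots> = (CLINT \<omega>|M. \<Sum>k\<le>m. complex_of_real (real (D \<omega> choose k)) * z ^ k)"
    by (intro Bochner_Integration.integral_cong exp_eq refl)
  also have "\<dots> = (\<Sum>k\<le>m. complex_of_real (expectation (\<lambda>\<omega>. real (D \<omega> choose k))) * z ^ k)"
    using int by (subst Bochner_Integration.integral_sum)
      (auto intro!: integrable_mult_left integrable_of_real simp: integral_complex_of_real simp del: of_real_of_nat_eq)
  also have "\<dots> = (\<Sum>k. complex_of_real (expectation (\<lambda>\<omega>. real (D \<omega> choose k))) * z ^ k)"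
    by (rule suminf_finite[symmetric]) (auto simp: zero)
  finally show ?thesis by (simp add: z_def)
qed

text \<open>In this form the power series in \<open>iexp t - 1\<close> has the coefficients
  \<alpha>^k / k!, the binomial moments of the Poisson law.\<close>

lemma char_poisson:
  assumes "0 < \<alpha>"
  shows "char (distr (measure_pmf (poisson_pmf \<alpha>)) borel real) t = exp (complex_of_real \<alpha> * (iexp t - 1))"
proof -
  let ?f = "\<lambda>k. pmf (poisson_pmf \<alpha>) k *\<^sub>R iexp (t * real k)"
  let ?w = "complex_of_real \<alpha> * iexp t"
  have f: "?f k = complex_of_real (exp (- \<alpha>)) * (?w ^ k /\<^sub>R fact k)" for k
    using assms by (simp add: scaleR_conv_of_real power_mult_distrib exp_of_nat_mult[symmetric] field_simps)
  have sums: "?f sums (complex_of_real (exp (- \<alpha>)) * exp ?w)"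
    unfolding f by (intro sums_mult exp_converges)
  have nrm: "norm (?f k) = pmf (poisson_pmf \<alpha>) k" for k by simp
  have "(\<lambda>k. (\<alpha> ^ k /\<^sub>R fact k) * exp (-\<alpha>)) sums (exp \<alpha> * exp (-\<alpha>))"
    by (intro sums_mult2 exp_converges)
  moreover have "pmf (poisson_pmf \<alpha>) = (\<lambda>k. (\<alpha> ^ k /\<^sub>R fact k) * exp (-\<alpha>))"
    using assms by (intro ext) (simp add: field_simps)
  ultimately have "summable (pmf (poisson_pmf \<alpha>))" by (simp add: sums_iff)
  then have int: "integrable (count_space UNIV) ?f"
    unfolding integrable_count_space_nat_iff nrm .
  have "char (distr (measure_pmf (poisson_pmf \<alpha>)) borel real) t = (CLINT k|measure_pmf (poisson_pmf \<alpha>). iexp (t * real k))"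
    unfolding char_def by (subst integral_distr) auto
  also have "\<dots> = (CLINT k|count_space UNIV. ?f k)"
    unfolding measure_pmf_eq_density by (subst integral_density) auto
  also have "\<dots> = complex_of_real (exp (- \<alpha>)) * exp ?w"
    using integral_count_space_nat[OF int] sums by (simp add: sums_iff)
  also have "\<dots> = exp (complex_of_real \<alpha> * (iexp t - 1))"
    by (simp add: exp_of_real[symmetric] exp_add[symmetric] algebra_simps del: exp_of_real)
  finally show ?thesis .
qed

text \<open>The series in binomial moments converges termwise, and Tannery's theorem exchanges limit
  and sum. It needs a bound valid for all k from a common n on, hence the quantifier over k inside
  \<open>dom\<close>.\<close>

lemma (in prob_space) char_tendsto_poisson:
  fixes D :: "nat \<Rightarrow> 'a \<Rightarrow> nat"
  assumes meas: "\<And>n. D n \<in> measurable M (count_space UNIV)"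
    and bd: "\<And>n \<omega>. \<omega> \<in> space M \<Longrightarrow> D n \<omega> \<le> m n"
    and dom: "\<forall>\<^sub>F n in sequentially. \<forall>k. expectation (\<lambda>\<omega>. real (D n \<omega> choose k)) \<le> K ^ k / fact k"
    and lim: "\<And>k. (\<lambda>n. expectation (\<lambda>\<omega>. real (D n \<omega> choose k))) \<longlonglongrightarrow> \<alpha> ^ k / fact k"
    and \<alpha>: "0 < \<alpha>"
  shows "(\<lambda>n. char (distr M borel (\<lambda>\<omega>. real (D n \<omega>))) t)
    \<longlonglongrightarrow> char (distr (measure_pmf (poisson_pmf \<alpha>)) borel real) t"
proof -
  define z where "z = iexp t - 1"
  let ?E = "\<lambda>k n. expectation (\<lambda>\<omega>. real (D n \<omega> choose k))"
  have char_eq: "char (distr M borel (\<lambda>\<omega>. real (D n \<omega>))) t = (\<Sum>k. complex_of_real (?E k n) * z ^ k)" for n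
    unfolding z_def by (rule char_bounded_nat_binomial_moments[OF meas bd])
  have "\<forall>\<^sub>F (k, n) in at_top \<times>\<^sub>F sequentially. norm (complex_of_real (?E k n) * z ^ k) \<le> (K * norm z) ^ k / fact k"
    using eventually_prodI[OF always_eventually dom, of "\<lambda>_. True"]
  proof (rule eventually_mono)
    show "\<forall>x::nat. True" by simp
    fix x :: "nat \<times> nat" assume "True \<and> (\<forall>k. ?E k (snd x) \<le> K ^ k / fact k)"
    then have d: "?E (fst x) (snd x) \<le> K ^ fst x / fact (fst x)" by blast
    have "norm (complex_of_real (?E (fst x) (snd x)) * z ^ fst x) = ?E (fst x) (snd x) * norm z ^ fst x"
      by (simp add: norm_mult norm_power)
    also have "\<dots> \<le> (K ^ fst x / fact (fst x)) * norm z ^ fst x"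
      using d by (intro mult_right_mono) auto
    finally show "case x of (k, n) \<Rightarrow> norm (complex_of_real (?E k n) * z ^ k) \<le> (K * norm z) ^ k / fact k"
      by (simp add: power_mult_distrib case_prod_unfold)
  qed
  moreover have "summable (\<lambda>k. (K * norm z) ^ k / fact k)"
    using summable_exp[of "K * norm z"] by (simp add: field_simps)
  ultimately have "(\<lambda>n. \<Sum>k. complex_of_real (?E k n) * z ^ k) \<longlonglongrightarrow> (\<Sum>k. complex_of_real (\<alpha> ^ k / fact k) * z ^ k)"
    by (intro tannerys_theorem[THEN conjunct2, THEN conjunct2] tendsto_intros lim) auto
  also have "(\<Sum>k. complex_of_real (\<alpha> ^ k / fact k) * z ^ k) = exp (complex_of_real \<alpha> * z)"
    using exp_converges[of "complex_of_real \<alpha> * z"]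
    by (simp add: sums_iff scaleR_conv_of_real power_mult_distrib field_simps)
  finally show ?thesis unfolding char_eq by (simp add: char_poisson[OF \<alpha>] z_def)
qed

section \<open>The transition density between opposite corners\<close>

text \<open>The Weierstrass test for products. The infinite products below have factors within a
  constant times |q|^n of 1, uniformly on a compact parameter set, so that this lemma yields both
  convergence and continuity.\<close>

lemma prodinf_compact:
  fixes f :: "nat \<Rightarrow> 'a :: topological_space \<Rightarrow> real"
  assumes A: "compact A" and cont: "\<And>n. continuous_on A (f n)"
    and bd: "\<And>n x. x \<in> A \<Longrightarrow> \<bar>f n x - 1\<bar> \<le> B n" and B: "summable B"
  shows "\<And>x. x \<in> A \<Longrightarrow> convergent_prod (\<lambda>n. f n x)"
    and "continuous_on A (\<lambda>x. \<Prod>n. f n x)"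
proof -
  show conv: "convergent_prod (\<lambda>n. f n x)" if "x \<in> A" for x
  proof -
    have "summable (\<lambda>n. norm (f n x - 1))"
      by (rule summable_comparison_test[OF _ B]) (use bd[OF that] in auto)
    then show ?thesis
      by (intro abs_convergent_prod_imp_convergent_prod) (simp add: abs_convergent_prod_conv_summable)
  qed
  have "uniformly_convergent_on A (\<lambda>N x. \<Sum>n<N. norm (f n x - 1))"
    by (rule Weierstrass_m_test'[OF _ B]) (use bd in auto)
  then have "uniformly_convergent_on A (\<lambda>N x. \<Prod>n<N. f n x)"
    by (intro uniformly_convergent_on_prod' A cont)
  then have "uniform_limit A (\<lambda>N x. \<Prod>n<N. f n x) (\<lambda>x. lim (\<lambda>N. \<Prod>n<N. f n x)) sequentially"
    by (simp add: uniformly_convergent_uniform_limit_iff)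
  moreover have "lim (\<lambda>N. \<Prod>n<N. f n x) = (\<Prod>n. f n x)" if "x \<in> A" for x
    using convergent_prod_LIMSEQ[OF conv[OF that]] by (intro limI) (simp add: LIMSEQ_lessThan_iff_atMost)
  ultimately have "uniform_limit A (\<lambda>N x. \<Prod>n<N. f n x) (\<lambda>x. \<Prod>n. f n x) sequentially"
    by (metis (mono_tags, lifting) uniform_limit_cong')
  then show "continuous_on A (\<lambda>x. \<Prod>n. f n x)"
    by (rule uniform_limit_theorem[rotated]) (auto intro!: always_eventually continuous_on_prod cont)
qed

definition qOU_psi :: "real \<Rightarrow> real \<Rightarrow> real \<Rightarrow> real \<Rightarrow> real" where
  "qOU_psi q r x y = (1 - r\<^sup>2)\<^sup>2 - (1 - q) * r * (1 + r\<^sup>2) * x * y + (1 - q) * r\<^sup>2 * (x\<^sup>2 + y\<^sup>2)"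

text \<open>The parameter \<rho> = exp (-\<delta>) compactifies time: \<rho> = 1 is time 0 and
  \<rho> = 0 is infinite time, and the factors are polynomials in \<rho>.\<close>

definition qOU_kernel :: "real \<Rightarrow> real \<Rightarrow> real \<Rightarrow> real \<Rightarrow> real" where
  "qOU_kernel q \<rho> x y = (\<Prod>k. qOU_psi q (\<rho> * q ^ k) x y)"

text \<open>Transition density divided by stationary density: the Poisson-Mehler kernel of the
  continuous q-Hermite polynomials, in rescaled variables.\<close>

definition qOU_ratio :: "real \<Rightarrow> real \<Rightarrow> real \<Rightarrow> real \<Rightarrow> real" where
  "qOU_ratio q \<delta> x y = q_pochhammer_inf (exp (- 2 * \<delta>)) q * (\<Prod>k. 1 / qOU_phi q k \<delta> x y)"

definition qOU_edge :: "real \<Rightarrow> real" where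
  "qOU_edge q = 2 / sqrt (1 - q)"

lemma qOU_transition_eq: "qOU_transition q s t x y = qOU_ratio q (t - s) x y * qOU_density q y"
  by (simp add: qOU_transition_def qOU_ratio_def)

lemma qOU_states_eq: "qOU_states q = {- qOU_edge q..qOU_edge q}"
  by (simp add: qOU_states_def qOU_edge_def)

lemma qOU_phi_eq_psi: "qOU_phi q k \<delta> x y = qOU_psi q (exp (- \<delta>) * q ^ k) x y"
proof -
  have "exp (- 2 * \<delta>) = (exp (- \<delta>))\<^sup>2" by (simp add: power2_eq_square exp_add[symmetric])
  then have "exp (- 2 * \<delta>) * q ^ (2 * k) = (exp (- \<delta>) * q ^ k)\<^sup>2"
    by (simp add: power_mult_distrib power_mult[symmetric] mult.commute[of 2 k])
  then show ?thesis by (simp add: qOU_phi_def qOU_psi_def mult.assoc)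
qed

locale qOU_parameter =
  fixes q :: real
  assumes q: "-1 < q" "q < 1"
begin

abbreviation (input) "c \<equiv> qOU_edge q"

lemma edge_pos: "0 < c" using q by (simp add: qOU_edge_def)

lemma edge_sq: "(1 - q) * c\<^sup>2 = 4" using q by (simp add: qOU_edge_def power_divide field_simps)

lemma states_sq: "(1 - q) * x\<^sup>2 \<le> 4" if "x \<in> qOU_states q"
proof -
  have "\<bar>x\<bar> \<le> c" using that by (auto simp: qOU_states_eq)
  then have "x\<^sup>2 \<le> c\<^sup>2" by (metis abs_ge_zero power_mono power2_abs)
  then have "(1 - q) * x\<^sup>2 \<le> (1 - q) * c\<^sup>2" using q by (intro mult_left_mono) auto
  then show ?thesis by (simp add: edge_sq)
qed

lemma abs_q_power_le: "\<bar>q\<bar> ^ n \<le> 1" using q by (intro power_le_one) auto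

text \<open>A factor r splits off from \<open>qOU_psi\<close> - 1, and the cofactor is bounded
  because (1 - q) x^2, (1 - q) y^2 and (1 - q) |x y| are at most 4. The estimate gives 2 + 8 + 8 =
  18; the constant 19 has some slack.\<close>

lemma psi_bound:
  assumes r: "\<bar>r\<bar> \<le> 1" and xy: "x \<in> qOU_states q" "y \<in> qOU_states q"
  shows "\<bar>qOU_psi q r x y - 1\<bar> \<le> 19 * \<bar>r\<bar>"
proof -
  define p where "p = (1 - q) * (x * y)"
  define s where "s = (1 - q) * (x\<^sup>2 + y\<^sup>2)"
  have s: "0 \<le> s" "s \<le> 8"
    using states_sq[OF xy(1)] states_sq[OF xy(2)] q by (simp_all add: s_def distrib_left)
  have "2 * \<bar>x * y\<bar> \<le> x\<^sup>2 + y\<^sup>2"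
    using sum_squares_bound[of "\<bar>x\<bar>" "\<bar>y\<bar>"] by (simp add: abs_mult)
  then have "(1 - q) * (2 * \<bar>x * y\<bar>) \<le> s" unfolding s_def using q by (intro mult_left_mono) auto
  then have p: "\<bar>p\<bar> \<le> 4" using s q by (simp add: p_def abs_mult)
  have r2: "r\<^sup>2 \<le> 1" "0 \<le> r\<^sup>2" using r by (simp_all add: abs_square_le_1)
  have eq: "qOU_psi q r x y - 1 = r * (r * (r\<^sup>2 - 2) - (1 + r\<^sup>2) * p + r * s)"
    by (simp add: qOU_psi_def p_def s_def algebra_simps power2_eq_square)
  have "\<bar>r * (r\<^sup>2 - 2) - (1 + r\<^sup>2) * p + r * s\<bar> \<le> \<bar>r * (r\<^sup>2 - 2)\<bar> + \<bar>(1 + r\<^sup>2) * p\<bar> + \<bar>r * s\<bar>"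
    by linarith
  also have "\<dots> \<le> 1 * 2 + 2 * 4 + 1 * 8"
    unfolding abs_mult using r r2 p s by (intro add_mono mult_mono) auto
  finally show ?thesis unfolding eq abs_mult by (simp add: mult.commute mult_left_mono)
qed

abbreviation (input) "cube \<equiv> {0..1::real} \<times> qOU_states q \<times> qOU_states q"

lemma compact_cube: "compact cube"
  by (intro compact_Times) (auto simp: qOU_states_eq)

text \<open>The cube includes \<rho> = 1, where the factor k = 0 vanishes for x = y. Convergence in
  the sense of \<open>convergent_prod\<close> and continuity are unaffected by this; positivity is
  claimed only near opposite edges.\<close>

lemma kernel_props:
  shows kernel_convergent: "\<rho> \<in> {0..1} \<Longrightarrow> x \<in> qOU_states q \<Longrightarrow> y \<in> qOU_states q \<Longrightarrow>
      convergent_prod (\<lambda>k. qOU_psi q (\<rho> * q ^ k) x y)"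
    and continuous_on_kernel: "continuous_on cube (\<lambda>(\<rho>, x, y). qOU_kernel q \<rho> x y)"
proof -
  let ?f = "\<lambda>k (\<rho>, x, y). qOU_psi q (\<rho> * q ^ k) x y"
  have cont: "continuous_on cube (?f k)" for k
    unfolding qOU_psi_def case_prod_unfold by (intro continuous_intros)
  have bd: "\<bar>?f k z - 1\<bar> \<le> 19 * \<bar>q\<bar> ^ k" if z: "z \<in> cube" for k z
  proof -
    obtain \<rho> x y where z': "z = (\<rho>, x, y)" by (cases z)
    have "\<bar>\<rho> * q ^ k\<bar> \<le> \<bar>q\<bar> ^ k"
      using z mult_right_mono[of \<rho> 1 "\<bar>q\<bar> ^ k"] by (auto simp: z' abs_mult power_abs)
    moreover have "\<bar>\<rho> * q ^ k\<bar> \<le> 1" using calculation abs_q_power_le[of k] by linarith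
    ultimately show ?thesis
      using psi_bound[of "\<rho> * q ^ k" x y] z unfolding z' by auto
  qed
  have "summable (\<lambda>k. 19 * \<bar>q\<bar> ^ k)" using q by (intro summable_mult summable_geometric) auto
  note * = prodinf_compact[OF compact_cube cont bd this]
  show "convergent_prod (\<lambda>k. qOU_psi q (\<rho> * q ^ k) x y)"
    if "\<rho> \<in> {0..1}" "x \<in> qOU_states q" "y \<in> qOU_states q"
    using *(1)[of "(\<rho>, x, y)"] that by simp
  show "continuous_on cube (\<lambda>(\<rho>, x, y). qOU_kernel q \<rho> x y)"
    using *(2) by (simp add: case_prod_unfold qOU_kernel_def)
qed

lemma ratio_eq:
  assumes "0 \<le> \<delta>" "x \<in> qOU_states q" "y \<in> qOU_states q"
  shows "qOU_ratio q \<delta> x y = q_pochhammer_inf (exp (- 2 * \<delta>)) q / qOU_kernel q (exp (- \<delta>)) x y"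
  using prodinf_inverse[OF kernel_convergent[of "exp (- \<delta>)" x y]] assms
  by (simp add: qOU_ratio_def qOU_kernel_def qOU_phi_eq_psi divide_inverse)

lemma kernel_sym: "qOU_kernel q \<rho> x y = qOU_kernel q \<rho> y x"
  by (simp add: qOU_kernel_def qOU_psi_def mult_ac add_ac)

text \<open>Reversibility of the process. Between two extreme steps it returns from the upper to the
  lower corner, and symmetry lets the same estimates serve for both directions.\<close>

lemma ratio_sym:
  "0 \<le> \<delta> \<Longrightarrow> x \<in> qOU_states q \<Longrightarrow> y \<in> qOU_states q \<Longrightarrow> qOU_ratio q \<delta> x y = qOU_ratio q \<delta> y x"
  by (simp add: ratio_eq kernel_sym[of _ x y])

lemma edges_in_states: "c \<in> qOU_states q" "- c \<in> qOU_states q"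
  using edge_pos by (auto simp: qOU_states_eq)

text \<open>With x y = - c^2 and (1 - q) c^2 = 4 all terms combine to a perfect fourth power. This
  is the origin of the denominators (1 + q^k)^4 in the rate.\<close>

lemma psi_edges: "qOU_psi q r (- c) c = (1 + r) ^ 4"
proof -
  have "qOU_psi q r (- c) c = (1 - r\<^sup>2)\<^sup>2 + r * (1 + r\<^sup>2) * ((1 - q) * c\<^sup>2) + 2 * r\<^sup>2 * ((1 - q) * c\<^sup>2)"
    by (simp add: qOU_psi_def algebra_simps power2_eq_square)
  then show ?thesis unfolding edge_sq by (simp add: algebra_simps power2_eq_square power4_eq_xxxx)
qed

lemma kernel_edges_pos:
  assumes "\<rho> \<in> {0..1}"
  shows "0 < qOU_kernel q \<rho> (- c) c"
  unfolding qOU_kernel_def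
proof (rule less_0_prodinf[OF kernel_convergent[OF assms edges_in_states(2,1)]])
  fix k
  have "-1 < \<rho> * q ^ k"
  \<comment> \<open>A factor could vanish only at -1. For k = 0 this is excluded by 0 \<le> \<rho>,
    for k > 0 by |q| < 1.\<close>
  proof (cases k)
    case 0 then show ?thesis using assms by simp
  next
    case (Suc j)
    have "\<bar>\<rho> * q ^ k\<bar> \<le> \<bar>q\<bar> ^ k"
      using assms mult_right_mono[of \<rho> 1 "\<bar>q\<bar> ^ k"] by (auto simp: abs_mult power_abs)
    also have "\<dots> < 1" using q Suc power_Suc_less_one[of "\<bar>q\<bar>" j] by (cases "q = 0") auto
    finally show ?thesis by linarith
  qed
  then show "0 < qOU_psi q (\<rho> * q ^ k) (- c) c" unfolding psi_edges by simp
qed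

text \<open>The argument a * q leaves out the factor 1 - a, which vanishes at a = 1, that is, at
  time 0.\<close>

lemma pochhammer_props:
  shows pochhammer_convergent: "\<And>a. a \<in> {0..1} \<Longrightarrow> convergent_prod (\<lambda>k. 1 - a * q * q ^ k)"
    and continuous_on_pochhammer: "continuous_on {0..1} (\<lambda>a. q_pochhammer_inf (a * q) q)"
proof -
  let ?f = "\<lambda>k a::real. 1 - a * q * q ^ k"
  have cont: "continuous_on {0..1} (?f k)" for k by (intro continuous_intros)
  have bd: "\<bar>?f k a - 1\<bar> \<le> \<bar>q\<bar> ^ k" if "a \<in> {0..1}" for k and a :: real
  proof -
    have "\<bar>a * q\<bar> \<le> 1" unfolding abs_mult using that q by (intro mult_le_one) auto
    then show ?thesis using mult_right_mono[of "\<bar>a * q\<bar>" 1 "\<bar>q\<bar> ^ k"] by (simp add: abs_mult power_abs)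
  qed
  have "summable (\<lambda>k. \<bar>q\<bar> ^ k)" using q by (intro summable_geometric) auto
  note * = prodinf_compact[OF compact_Icc[of 0 "1::real"] cont bd this]
  show "convergent_prod (\<lambda>k. 1 - a * q * q ^ k)" if "a \<in> {0..1}" for a
    using *(1)[OF _ that] by simp
  show "continuous_on {0..1} (\<lambda>a. q_pochhammer_inf (a * q) q)"
    using *(2) by (simp add: q_pochhammer_inf_def)
qed

lemma pochhammer_split:
  assumes "a \<in> {0..<1}"
  shows "q_pochhammer_inf a q = (1 - a) * q_pochhammer_inf (a * q) q"
proof -
  have "convergent_prod (\<lambda>k. 1 - a * q ^ Suc k)"
    using pochhammer_convergent[of a] assms by (simp add: mult_ac)
  then have "convergent_prod (\<lambda>k. 1 - a * q ^ k)" by (subst (asm) convergent_prod_Suc_iff)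
  from prodinf_split_head[OF this] assms show ?thesis
    by (simp add: q_pochhammer_inf_def mult_ac)
qed

end

lemma dist_triple_less:
  fixes x y z :: real
  assumes "\<bar>x - x'\<bar> < e / 3" "\<bar>y - y'\<bar> < e / 3" "\<bar>z - z'\<bar> < e / 3"
  shows "dist (x, y, z) (x', y', z') < e"
proof -
  have "dist (x, y, z) (x', y', z') \<le> dist x x' + dist (y, z) (y', z')"
    unfolding dist_Pair_Pair[of x] by (rule sqrt_sum_squares_le_sum) auto
  also have "dist (y, z) (y', z') \<le> dist y y' + dist z z'"
    unfolding dist_Pair_Pair[of y] by (rule sqrt_sum_squares_le_sum) auto
  finally show ?thesis using assms unfolding dist_real_def by linarith
qed

section \<open>Uniform estimates of the density ratio at opposite corners\<close>

context qOU_parameter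
begin

text \<open>The constant \<kappa> of the overview: 2 is the derivative of 1 - exp (-2 \<delta>) at
  0, and the quotient is the rest of the ratio at time 0 between the two edges.\<close>

definition qOU_jump_rate :: real where
  "qOU_jump_rate = 2 * q_pochhammer_inf q q / qOU_kernel q 1 (- c) c"

text \<open>Over the compact range of \<rho> the kernel between the edges has a positive minimum m,
  and uniform continuity keeps its variation below m on small corners.\<close>

lemma kernel_corner_pos:
  obtains d where "0 < d" "d \<le> c"
    "\<And>\<rho> x y. \<rho> \<in> {0..1} \<Longrightarrow> x \<in> {- c..- c + d} \<Longrightarrow> y \<in> {c - d..c} \<Longrightarrow> 0 < qOU_kernel q \<rho> x y"
proof -
  let ?K = "\<lambda>(\<rho>, x, y). qOU_kernel q \<rho> x y"
  let ?cube = "{0..1::real} \<times> qOU_states q \<times> qOU_states q"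
  note ed = edges_in_states
  have "continuous_on {0..1} (\<lambda>\<rho>. ?K (\<rho>, - c, c))"
    by (rule continuous_on_compose2[OF continuous_on_kernel])
      (use ed in \<open>auto intro!: continuous_intros\<close>)
  then obtain \<rho>0 where \<rho>0: "\<rho>0 \<in> {0..1}" "\<And>\<rho>. \<rho> \<in> {0..1} \<Longrightarrow> qOU_kernel q \<rho>0 (- c) c \<le> qOU_kernel q \<rho> (- c) c"
    using continuous_attains_inf[of "{0..1::real}" "\<lambda>\<rho>. ?K (\<rho>, - c, c)"] by auto
  define m where "m = qOU_kernel q \<rho>0 (- c) c"
  have m: "0 < m" unfolding m_def by (rule kernel_edges_pos[OF \<rho>0(1)])
  have "uniformly_continuous_on ?cube ?K"
    by (intro compact_uniformly_continuous continuous_on_kernel compact_cube)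
  then obtain e where e: "0 < e"
    "\<And>z z'. z \<in> ?cube \<Longrightarrow> z' \<in> ?cube \<Longrightarrow> dist z' z < e \<Longrightarrow> dist (?K z') (?K z) < m"
    using m unfolding uniformly_continuous_on_def by metis
  show thesis
  \<comment> \<open>Smaller than e / 3, because the corners are closed while
    \<open>dist_triple_less\<close> asks for strict inequalities.\<close>
  proof (rule that[of "min c (e / 4)"])
    fix \<rho> x y :: real assume *: "\<rho> \<in> {0..1}" "x \<in> {- c..- c + min c (e / 4)}" "y \<in> {c - min c (e / 4)..c}"
    have xy: "x \<in> qOU_states q" "y \<in> qOU_states q"
      using * edge_pos by (auto simp: qOU_states_eq)
    have "dist (\<rho>, x, y) (\<rho>, - c, c) < e"
      by (rule dist_triple_less) (use * e(1) in auto)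
    then have "dist (qOU_kernel q \<rho> x y) (qOU_kernel q \<rho> (- c) c) < m"
      using e(2)[of "(\<rho>, - c, c)" "(\<rho>, x, y)"] * xy ed by auto
    then show "0 < qOU_kernel q \<rho> x y"
      using \<rho>0(2)[OF *(1)] unfolding dist_real_def m_def[symmetric] by linarith
  qed (use e(1) edge_pos in auto)
qed

text \<open>Separates the factor that vanishes at time 0 from a function G that is continuous on a
  compact box containing both ends of the time range. The three estimates that follow are
  boundedness of G, uniform continuity near \<rho> = 0, and uniform continuity near \<rho> =
  1.\<close>

lemma ratio_corner:
  obtains d G where "0 < d" "d \<le> c"
    "continuous_on ({0..1::real} \<times> {- c..- c + d} \<times> {c - d..c}) (\<lambda>(\<rho>, x, y). G \<rho> x y)"
    "\<And>\<delta> x y. 0 < \<delta> \<Longrightarrow> x \<in> {- c..- c + d} \<Longrightarrow> y \<in> {c - d..c} \<Longrightarrow>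
       qOU_ratio q \<delta> x y = (1 - exp (- 2 * \<delta>)) * G (exp (- \<delta>)) x y"
    "\<And>\<rho> x y. \<rho> \<in> {0..1} \<Longrightarrow> x \<in> {- c..- c + d} \<Longrightarrow> y \<in> {c - d..c} \<Longrightarrow> 0 < G \<rho> x y"
    "\<And>x y. G 0 x y = 1"
    "2 * G 1 (- c) c = qOU_jump_rate"
proof -
  obtain d where d: "0 < d" "d \<le> c"
    "\<And>\<rho> x y. \<rho> \<in> {0..1} \<Longrightarrow> x \<in> {- c..- c + d} \<Longrightarrow> y \<in> {c - d..c} \<Longrightarrow> 0 < qOU_kernel q \<rho> x y"
    using kernel_corner_pos by blast
  define G where "G \<rho> x y = q_pochhammer_inf (\<rho>\<^sup>2 * q) q / qOU_kernel q \<rho> x y" for \<rho> x y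
  let ?box = "{0..1::real} \<times> {- c..- c + d} \<times> {c - d..c}"
  have states: "x \<in> qOU_states q" "y \<in> qOU_states q" if "x \<in> {- c..- c + d}" "y \<in> {c - d..c}" for x y
    using that d(2) edge_pos by (auto simp: qOU_states_eq)
  show thesis
  proof (rule that[of d G])
    have sq: "\<rho>\<^sup>2 \<in> {0..1}" if "\<rho> \<in> {0..1}" for \<rho> :: real using that by (auto simp: power_le_one)
    have "continuous_on ?box (\<lambda>z. q_pochhammer_inf ((fst z)\<^sup>2 * q) q)"
      by (rule continuous_on_compose2[OF continuous_on_pochhammer, of _ "\<lambda>z. (fst z)\<^sup>2"])
        (use sq in \<open>auto intro!: continuous_intros simp: power_le_one\<close>)
    moreover have "continuous_on ?box (\<lambda>(\<rho>, x, y). qOU_kernel q \<rho> x y)"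
      by (rule continuous_on_subset[OF continuous_on_kernel]) (use states in blast)
    ultimately show "continuous_on ?box (\<lambda>(\<rho>, x, y). G \<rho> x y)"
      unfolding G_def case_prod_unfold using d(3) by (intro continuous_on_divide) fastforce+
    show "0 < G \<rho> x y" if "\<rho> \<in> {0..1}" "x \<in> {- c..- c + d}" "y \<in> {c - d..c}" for \<rho> x y
      unfolding G_def
    proof (intro divide_pos_pos d(3)[OF that])
      show "0 < q_pochhammer_inf (\<rho>\<^sup>2 * q) q"
        unfolding q_pochhammer_inf_def
      proof (rule less_0_prodinf[OF pochhammer_convergent[OF sq[OF that(1)]]])
        fix k
        have "\<bar>\<rho>\<^sup>2 * q * q ^ k\<bar> \<le> 1 * \<bar>q\<bar> * 1"
          unfolding abs_mult[of _ "q ^ k"] abs_mult[of _ q] power_abs[of q]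
          using sq[OF that(1)] q by (intro mult_mono power_le_one) auto
        then show "0 < 1 - \<rho>\<^sup>2 * q * q ^ k" using q by linarith
      qed
    qed
    show "qOU_ratio q \<delta> x y = (1 - exp (- 2 * \<delta>)) * G (exp (- \<delta>)) x y"
      if "0 < \<delta>" "x \<in> {- c..- c + d}" "y \<in> {c - d..c}" for \<delta> x y
    proof -
      have "(exp (- \<delta>))\<^sup>2 = exp (- 2 * \<delta>)" by (simp add: power2_eq_square exp_add[symmetric])
      then show ?thesis
        using ratio_eq[OF _ states[OF that(2,3)], of \<delta>] pochhammer_split[of "exp (- 2 * \<delta>)"] that
        by (simp add: G_def)
    qed
    show "G 0 x y = 1" for x y
      by (simp add: G_def q_pochhammer_inf_def qOU_kernel_def qOU_psi_def)
    show "2 * G 1 (- c) c = qOU_jump_rate" by (simp add: G_def qOU_jump_rate_def)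
  qed (use d in auto)
qed

lemma jump_rate_pos: "0 < qOU_jump_rate"
proof -
  obtain d and G :: "real \<Rightarrow> real \<Rightarrow> real \<Rightarrow> real" where d: "0 < d"
    and G: "\<And>\<rho> x y. \<rho> \<in> {0..1} \<Longrightarrow> x \<in> {- c..- c + d} \<Longrightarrow> y \<in> {c - d..c} \<Longrightarrow> 0 < G \<rho> x y"
    "2 * G 1 (- c) c = qOU_jump_rate"
    by (rule ratio_corner) blast
  show ?thesis using G(1)[of 1 "- c" c] G(2) d by auto
qed

lemma ratio_bounded_at_corner:
  obtains d C where "0 < d" "d \<le> c" "0 \<le> C"
    "\<And>\<delta> x y. 0 < \<delta> \<Longrightarrow> x \<in> {- c..- c + d} \<Longrightarrow> y \<in> {c - d..c} \<Longrightarrow>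
      0 \<le> qOU_ratio q \<delta> x y \<and> qOU_ratio q \<delta> x y \<le> C"
proof -
  obtain d G where d: "0 < d" "d \<le> c"
    and cont: "continuous_on ({0..1::real} \<times> {- c..- c + d} \<times> {c - d..c}) (\<lambda>(\<rho>, x, y). G \<rho> x y)"
    and eq: "\<And>\<delta> x y. 0 < \<delta> \<Longrightarrow> x \<in> {- c..- c + d} \<Longrightarrow> y \<in> {c - d..c} \<Longrightarrow>
       qOU_ratio q \<delta> x y = (1 - exp (- 2 * \<delta>)) * G (exp (- \<delta>)) x y"
    and pos: "\<And>\<rho> x y. \<rho> \<in> {0..1} \<Longrightarrow> x \<in> {- c..- c + d} \<Longrightarrow> y \<in> {c - d..c} \<Longrightarrow> 0 < G \<rho> x y"
    by (rule ratio_corner) blast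
  have "bounded ((\<lambda>(\<rho>, x, y). G \<rho> x y) ` ({0..1::real} \<times> {- c..- c + d} \<times> {c - d..c}))"
    by (intro compact_imp_bounded compact_continuous_image cont compact_Times) auto
  then obtain C where C: "\<And>\<rho> x y. \<rho> \<in> {0..1} \<Longrightarrow> x \<in> {- c..- c + d} \<Longrightarrow> y \<in> {c - d..c} \<Longrightarrow> \<bar>G \<rho> x y\<bar> \<le> C"
    unfolding bounded_iff by fastforce
  show thesis
  proof (rule that[of d "\<bar>C\<bar>"])
    fix \<delta> x y :: real assume *: "0 < \<delta>" "x \<in> {- c..- c + d}" "y \<in> {c - d..c}"
    have "\<bar>G (exp (- \<delta>)) x y\<bar> \<le> C" "0 < G (exp (- \<delta>)) x y" using C pos * by auto
    moreover have "0 \<le> 1 - exp (- 2 * \<delta>)" "1 - exp (- 2 * \<delta>) \<le> 1" using * by auto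
    ultimately show "0 \<le> qOU_ratio q \<delta> x y \<and> qOU_ratio q \<delta> x y \<le> \<bar>C\<bar>"
      unfolding eq[OF *] by (auto intro!: mult_nonneg_nonneg mult_left_le_one_le[THEN order_trans])
  qed (use d in auto)
qed

lemma ratio_tendsto_one_at_corner:
  obtains d where "0 < d" "d \<le> c"
    "\<And>\<eta>. 0 < \<eta> \<Longrightarrow> \<exists>L>0. \<forall>\<delta>\<ge>L. \<forall>x\<in>{- c..- c + d}. \<forall>y\<in>{c - d..c}. \<bar>qOU_ratio q \<delta> x y - 1\<bar> \<le> \<eta>"
proof -
  obtain d G where d: "0 < d" "d \<le> c"
    and cont: "continuous_on ({0..1::real} \<times> {- c..- c + d} \<times> {c - d..c}) (\<lambda>(\<rho>, x, y). G \<rho> x y)"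
    and eq: "\<And>\<delta> x y. 0 < \<delta> \<Longrightarrow> x \<in> {- c..- c + d} \<Longrightarrow> y \<in> {c - d..c} \<Longrightarrow>
       qOU_ratio q \<delta> x y = (1 - exp (- 2 * \<delta>)) * G (exp (- \<delta>)) x y"
    and one: "\<And>x y. G 0 x y = 1"
    by (rule ratio_corner) blast
  let ?box = "{0..1::real} \<times> {- c..- c + d} \<times> {c - d..c}"
  have uc: "uniformly_continuous_on ?box (\<lambda>(\<rho>, x, y). G \<rho> x y)"
    by (intro compact_uniformly_continuous cont compact_Times) auto
  show thesis
  proof (rule that[of d])
    fix \<eta> :: real assume \<eta>: "0 < \<eta>"
    obtain e where e: "0 < e"
      "\<And>z z'. z \<in> ?box \<Longrightarrow> z' \<in> ?box \<Longrightarrow> dist z' z < e \<Longrightarrow>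
        dist ((\<lambda>(\<rho>, x, y). G \<rho> x y) z') ((\<lambda>(\<rho>, x, y). G \<rho> x y) z) < \<eta> / 2"
      using uc \<eta> unfolding uniformly_continuous_on_def by (metis half_gt_zero)
    have "((\<lambda>\<delta>::real. exp (- \<delta>)) \<longlongrightarrow> 0) at_top"
      using filterlim_compose[OF exp_at_bot filterlim_uminus_at_bot_at_top] by simp
    then have "\<forall>\<^sub>F \<delta>::real in at_top. exp (- \<delta>) < min (e / 3) (min 1 (\<eta> / 2))"
      using e(1) \<eta> by (intro order_tendstoD) auto
    then obtain L :: real where L: "\<And>\<delta>. L \<le> \<delta> \<Longrightarrow> exp (- \<delta>) < min (e / 3) (min 1 (\<eta> / 2))"
      unfolding eventually_at_top_linorder by blast
    show "\<exists>L>0. \<forall>\<delta>\<ge>L. \<forall>x\<in>{- c..- c + d}. \<forall>y\<in>{c - d..c}. \<bar>qOU_ratio q \<delta> x y - 1\<bar> \<le> \<eta>"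
    proof (intro exI[of _ "max L 1"] conjI allI impI ballI)
      fix \<delta> x y :: real assume \<delta>: "max L 1 \<le> \<delta>" and xy: "x \<in> {- c..- c + d}" "y \<in> {c - d..c}"
      define \<rho> where "\<rho> = exp (- \<delta>)"
      have \<rho>: "0 < \<rho>" "\<rho> < e / 3" "\<rho> < 1" "\<rho> < \<eta> / 2" using L[of \<delta>] \<delta> by (auto simp: \<rho>_def)
      have "dist (\<rho>, x, y) (0, x, y) < e" by (rule dist_triple_less) (use \<rho> e(1) in auto)
      then have "dist (G \<rho> x y) (G 0 x y) < \<eta> / 2"
        using e(2)[of "(0, x, y)" "(\<rho>, x, y)"] xy \<rho> by auto
      then have G1: "\<bar>G \<rho> x y - 1\<bar> < \<eta> / 2" by (simp add: one dist_real_def)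
      have r2: "exp (- 2 * \<delta>) = \<rho> * \<rho>" by (simp add: \<rho>_def exp_add[symmetric])
      have \<rho>2: "\<rho> * \<rho> \<le> \<rho>" "0 \<le> \<rho> * \<rho>" using \<rho> by (auto intro: mult_left_le)
      have "\<bar>1 - \<rho> * \<rho>\<bar> \<le> 1" using \<rho> \<rho>2 by linarith
      then have "\<bar>(1 - \<rho> * \<rho>) * (G \<rho> x y - 1)\<bar> \<le> \<bar>G \<rho> x y - 1\<bar>"
        unfolding abs_mult by (intro mult_left_le_one_le) auto
      moreover have "(1 - \<rho> * \<rho>) * G \<rho> x y - 1 = (1 - \<rho> * \<rho>) * (G \<rho> x y - 1) - \<rho> * \<rho>"
        by (simp add: algebra_simps)
      moreover have "qOU_ratio q \<delta> x y = (1 - \<rho> * \<rho>) * G \<rho> x y"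
        using eq[of \<delta> x y] \<delta> xy unfolding r2 \<rho>_def[symmetric] by auto
      ultimately show "\<bar>qOU_ratio q \<delta> x y - 1\<bar> \<le> \<eta>" using G1 \<rho>2 \<rho> by linarith
    qed auto
  qed (use d in auto)
qed

lemma ratio_short_time_at_corner:
  assumes \<eta>: "0 < \<eta>"
  obtains d \<delta>0 where "0 < d" "d \<le> c" "0 < \<delta>0"
    "\<And>\<delta> x y. 0 < \<delta> \<Longrightarrow> \<delta> < \<delta>0 \<Longrightarrow> x \<in> {- c..- c + d} \<Longrightarrow> y \<in> {c - d..c} \<Longrightarrow>
      \<bar>qOU_ratio q \<delta> x y - qOU_jump_rate * \<delta>\<bar> \<le> \<eta> * \<delta>"
proof -
  obtain d G where d: "0 < d" "d \<le> c"
    and cont: "continuous_on ({0..1::real} \<times> {- c..- c + d} \<times> {c - d..c}) (\<lambda>(\<rho>, x, y). G \<rho> x y)"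
    and eq: "\<And>\<delta> x y. 0 < \<delta> \<Longrightarrow> x \<in> {- c..- c + d} \<Longrightarrow> y \<in> {c - d..c} \<Longrightarrow>
       qOU_ratio q \<delta> x y = (1 - exp (- 2 * \<delta>)) * G (exp (- \<delta>)) x y"
    and G1: "2 * G 1 (- c) c = qOU_jump_rate"
    by (rule ratio_corner) blast
  let ?box = "{0..1::real} \<times> {- c..- c + d} \<times> {c - d..c}"
  have uc: "uniformly_continuous_on ?box (\<lambda>(\<rho>, x, y). G \<rho> x y)"
    by (intro compact_uniformly_continuous cont compact_Times) auto
  obtain e where e: "0 < e"
      "\<And>z z'. z \<in> ?box \<Longrightarrow> z' \<in> ?box \<Longrightarrow> dist z' z < e \<Longrightarrow>
        dist ((\<lambda>(\<rho>, x, y). G \<rho> x y) z') ((\<lambda>(\<rho>, x, y). G \<rho> x y) z) < \<eta> / 4"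
      using uc \<eta> unfolding uniformly_continuous_on_def by (metis divide_pos_pos zero_less_numeral)
  define C where "C = \<bar>G 1 (- c) c\<bar> + \<eta> / 4"
  have C: "0 < C" using \<eta> by (simp add: C_def)
  have "((\<lambda>\<delta>::real. exp (- \<delta>)) \<longlongrightarrow> exp (- 0)) (at_right 0)" by (intro tendsto_intros)
  then have ev1: "\<forall>\<^sub>F \<delta>::real in at_right 0. 1 - e / 3 < exp (- \<delta>)"
    using e(1) by (intro order_tendstoD) auto
  have "((\<lambda>\<delta>::real. exp (- 2 * \<delta>)) has_real_derivative - 2) (at 0)"
    by (auto intro!: derivative_eq_intros)
  then have "((\<lambda>\<delta>::real. (exp (- 2 * \<delta>) - 1) / \<delta>) \<longlongrightarrow> - 2) (at 0)"
    unfolding DERIV_def by simp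
  then have "((\<lambda>\<delta>::real. - ((exp (- 2 * \<delta>) - 1) / \<delta>)) \<longlongrightarrow> - (- 2)) (at_right 0)"
    by (intro tendsto_minus) (auto intro: tendsto_within_subset)
  then have ev2: "\<forall>\<^sub>F \<delta>::real in at_right 0. dist (- ((exp (- 2 * \<delta>) - 1) / \<delta>)) (- (- 2)) < \<eta> / (2 * C)"
    using \<eta> C by (intro tendstoD) auto
  obtain \<delta>0 :: real where \<delta>0: "0 < \<delta>0" "\<And>\<delta>. 0 < \<delta> \<Longrightarrow> \<delta> < \<delta>0 \<Longrightarrow> 1 - e / 3 < exp (- \<delta>)
      \<and> dist (- ((exp (- 2 * \<delta>) - 1) / \<delta>)) (- (- 2)) < \<eta> / (2 * C)"
    using eventually_conj[OF ev1 ev2] unfolding eventually_at_right_field by blast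
  show thesis
  proof (rule that[of "min d (e / 4)" \<delta>0])
    fix \<delta> x y :: real assume \<delta>: "0 < \<delta>" "\<delta> < \<delta>0"
      and xy: "x \<in> {- c..- c + min d (e / 4)}" "y \<in> {c - min d (e / 4)..c}"
    have xy': "x \<in> {- c..- c + d}" "y \<in> {c - d..c}" using xy by auto
    \<comment> \<open>h is the difference quotient that tends to 2. The error of h * g is a
      derivative part, at most \<eta> / (2 C) * C = \<eta> / 2, plus a continuity part, below 2 *
      \<eta> / 4.\<close>
    define g h where "g = G (exp (- \<delta>)) x y" and "h = - ((exp (- 2 * \<delta>) - 1) / \<delta>)"
    have "dist (exp (- \<delta>), x, y) (1, - c, c) < e"
      using \<delta>0(2)[OF \<delta>] xy \<delta> e(1) by (intro dist_triple_less) auto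
    then have "dist g (G 1 (- c) c) < \<eta> / 4"
      using e(2)[of "(1, - c, c)" "(exp (- \<delta>), x, y)"] xy' \<delta> d unfolding g_def by auto
    then have g: "\<bar>g - G 1 (- c) c\<bar> < \<eta> / 4" by (simp add: dist_real_def)
    then have gC: "\<bar>g\<bar> \<le> C" unfolding C_def by linarith
    have h: "\<bar>h - 2\<bar> < \<eta> / (2 * C)" using \<delta>0(2)[OF \<delta>] by (simp add: h_def dist_real_def)
    have "\<delta> * h = 1 - exp (- 2 * \<delta>)" using \<delta>(1) by (simp add: h_def)
    then have "qOU_ratio q \<delta> x y = \<delta> * (h * g)"
      unfolding eq[OF \<delta>(1) xy'] g_def by (simp add: mult.assoc[symmetric])
    then have diff: "qOU_ratio q \<delta> x y - qOU_jump_rate * \<delta> = \<delta> * ((h - 2) * g + 2 * (g - G 1 (- c) c))"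
      by (simp add: G1[symmetric] algebra_simps)
    have "\<bar>(h - 2) * g\<bar> \<le> \<eta> / (2 * C) * C"
      unfolding abs_mult using h gC C by (intro mult_mono) auto
    then have "\<bar>(h - 2) * g\<bar> \<le> \<eta> / 2" using C by simp
    moreover have "\<bar>v + 2 * w\<bar> \<le> \<eta>" if "\<bar>v\<bar> \<le> \<eta> / 2" "\<bar>w\<bar> < \<eta> / 4" for v w
      using that by linarith
    ultimately have "\<bar>(h - 2) * g + 2 * (g - G 1 (- c) c)\<bar> \<le> \<eta>" using g by blast
    then show "\<bar>qOU_ratio q \<delta> x y - qOU_jump_rate * \<delta>\<bar> \<le> \<eta> * \<delta>"
      unfolding diff using \<delta>(1) by (simp add: abs_mult mult.commute)
  qed (use d e(1) \<delta>0 in auto)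
qed

end

section \<open>The stationary mass of the corners\<close>

lemma set_integral_sqrt:
  assumes "0 \<le> e"
  shows "(LINT u:{0..e}|lborel. sqrt u) = 2 / 3 * e powr (3 / 2)"
proof -
  have "((\<lambda>u. u powr (1 / 2)) has_integral (e powr (1 / 2 + 1) / (1 / 2 + 1))) {0..e}"
    using assms by (intro has_integral_powr_from_0) auto
  then have "integral {0..e} (\<lambda>u. u powr (1 / 2)) = 2 / 3 * e powr (3 / 2)"
    by (simp add: integral_unique)
  moreover have "integral {0..e} (\<lambda>u. u powr (1 / 2)) = integral {0..e} sqrt"
    by (intro integral_cong) (auto simp: powr_half_sqrt)
  moreover have "set_integrable lborel {0..e} sqrt"
    unfolding set_integrable_def by (intro borel_integrable_compact continuous_intros) auto
  ultimately show ?thesis using set_borel_integral_eq_integral(2) by metis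
qed

text \<open>The half-line matches the event that a state lies below the level; the density vanishes
  beyond the edge. By symmetry this is also the mass of the upper corner
  (\<open>right_tail\<close>).\<close>

definition qOU_tail :: "real \<Rightarrow> real \<Rightarrow> real" where
  "qOU_tail q \<epsilon> = (LINT x:{..< - qOU_edge q + \<epsilon>}|lborel. qOU_density q x)"

context qOU_parameter
begin

definition density_product :: "real \<Rightarrow> real" where
  "density_product x = (\<Prod>k. (1 + q ^ Suc k)\<^sup>2 - (1 - q) * x\<^sup>2 * q ^ Suc k)"

definition density_core :: "real \<Rightarrow> real" where
  "density_core x = sqrt (1 - q) * q_pochhammer_inf q q / (2 * pi) * sqrt (4 - (1 - q) * x\<^sup>2) * density_product x"

lemma density_eq: "qOU_density q x = indicator (qOU_states q) x * density_core x"
  by (simp add: qOU_density_def density_core_def density_product_def)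

lemma density_product_props:
  shows convergent_density_product: "\<And>x. x \<in> qOU_states q \<Longrightarrow>
      convergent_prod (\<lambda>k. (1 + q ^ Suc k)\<^sup>2 - (1 - q) * x\<^sup>2 * q ^ Suc k)"
    and continuous_on_density_product: "continuous_on (qOU_states q) density_product"
proof -
  let ?f = "\<lambda>k x. (1 + q ^ Suc k)\<^sup>2 - (1 - q) * x\<^sup>2 * q ^ Suc k"
  have cont: "continuous_on (qOU_states q) (?f k)" for k by (intro continuous_intros)
  have bd: "\<bar>?f k x - 1\<bar> \<le> 7 * \<bar>q\<bar> ^ k" if x: "x \<in> qOU_states q" for k x
  proof -
    define r where "r = q ^ Suc k"
    have r: "\<bar>r\<bar> \<le> \<bar>q\<bar> ^ k" using q mult_right_mono[of "\<bar>q\<bar>" 1 "\<bar>q\<bar> ^ k"] by (simp add: r_def abs_mult power_abs)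
    have r1: "\<bar>r\<bar> \<le> 1" using r abs_q_power_le[of k] by linarith
    have u: "0 \<le> (1 - q) * x\<^sup>2" "(1 - q) * x\<^sup>2 \<le> 4" using states_sq[OF x] q by auto
    have "?f k x - 1 = r * (2 + r - (1 - q) * x\<^sup>2)"
      unfolding r_def[symmetric] by (simp add: algebra_simps power2_eq_square)
    moreover have "\<bar>2 + r - (1 - q) * x\<^sup>2\<bar> \<le> 7" using u r1 by linarith
    ultimately have "\<bar>?f k x - 1\<bar> \<le> \<bar>r\<bar> * 7" by (simp add: abs_mult mult_left_mono)
    then show ?thesis using r by linarith
  qed
  have "summable (\<lambda>k. 7 * \<bar>q\<bar> ^ k)" using q by (intro summable_mult summable_geometric) auto
  note * = prodinf_compact[OF _ cont bd this]
  have cpt: "compact (qOU_states q)" by (simp add: qOU_states_eq)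
  show "convergent_prod (\<lambda>k. ?f k x)" if "x \<in> qOU_states q" for x using *(1)[OF cpt _ that] by simp
  show "continuous_on (qOU_states q) density_product"
    using *(2)[OF cpt] by (simp add: density_product_def[abs_def])
qed

text \<open>With r = q^(k+1) and u = (1 - q) x^2 in [0, 4], the factor (1 + r)^2 - u r is at least
  (1 - r)^2 for r \<ge> 0. For r < 0, which occurs when q is negative, the subtracted term is itself
  at most 0.\<close>

lemma density_product_nonneg:
  assumes x: "x \<in> qOU_states q"
  shows "0 \<le> density_product x"
  unfolding density_product_def
proof (rule has_prod_nonneg[OF convergent_prod_has_prod[OF convergent_density_product[OF x]]])
  fix k
  define r where "r = q ^ Suc k"
  have u: "0 \<le> (1 - q) * x\<^sup>2" "(1 - q) * x\<^sup>2 \<le> 4" using states_sq[OF x] q by auto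
  have "(1 - q) * x\<^sup>2 * r \<le> (1 + r)\<^sup>2"
  proof (cases "0 \<le> r")
    case True
    then have "(1 - q) * x\<^sup>2 * r \<le> 4 * r" using u by (intro mult_right_mono) auto
    also have "\<dots> \<le> (1 + r)\<^sup>2" using zero_le_power2[of "1 - r"] by (simp add: power2_eq_square algebra_simps)
    finally show ?thesis .
  next
    case False
    then have "(1 - q) * x\<^sup>2 * r \<le> 0" using u by (intro mult_nonneg_nonpos) auto
    then show ?thesis using zero_le_power2[of "1 + r"] by linarith
  qed
  then show "0 \<le> (1 + q ^ Suc k)\<^sup>2 - (1 - q) * x\<^sup>2 * q ^ Suc k" by (simp add: r_def)
qed

lemma convergent_pochhammer: "convergent_prod (\<lambda>k. 1 - q * q ^ k)"
  using pochhammer_convergent[of 1] by simp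

lemma pochhammer_pos: "0 < q_pochhammer_inf q q"
  unfolding q_pochhammer_inf_def
proof (rule less_0_prodinf[OF convergent_pochhammer])
  fix k
  have "\<bar>q * q ^ k\<bar> \<le> \<bar>q\<bar> * 1" unfolding abs_mult power_abs by (intro mult_left_mono abs_q_power_le) auto
  then show "0 < 1 - q * q ^ k" using q by linarith
qed

lemma density_core_nonneg: "x \<in> qOU_states q \<Longrightarrow> 0 \<le> density_core x"
  using density_product_nonneg[of x] pochhammer_pos states_sq[of x] q by (simp add: density_core_def)

lemma density_nonneg: "0 \<le> qOU_density q x"
  using density_core_nonneg by (simp add: density_eq indicator_def)

lemma density_outside: "x \<notin> qOU_states q \<Longrightarrow> qOU_density q x = 0"
  by (simp add: density_eq)

lemma continuous_on_density_core: "continuous_on (qOU_states q) density_core"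
  unfolding density_core_def[abs_def] by (intro continuous_intros continuous_on_density_product) auto

lemma density_measurable [measurable]: "qOU_density q \<in> borel_measurable borel"
  using borel_measurable_continuous_on_indicator[OF _ continuous_on_density_core]
  by (simp add: density_eq[abs_def] qOU_states_eq)

lemma density_integrable: "integrable lborel (qOU_density q)"
  using borel_integrable_compact[OF _ continuous_on_density_core]
  by (simp add: density_eq[abs_def] qOU_states_eq)

lemma density_minus: "qOU_density q (- x) = qOU_density q x"
  by (auto simp: density_eq density_core_def density_product_def qOU_states_eq indicator_def)

lemma right_tail: "(LINT x:{c - \<epsilon><..}|lborel. qOU_density q x) = qOU_tail q \<epsilon>"
proof -
  have "(LINT x:{c - \<epsilon><..}|lborel. qOU_density q x) = (LINT x|lborel. indicator {c - \<epsilon><..} (- x) * qOU_density q (- x))"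
    unfolding set_lebesgue_integral_def
    by (subst lborel_integral_real_affine[where c="-1" and t=0]) auto
  also have "\<dots> = qOU_tail q \<epsilon>"
    unfolding qOU_tail_def set_lebesgue_integral_def
    by (intro Bochner_Integration.integral_cong) (auto simp: density_minus indicator_def)
  finally show ?thesis .
qed

lemma tail_nonneg: "0 \<le> qOU_tail q \<epsilon>"
  unfolding qOU_tail_def set_lebesgue_integral_def
  by (intro Bochner_Integration.integral_nonneg) (auto simp: density_nonneg)

text \<open>The constant \<tau> of the overview. The factor 2 / 3 comes from integrating the square
  root, the power 3 / 4 from the value of the remaining factors at the edge, and the cube from the
  normalising constant times \<open>density_product_edge\<close>.\<close>

definition tail_constant :: real where
  "tail_constant = 2 / 3 * ((1 - q) powr (3 / 4) * q_pochhammer_inf q q ^ 3 / pi)"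

lemma density_product_edge: "density_product (- c) = (q_pochhammer_inf q q)\<^sup>2"
proof -
  have "(1 - q) * (- c)\<^sup>2 = 4" using edge_sq by simp
  then have "(1 + q ^ Suc k)\<^sup>2 - (1 - q) * (- c)\<^sup>2 * q ^ Suc k = (1 - q * q ^ k)\<^sup>2" for k
    by (simp only:) (simp add: power2_eq_square algebra_simps)
  then show ?thesis
    by (simp add: density_product_def q_pochhammer_inf_def prodinf_power[OF convergent_pochhammer])
qed

text \<open>With x = u - c the expression 4 - (1 - q) x^2 factors as u (1 - q) (2 c - u), so the
  density is sqrt u times a function h continuous at the edge. The tail is then squeezed between (h
  0 - \<eta>) and (h 0 + \<eta>) times the integral of sqrt.\<close>

lemma tail_asymp: "((\<lambda>\<epsilon>. qOU_tail q \<epsilon> / \<epsilon> powr (3 / 2)) \<longlongrightarrow> tail_constant) (at_right 0)"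
proof -
  define h where "h u = sqrt (1 - q) * q_pochhammer_inf q q / (2 * pi) * sqrt ((1 - q) * (2 * c - u)) * density_product (u - c)" for u
  have core: "density_core (u - c) = sqrt u * h u" for u
  proof -
    have "4 - (1 - q) * (u - c)\<^sup>2 = u * ((1 - q) * (2 * c - u))"
      by (subst edge_sq[symmetric]) (simp add: algebra_simps power2_eq_square)
    then show ?thesis by (simp add: density_core_def h_def real_sqrt_mult)
  qed
  have sub: "u - c \<in> qOU_states q" if "u \<in> {0..c}" for u using that edge_pos by (auto simp: qOU_states_eq)
  have "continuous_on {0..c} (\<lambda>u. density_product (u - c))"
  proof (rule continuous_on_compose2[OF continuous_on_density_product])
    show "continuous_on {0..c} (\<lambda>u. u - c)" by (intro continuous_intros)
    show "(\<lambda>u. u - c) ` {0..c} \<subseteq> qOU_states q" using sub by blast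
  qed
  then have conth: "continuous_on {0..c} h"
    unfolding h_def by (intro continuous_intros)
  have h0: "2 / 3 * h 0 = tail_constant"
  proof -
    have a: "sqrt ((1 - q) * (2 * c)) = 2 * (1 - q) powr (1 / 4)"
    proof (rule real_sqrt_unique)
      have "(2 * (1 - q) powr (1 / 4))\<^sup>2 = 4 * (1 - q) powr (1 / 2)"
        by (simp add: power2_eq_square powr_add[symmetric])
      also have "\<dots> = 4 * sqrt (1 - q)" using q by (simp add: powr_half_sqrt)
      also have "sqrt (1 - q) = (1 - q) / sqrt (1 - q)" using q by (simp add: real_div_sqrt)
      also have "4 * ((1 - q) / sqrt (1 - q)) = (1 - q) * (2 * c)" by (simp add: qOU_edge_def)
      finally show "(2 * (1 - q) powr (1 / 4))\<^sup>2 = (1 - q) * (2 * c)" .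
    qed auto
    have b: "sqrt (1 - q) * (1 - q) powr (1 / 4) = (1 - q) powr (3 / 4)"
      using q by (simp add: powr_half_sqrt[symmetric] powr_add[symmetric])
    have "h 0 = sqrt (1 - q) * (1 - q) powr (1 / 4) * (q_pochhammer_inf q q * (q_pochhammer_inf q q)\<^sup>2) / pi"
      using a density_product_edge by (simp add: h_def)
    then show ?thesis unfolding b tail_constant_def
      by (simp add: power3_eq_cube power2_eq_square)
  qed
  have tail: "qOU_tail q e = (LINT u:{0..e}|lborel. sqrt u * h u)" if e: "0 < e" "e \<le> c" for e
  proof -
    have "qOU_tail q e = (LINT u|lborel. indicator {..<e - c} (u - c) * qOU_density q (u - c))"
      unfolding qOU_tail_def set_lebesgue_integral_def
      by (subst lborel_integral_real_affine[where c=1 and t="- c"]) (auto simp: add.commute)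
    also have "\<dots> = (LINT u|lborel. indicator {0..e} u * (sqrt u * h u))"
    proof (rule integral_cong_AE)
      show "(\<lambda>u. indicator {..<e - c} (u - c) * qOU_density q (u - c)) \<in> borel_measurable lborel"
        by measurable
      show "(\<lambda>u. indicator {0..e} u * (sqrt u * h u)) \<in> borel_measurable lborel"
      proof -
        have "continuous_on {0..e} h" by (rule continuous_on_subset[OF conth]) (use e in auto)
        then have "continuous_on {0..e} (\<lambda>u. sqrt u * h u)" by (intro continuous_intros)
        from borel_measurable_continuous_on_indicator[OF _ this] show ?thesis by simp
      qed
      show "AE u in lborel. indicator {..<e - c} (u - c) * qOU_density q (u - c)
          = indicator {0..e} u * (sqrt u * h u)"
        using AE_lborel_singleton[of e]
      proof eventually_elim
        case (elim u)
        show ?case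
        proof (cases "u \<in> {0..<e}")
          case True
          then show ?thesis using sub[of u] e by (simp add: density_eq core)
        next
          case False
          then have "e < u \<or> u < 0" using elim by auto
          then show ?thesis
          proof
            assume "e < u"
            then show ?thesis by simp
          next
            assume "u < 0"
            then show ?thesis by (simp add: density_outside qOU_states_eq)
          qed
        qed
      qed
    qed
    finally show ?thesis by (simp add: set_lebesgue_integral_def)
  qed
  show ?thesis
  proof (rule tendstoI)
    fix \<eta> :: real assume \<eta>: "0 < \<eta>"
    obtain e0 where e0: "0 < e0" "\<And>u. u \<in> {0..c} \<Longrightarrow> dist u 0 < e0 \<Longrightarrow> dist (h u) (h 0) < \<eta>"
      using conth[unfolded continuous_on_iff, rule_format, of 0 \<eta>] \<eta> edge_pos by auto
    have "\<forall>\<^sub>F e in at_right 0. e \<in> {0<..<min e0 c}"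
      using e0 edge_pos by (intro eventually_at_right_real) auto
    then show "\<forall>\<^sub>F e in at_right 0. dist (qOU_tail q e / e powr (3 / 2)) tail_constant < \<eta>"
    proof eventually_elim
      case (elim e)
      then have e: "0 < e" "e < e0" "e \<le> c" by auto
      have hb: "h 0 - \<eta> \<le> h u" "h u \<le> h 0 + \<eta>" if "u \<in> {0..e}" for u
        using e0(2)[of u] that e by (auto simp: dist_real_def)
      have int: "set_integrable lborel {0..e} (\<lambda>u. sqrt u * k u)" if "continuous_on {0..c} k" for k
        unfolding set_integrable_def
        by (intro borel_integrable_compact continuous_intros continuous_on_subset[OF that]) (use e in auto)
      have "(LINT u:{0..e}|lborel. sqrt u * (h 0 - \<eta>)) \<le> qOU_tail q e"
        unfolding tail[OF e(1,3)] by (intro set_integral_mono int conth continuous_intros mult_left_mono hb) auto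
      moreover have "qOU_tail q e \<le> (LINT u:{0..e}|lborel. sqrt u * (h 0 + \<eta>))"
        unfolding tail[OF e(1,3)] by (intro set_integral_mono int conth continuous_intros mult_left_mono hb) auto
      ultimately have "2 / 3 * e powr (3 / 2) * (h 0 - \<eta>) \<le> qOU_tail q e"
        "qOU_tail q e \<le> 2 / 3 * e powr (3 / 2) * (h 0 + \<eta>)"
        using set_integral_sqrt[of e] e by simp_all
      then have "2 / 3 * (h 0 - \<eta>) * e powr (3 / 2) \<le> qOU_tail q e"
        "qOU_tail q e \<le> 2 / 3 * (h 0 + \<eta>) * e powr (3 / 2)"
        by (simp_all only: mult_ac)
      moreover have "0 < e powr (3 / 2)" using e by simp
      ultimately have "2 / 3 * (h 0 - \<eta>) \<le> qOU_tail q e / e powr (3 / 2)"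
        "qOU_tail q e / e powr (3 / 2) \<le> 2 / 3 * (h 0 + \<eta>)"
        by (simp_all only: pos_le_divide_eq pos_divide_le_eq)
      then show ?case using \<eta> unfolding h0[symmetric] dist_real_def distrib_left right_diff_distrib
        by linarith
    qed
  qed
qed

text \<open>The kernel at \<rho> = 1 is 16 P^4, the 16 being its factor k = 0; the constants combine
  to 2 / 16 * 4 / 9 = 1 / 18, and the powers of the Pochhammer symbol to 1 + 6 = 7.\<close>

lemma rate_eq: "qOU_rate q = qOU_jump_rate * tail_constant\<^sup>2"
proof -
  define N where "N = q_pochhammer_inf q q"
  define P where "P = (\<Prod>k. 1 + q ^ Suc k)"
  have c1: "convergent_prod (\<lambda>k. 1 - q ^ Suc k)" using convergent_pochhammer by simp
  have N: "N = (\<Prod>k. 1 - q ^ Suc k)" by (simp add: N_def q_pochhammer_inf_def)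
  have "summable (\<lambda>k. norm (q ^ Suc k))"
    unfolding norm_power using q summable_geometric[of "\<bar>q\<bar>"] by (subst summable_Suc_iff) simp
  then have c2: "convergent_prod (\<lambda>k. 1 + q ^ Suc k)"
    by (intro abs_convergent_prod_imp_convergent_prod) (simp add: abs_convergent_prod_conv_summable)
  then have c3: "convergent_prod (\<lambda>k. 1 + q ^ k)" using convergent_prod_Suc_iff[of "\<lambda>k. 1 + q ^ k"] by simp
  have "(\<Prod>k. 1 + q ^ k) = 2 * P"
    using prodinf_split_head[OF c3] by (simp add: P_def)
  then have K: "qOU_kernel q 1 (- c) c = 16 * P ^ 4"
    by (simp add: qOU_kernel_def psi_edges prodinf_power[OF c3] power_mult_distrib)
  have "(\<Prod>k. (1 - q ^ Suc k) ^ 7 / (1 + q ^ Suc k) ^ 4) = N ^ 7 / P ^ 4"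
    using prodinf_divide[OF convergent_prod_power[OF c1] convergent_prod_power[OF c2], of 7 4]
    unfolding prodinf_power[OF c1] prodinf_power[OF c2] N P_def by simp
  then have "qOU_rate q = 1 / (18 * pi\<^sup>2) * (1 - q) powr (3 / 2) * (N ^ 7 / P ^ 4)"
    by (simp add: qOU_rate_def)
  moreover have "((1 - q) powr (3 / 4))\<^sup>2 = (1 - q) powr (3 / 2)"
    by (simp add: power2_eq_square powr_add[symmetric])
  then have "tail_constant\<^sup>2 = 4 / 9 * ((1 - q) powr (3 / 2) * N ^ 6 / pi\<^sup>2)"
    by (simp add: tail_constant_def N_def[symmetric] power_mult_distrib power_divide power_mult[symmetric])
  moreover have "N ^ 7 = N * N ^ 6" by (simp add: power_numeral_reduce)
  ultimately show ?thesis unfolding qOU_jump_rate_def K N_def[symmetric]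
    by (simp only:) (simp add: field_simps)
qed

lemma tail_constant_pos: "0 < tail_constant"
  using pochhammer_pos q by (simp add: tail_constant_def)

lemma rate_pos: "0 < qOU_rate q"
  using tail_constant_pos jump_rate_pos by (simp add: rate_eq)

end

section \<open>Grid counts of the process\<close>

lemma step_count_0 [simp]: "step_count f a b d 0 = 0"
  by (simp add: step_count_def)

lemma step_count_Suc:
  "step_count f a b d (Suc m) =
    step_count f a b d m + (if f (real m * d) < a \<and> f (real (Suc m) * d) > b then 1 else 0)"
proof -
  let ?P = "\<lambda>i. f (real i * d) < a \<and> f (real (Suc i) * d) > b"
  have "{i. i < Suc m \<and> ?P i} = (if ?P m then insert m {i. i < m \<and> ?P i} else {i. i < m \<and> ?P i})"
    by (auto simp: less_Suc_eq)
  then show ?thesis unfolding step_count_def by (simp del: of_nat_Suc)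
qed

lemma step_count_le: "step_count f a b d m \<le> m"
  by (induction m) (auto simp: step_count_Suc simp del: of_nat_Suc)

text \<open>Sets of k + 1 extreme steps are sorted by their last element j; the other k are chosen
  among the extreme steps before j.\<close>

lemma step_count_binomial_sum:
  "real (step_count f a b d m choose Suc k) =
    (\<Sum>j<m. indicator {..<a} (f (real j * d)) * indicator {b<..} (f (real (Suc j) * d))
      * real (step_count f a b d j choose k))"
  by (induction m) (auto simp: step_count_Suc simp del: of_nat_Suc)

lemma step_count_measurable:
  fixes X :: "real \<Rightarrow> 'a \<Rightarrow> real"
  assumes "\<And>i. i \<le> m \<Longrightarrow> (\<lambda>\<omega>. X (real i * d) \<omega>) \<in> borel_measurable N"
  shows "(\<lambda>\<omega>. step_count (\<lambda>t. X t \<omega>) a b d m) \<in> measurable N (count_space UNIV)"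
  using assms
proof (induction m)
  case (Suc m)
  have [measurable]: "(\<lambda>\<omega>. X (real m * d) \<omega>) \<in> borel_measurable N"
      "(\<lambda>\<omega>. X (real (Suc m) * d) \<omega>) \<in> borel_measurable N"
      "(\<lambda>\<omega>. step_count (\<lambda>t. X t \<omega>) a b d m) \<in> measurable N (count_space UNIV)"
    using Suc.prems[of m] Suc.prems[of "Suc m"] Suc by auto
  show ?case unfolding step_count_Suc by measurable
qed simp

locale qOU_process = q_ornstein_uhlenbeck M q X + qOU_parameter q
  for M :: "'a measure" and q :: real and X :: "real \<Rightarrow> 'a \<Rightarrow> real"
begin

section \<open>Filtration and the Markov property as a two-sided estimate\<close>

lemma space_filtration [simp]: "space (natural_filtration M X s) = space M"
  by (simp add: natural_filtration_def space_measure_of_conv)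

lemma sets_filtration:
  "sets (natural_filtration M X s) =
    sigma_sets (space M) {X u -` B \<inter> space M | u B. u \<in> {0..s} \<and> B \<in> sets borel}"
  unfolding natural_filtration_def by (rule sets_measure_of) auto

lemma filtration_measurable: "0 \<le> u \<Longrightarrow> u \<le> s \<Longrightarrow> X u \<in> borel_measurable (natural_filtration M X s)"
  by (rule measurableI) (auto simp: sets_filtration intro!: sigma_sets.Basic)

lemma subalgebra_filtration: "subalgebra M (natural_filtration M X s)"
proof -
  have "sets (natural_filtration M X s) \<subseteq> sets M"
    unfolding sets_filtration
    by (rule sets.sigma_sets_subset) (auto intro!: measurable_sets[OF random_variables])
  then show ?thesis by (simp add: subalgebra_def)
qed

lemma transition_integral_bounds:
  assumes x: "x \<in> qOU_states q" and \<delta>: "0 < \<delta>" and B: "B \<in> sets borel"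
    and bd: "\<And>y. y \<in> B \<Longrightarrow> y \<in> qOU_states q \<Longrightarrow> lo \<le> qOU_ratio q \<delta> x y \<and> qOU_ratio q \<delta> x y \<le> hi"
  shows "lo * (LINT y:B|lborel. qOU_density q y) \<le> (LINT y:B|lborel. qOU_ratio q \<delta> x y * qOU_density q y)"
    and "(LINT y:B|lborel. qOU_ratio q \<delta> x y * qOU_density q y) \<le> hi * (LINT y:B|lborel. qOU_density q y)"
proof -
  let ?S = "qOU_states q"
  define \<rho> where "\<rho> = exp (- \<delta>)"
  have \<rho>: "\<rho> \<in> {0..1}" using \<delta> by (simp add: \<rho>_def)
  have "continuous_on ?S (\<lambda>y. (\<lambda>(\<rho>, x, y). qOU_kernel q \<rho> x y) (\<rho>, x, y))"
    by (rule continuous_on_compose2[OF continuous_on_kernel]) (use x \<rho> in \<open>auto intro!: continuous_intros\<close>)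
  then have [measurable]: "(\<lambda>y. indicator ?S y *\<^sub>R qOU_kernel q \<rho> x y) \<in> borel_measurable borel"
    by (intro borel_measurable_continuous_on_indicator) (auto simp: qOU_states_eq)
  \<comment> \<open>Off the state space both sides are 0 because the density is. This replaces the
    ratio by a quotient whose measurability follows from continuity of the kernel on the
    states.\<close>
  have eq: "qOU_ratio q \<delta> x y * qOU_density q y
      = q_pochhammer_inf (exp (- 2 * \<delta>)) q / (indicator ?S y *\<^sub>R qOU_kernel q \<rho> x y) * qOU_density q y" for y
    using ratio_eq[of \<delta> x y] x \<delta> by (cases "y \<in> ?S") (auto simp: density_outside \<rho>_def)
  have dens: "set_integrable lborel B (qOU_density q)"
    unfolding set_integrable_def using B by (intro integrable_mult_indicator density_integrable) auto
  have int: "set_integrable lborel B (\<lambda>y. qOU_ratio q \<delta> x y * qOU_density q y)"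
    unfolding set_integrable_def
  proof (rule Bochner_Integration.integrable_bound)
    show "integrable lborel (\<lambda>y. (\<bar>lo\<bar> + \<bar>hi\<bar>) * qOU_density q y)"
      by (intro integrable_mult_right density_integrable)
    show "(\<lambda>y. indicator B y *\<^sub>R (qOU_ratio q \<delta> x y * qOU_density q y)) \<in> borel_measurable lborel"
      unfolding eq using B by measurable
    show "AE y in lborel. norm (indicator B y *\<^sub>R (qOU_ratio q \<delta> x y * qOU_density q y))
        \<le> norm ((\<bar>lo\<bar> + \<bar>hi\<bar>) * qOU_density q y)"
    proof (rule AE_I2)
      fix y
      show "norm (indicator B y *\<^sub>R (qOU_ratio q \<delta> x y * qOU_density q y)) \<le> norm ((\<bar>lo\<bar> + \<bar>hi\<bar>) * qOU_density q y)"
      proof (cases "y \<in> B \<and> y \<in> ?S")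
        case True
        then have "\<bar>qOU_ratio q \<delta> x y\<bar> \<le> \<bar>lo\<bar> + \<bar>hi\<bar>" using bd[of y] by linarith
        then show ?thesis using True by (simp add: abs_mult mult_right_mono)
      qed (auto simp: density_outside)
    qed
  qed
  have "(LINT y:B|lborel. lo * qOU_density q y) \<le> (LINT y:B|lborel. qOU_ratio q \<delta> x y * qOU_density q y)"
  proof (intro set_integral_mono int set_integrable_mult_right dens)
    fix y assume "y \<in> B"
    then show "lo * qOU_density q y \<le> qOU_ratio q \<delta> x y * qOU_density q y"
      using bd[of y] by (cases "y \<in> ?S") (auto simp: density_outside density_nonneg mult_right_mono)
  qed
  then show "lo * (LINT y:B|lborel. qOU_density q y) \<le> (LINT y:B|lborel. qOU_ratio q \<delta> x y * qOU_density q y)"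
    by simp
  have "(LINT y:B|lborel. qOU_ratio q \<delta> x y * qOU_density q y) \<le> (LINT y:B|lborel. hi * qOU_density q y)"
  proof (intro set_integral_mono int set_integrable_mult_right dens)
    fix y assume "y \<in> B"
    then show "qOU_ratio q \<delta> x y * qOU_density q y \<le> hi * qOU_density q y"
      using bd[of y] by (cases "y \<in> ?S") (auto simp: density_outside density_nonneg mult_right_mono)
  qed
  then show "(LINT y:B|lborel. qOU_ratio q \<delta> x y * qOU_density q y) \<le> hi * (LINT y:B|lborel. qOU_density q y)"
    by simp
qed

text \<open>Z is a weight depending on the past and vanishing unless X s lies in A. Bounds of the
  ratio on A and B alone are therefore enough, with no control of the transition density
  elsewhere.\<close>

lemma markov_bounds:
  assumes st: "0 \<le> s" "s < t" and B: "B \<in> sets borel"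
    and Z: "Z \<in> borel_measurable (natural_filtration M X s)"
    and Z0: "\<And>\<omega>. 0 \<le> Z \<omega>" "\<And>\<omega>. Z \<omega> \<le> K"
    and supp: "\<And>\<omega>. \<omega> \<in> space M \<Longrightarrow> Z \<omega> \<noteq> 0 \<Longrightarrow> X s \<omega> \<in> A"
    and bd: "\<And>x y. x \<in> A \<Longrightarrow> x \<in> qOU_states q \<Longrightarrow> y \<in> B \<Longrightarrow> y \<in> qOU_states q \<Longrightarrow>
      lo \<le> qOU_ratio q (t - s) x y \<and> qOU_ratio q (t - s) x y \<le> hi"
  shows "lo * (LINT y:B|lborel. qOU_density q y) * expectation Z
      \<le> expectation (\<lambda>\<omega>. Z \<omega> * indicator B (X t \<omega>))"
    and "expectation (\<lambda>\<omega>. Z \<omega> * indicator B (X t \<omega>))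
      \<le> hi * (LINT y:B|lborel. qOU_density q y) * expectation Z"
proof -
  let ?F = "natural_filtration M X s"
  let ?p = "LINT y:B|lborel. qOU_density q y"
  let ?g = "indicat_real (X t -` B \<inter> space M)"
  let ?E = "real_cond_exp M ?F ?g"
  interpret fin: finite_measure_subalgebra M ?F
    by unfold_locales (rule subalgebra_filtration)
  have [measurable]: "X t \<in> borel_measurable M" using random_variables st by simp
  note [measurable] = B
  have ZM [measurable]: "Z \<in> borel_measurable M"
    using measurable_from_subalg[OF subalgebra_filtration Z] .
  have gM [measurable]: "?g \<in> borel_measurable M" by measurable
  have Zint: "integrable M Z"
    using Z0 by (intro integrable_const_bound[where B=K]) auto
  have Zg: "integrable M (\<lambda>\<omega>. Z \<omega> * ?g \<omega>)"
  proof (rule integrable_const_bound[where B="\<bar>K\<bar>"])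
    show "AE \<omega> in M. norm (Z \<omega> * ?g \<omega>) \<le> \<bar>K\<bar>"
      using Z0 by (intro AE_I2) (auto simp: indicator_def intro: order_trans[OF _ abs_ge_self])
  qed measurable
  note ce = fin.real_cond_exp_intg[OF Zg Z gM]
  have eq: "expectation (\<lambda>\<omega>. Z \<omega> * indicator B (X t \<omega>)) = expectation (\<lambda>\<omega>. Z \<omega> * ?E \<omega>)"
    unfolding ce(2) by (intro Bochner_Integration.integral_cong) (auto simp: indicator_def)
  have AE: "AE \<omega> in M. lo * ?p * Z \<omega> \<le> Z \<omega> * ?E \<omega> \<and> Z \<omega> * ?E \<omega> \<le> hi * ?p * Z \<omega>"
    using markov[OF st B] AE_space
  proof eventually_elim
    case (elim \<omega>)
    show ?case
    proof (cases "Z \<omega> = 0")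
      case False
      have "X s \<omega> \<in> A" "X s \<omega> \<in> qOU_states q"
        using supp[OF elim(2) False] states[OF st(1) elim(2)] by auto
      then have "lo * ?p \<le> ?E \<omega>" "?E \<omega> \<le> hi * ?p"
        unfolding elim(1) qOU_transition_eq
        using transition_integral_bounds[of "X s \<omega>" "t - s" B lo hi] st B bd by auto
      then have "Z \<omega> * (lo * ?p) \<le> Z \<omega> * ?E \<omega>" "Z \<omega> * ?E \<omega> \<le> Z \<omega> * (hi * ?p)"
        using Z0(1)[of \<omega>] by (simp_all add: mult_left_mono)
      then show ?thesis by (simp add: mult_ac)
    qed simp
  qed
  have "expectation (\<lambda>\<omega>. lo * ?p * Z \<omega>) \<le> expectation (\<lambda>\<omega>. Z \<omega> * ?E \<omega>)"
    using AE by (intro integral_mono_AE ce(1) integrable_mult_right Zint) auto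
  then show "lo * ?p * expectation Z \<le> expectation (\<lambda>\<omega>. Z \<omega> * indicator B (X t \<omega>))" unfolding eq by simp
  have "expectation (\<lambda>\<omega>. Z \<omega> * ?E \<omega>) \<le> expectation (\<lambda>\<omega>. hi * ?p * Z \<omega>)"
    using AE by (intro integral_mono_AE ce(1) integrable_mult_right Zint) auto
  then show "expectation (\<lambda>\<omega>. Z \<omega> * indicator B (X t \<omega>)) \<le> hi * ?p * expectation Z" unfolding eq by simp
qed

lemma marginal_prob:
  assumes "0 \<le> t" "B \<in> sets borel"
  shows "expectation (\<lambda>\<omega>. indicator B (X t \<omega>)) = (LINT y:B|lborel. qOU_density q y)"
proof -
  have "(\<integral>y. qOU_density q y * indicator B y \<partial>lborel) = expectation (\<lambda>\<omega>. indicator B (X t \<omega>))"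
    by (rule distributed_integral[OF marginal[OF assms(1)]]) (use assms(2) density_nonneg in auto)
  then show ?thesis by (simp add: set_lebesgue_integral_def mult.commute)
qed


section \<open>Moments of grid counts and their recursion\<close>

definition steps :: "real \<Rightarrow> real \<Rightarrow> nat \<Rightarrow> 'a \<Rightarrow> nat" where
  "steps \<epsilon> \<delta> m \<omega> = step_count (\<lambda>t. X t \<omega>) (- c + \<epsilon>) (c - \<epsilon>) \<delta> m"

definition low :: "real \<Rightarrow> real \<Rightarrow> 'a \<Rightarrow> real" where
  "low \<epsilon> t \<omega> = indicator {..< - c + \<epsilon>} (X t \<omega>)"

definition high :: "real \<Rightarrow> real \<Rightarrow> 'a \<Rightarrow> real" where
  "high \<epsilon> t \<omega> = indicator {c - \<epsilon><..} (X t \<omega>)"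

text \<open>Takes the part of \<open>a k j\<close> in the renewal bounds. The two ends of the step
  stay separate factors because the Markov property is applied between them.\<close>

definition hit_moment :: "real \<Rightarrow> real \<Rightarrow> nat \<Rightarrow> nat \<Rightarrow> real" where
  "hit_moment \<epsilon> \<delta> k j =
    expectation (\<lambda>\<omega>. low \<epsilon> (real j * \<delta>) \<omega> * high \<epsilon> (real (Suc j) * \<delta>) \<omega> * real (steps \<epsilon> \<delta> j \<omega> choose k))"

lemma low_bounds: "0 \<le> low \<epsilon> t \<omega>" "low \<epsilon> t \<omega> \<le> 1" by (auto simp: low_def indicator_def)
lemma high_bounds: "0 \<le> high \<epsilon> t \<omega>" "high \<epsilon> t \<omega> \<le> 1" by (auto simp: high_def indicator_def)

lemma low_measurable: "0 \<le> t \<Longrightarrow> t \<le> s \<Longrightarrow> low \<epsilon> t \<in> borel_measurable (natural_filtration M X s)"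
  unfolding low_def[abs_def] using filtration_measurable[of t s] by measurable

lemma high_measurable: "0 \<le> t \<Longrightarrow> t \<le> s \<Longrightarrow> high \<epsilon> t \<in> borel_measurable (natural_filtration M X s)"
  unfolding high_def[abs_def] using filtration_measurable[of t s] by measurable

lemma steps_measurable_filtration:
  assumes "0 \<le> \<delta>" "real m * \<delta> \<le> s"
  shows "steps \<epsilon> \<delta> m \<in> measurable (natural_filtration M X s) (count_space UNIV)"
  unfolding steps_def[abs_def]
proof (rule step_count_measurable)
  fix i assume "i \<le> m"
  then have "real i * \<delta> \<le> real m * \<delta>" using assms(1) by (intro mult_right_mono) auto
  then show "X (real i * \<delta>) \<in> borel_measurable (natural_filtration M X s)"
    using assms by (intro filtration_measurable) auto
qed

lemma filtration_measurableD: "f \<in> measurable (natural_filtration M X s) N \<Longrightarrow> f \<in> measurable M N"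
  by (rule measurable_from_subalg[OF subalgebra_filtration])

lemma steps_measurable: "0 \<le> \<delta> \<Longrightarrow> steps \<epsilon> \<delta> m \<in> measurable M (count_space UNIV)"
  by (rule filtration_measurableD[OF steps_measurable_filtration[OF _ order_refl]])

lemma low_measurable_M [measurable]: "0 \<le> t \<Longrightarrow> low \<epsilon> t \<in> borel_measurable M"
  by (rule filtration_measurableD[OF low_measurable[OF _ order_refl]])

lemma high_measurable_M [measurable]: "0 \<le> t \<Longrightarrow> high \<epsilon> t \<in> borel_measurable M"
  by (rule filtration_measurableD[OF high_measurable[OF _ order_refl]])

lemma steps_le: "steps \<epsilon> \<delta> m \<omega> \<le> m"
  unfolding steps_def by (rule step_count_le)

lemma steps_choose_le: "real (steps \<epsilon> \<delta> m \<omega> choose k) \<le> 2 ^ m"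
proof -
  have "steps \<epsilon> \<delta> m \<omega> choose k \<le> 2 ^ steps \<epsilon> \<delta> m \<omega>" by (rule binomial_le_pow2)
  also have "(2::nat) ^ steps \<epsilon> \<delta> m \<omega> \<le> 2 ^ m" by (intro power_increasing steps_le) auto
  finally have "real (steps \<epsilon> \<delta> m \<omega> choose k) \<le> real (2 ^ m)" by (rule of_nat_mono)
  then show ?thesis by simp
qed

lemma hit_weight_bounds:
  "0 \<le> low \<epsilon> s \<omega> * high \<epsilon> t \<omega> * real (steps \<epsilon> \<delta> j \<omega> choose k)"
  "low \<epsilon> s \<omega> * high \<epsilon> t \<omega> * real (steps \<epsilon> \<delta> j \<omega> choose k) \<le> 2 ^ j"
proof -
  have *: "low \<epsilon> s \<omega> * high \<epsilon> t \<omega> \<le> 1" using low_bounds high_bounds by (intro mult_le_one) auto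
  show "0 \<le> low \<epsilon> s \<omega> * high \<epsilon> t \<omega> * real (steps \<epsilon> \<delta> j \<omega> choose k)" using low_bounds high_bounds by simp
  show "low \<epsilon> s \<omega> * high \<epsilon> t \<omega> * real (steps \<epsilon> \<delta> j \<omega> choose k) \<le> 2 ^ j"
    using mult_mono[OF * steps_choose_le[of \<epsilon> \<delta> j \<omega> k]] by simp
qed

lemma hit_weight_measurable:
  assumes "0 \<le> \<delta>"
  shows "(\<lambda>\<omega>. low \<epsilon> (real j * \<delta>) \<omega> * high \<epsilon> (real (Suc j) * \<delta>) \<omega> * real (steps \<epsilon> \<delta> j \<omega> choose k))
    \<in> borel_measurable (natural_filtration M X (real (Suc j) * \<delta>))"
proof -
  have le: "real j * \<delta> \<le> real (Suc j) * \<delta>" using assms by (intro mult_right_mono) auto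
  have [measurable]: "low \<epsilon> (real j * \<delta>) \<in> borel_measurable (natural_filtration M X (real (Suc j) * \<delta>))"
    "high \<epsilon> (real (Suc j) * \<delta>) \<in> borel_measurable (natural_filtration M X (real (Suc j) * \<delta>))"
    "steps \<epsilon> \<delta> j \<in> measurable (natural_filtration M X (real (Suc j) * \<delta>)) (count_space UNIV)"
    using assms le by (auto intro!: low_measurable high_measurable steps_measurable_filtration simp del: of_nat_Suc)
  show ?thesis by measurable
qed

lemma hit_moment_nonneg: "0 \<le> hit_moment \<epsilon> \<delta> k j"
  unfolding hit_moment_def by (intro Bochner_Integration.integral_nonneg hit_weight_bounds)

lemma bounded_integrable:
  fixes f :: "'a \<Rightarrow> real"
  assumes "f \<in> borel_measurable M" "\<And>\<omega>. 0 \<le> f \<omega>" "\<And>\<omega>. f \<omega> \<le> K"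
  shows "integrable M f"
  using assms by (intro integrable_const_bound[where B=K]) auto

lemma binomial_moment_eq:
  assumes "0 \<le> \<delta>"
  shows "expectation (\<lambda>\<omega>. real (steps \<epsilon> \<delta> m \<omega> choose Suc k)) = (\<Sum>j<m. hit_moment \<epsilon> \<delta> k j)"
proof -
  have "expectation (\<lambda>\<omega>. real (steps \<epsilon> \<delta> m \<omega> choose Suc k))
      = expectation (\<lambda>\<omega>. \<Sum>j<m. low \<epsilon> (real j * \<delta>) \<omega> * high \<epsilon> (real (Suc j) * \<delta>) \<omega> * real (steps \<epsilon> \<delta> j \<omega> choose k))"
    unfolding steps_def step_count_binomial_sum low_def high_def ..
  also have "\<dots> = (\<Sum>j<m. hit_moment \<epsilon> \<delta> k j)"
    unfolding hit_moment_def
    by (intro Bochner_Integration.integral_sum bounded_integrable[OF _ hit_weight_bounds]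
        filtration_measurableD[OF hit_weight_measurable[OF assms]])
  finally show ?thesis .
qed

text \<open>Splitting by the last earlier extreme step l yields products to which the Markov
  property applies twice, at the end of step l and at the start of step j.\<close>

lemma hit_moment_Suc:
  assumes "0 \<le> \<delta>"
  shows "hit_moment \<epsilon> \<delta> (Suc k) j = (\<Sum>l<j. expectation (\<lambda>\<omega>.
    low \<epsilon> (real l * \<delta>) \<omega> * high \<epsilon> (real (Suc l) * \<delta>) \<omega> * real (steps \<epsilon> \<delta> l \<omega> choose k)
      * low \<epsilon> (real j * \<delta>) \<omega> * high \<epsilon> (real (Suc j) * \<delta>) \<omega>))"
proof -
  let ?W = "\<lambda>l \<omega>. low \<epsilon> (real l * \<delta>) \<omega> * high \<epsilon> (real (Suc l) * \<delta>) \<omega> * real (steps \<epsilon> \<delta> l \<omega> choose k)"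
  let ?V = "\<lambda>l \<omega>. ?W l \<omega> * low \<epsilon> (real j * \<delta>) \<omega> * high \<epsilon> (real (Suc j) * \<delta>) \<omega>"
  have "hit_moment \<epsilon> \<delta> (Suc k) j = expectation (\<lambda>\<omega>. \<Sum>l<j. ?V l \<omega>)"
    unfolding hit_moment_def
  proof (intro Bochner_Integration.integral_cong refl)
    fix \<omega>
    have "real (steps \<epsilon> \<delta> j \<omega> choose Suc k) = (\<Sum>l<j. ?W l \<omega>)"
      unfolding steps_def step_count_binomial_sum low_def high_def ..
    then show "low \<epsilon> (real j * \<delta>) \<omega> * high \<epsilon> (real (Suc j) * \<delta>) \<omega> * real (steps \<epsilon> \<delta> j \<omega> choose Suc k)
        = (\<Sum>l<j. ?V l \<omega>)"
      by (simp add: sum_distrib_left mult_ac)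
  qed
  also have "\<dots> = (\<Sum>l<j. expectation (?V l))"
  proof (rule Bochner_Integration.integral_sum)
    fix l
    have [measurable]: "?W l \<in> borel_measurable M"
      by (rule filtration_measurableD[OF hit_weight_measurable[OF assms]])
    show "integrable M (?V l)"
    proof (rule bounded_integrable)
      have "0 \<le> real j * \<delta>" "0 \<le> real (Suc j) * \<delta>" using assms by auto
      then show "?V l \<in> borel_measurable M" by measurable
      fix \<omega>
      have u: "0 \<le> low \<epsilon> (real j * \<delta>) \<omega> * high \<epsilon> (real (Suc j) * \<delta>) \<omega>"
        "low \<epsilon> (real j * \<delta>) \<omega> * high \<epsilon> (real (Suc j) * \<delta>) \<omega> \<le> 1"
        using low_bounds high_bounds by (auto intro!: mult_le_one)
      show "0 \<le> ?V l \<omega>" unfolding mult.assoc[of "?W l \<omega>"] by (rule mult_nonneg_nonneg[OF hit_weight_bounds(1) u(1)])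
      show "?V l \<omega> \<le> 2 ^ l" unfolding mult.assoc[of "?W l \<omega>"]
        using mult_mono[OF hit_weight_bounds(2) u(2) _ u(1)] by simp
    qed
  qed
  finally show ?thesis .
qed

section \<open>Estimates for fixed level and mesh\<close>

context
  fixes \<epsilon> \<delta> loS hiS :: real
  assumes \<epsilon>: "\<epsilon> \<le> c" and \<delta>: "0 < \<delta>"
    and short: "\<And>x y. x \<in> {- c..- c + \<epsilon>} \<Longrightarrow> y \<in> {c - \<epsilon>..c} \<Longrightarrow>
      loS \<le> qOU_ratio q \<delta> x y \<and> qOU_ratio q \<delta> x y \<le> hiS"
    and hiS: "0 \<le> loS" "0 \<le> hiS"
begin

lemma last_step_bounds:
  assumes W: "W \<in> borel_measurable (natural_filtration M X (real j * \<delta>))"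
    and W0: "\<And>\<omega>. 0 \<le> W \<omega>" "\<And>\<omega>. W \<omega> \<le> K"
  shows "loS * qOU_tail q \<epsilon> * expectation (\<lambda>\<omega>. W \<omega> * low \<epsilon> (real j * \<delta>) \<omega>)
      \<le> expectation (\<lambda>\<omega>. W \<omega> * low \<epsilon> (real j * \<delta>) \<omega> * high \<epsilon> (real (Suc j) * \<delta>) \<omega>)"
    and "expectation (\<lambda>\<omega>. W \<omega> * low \<epsilon> (real j * \<delta>) \<omega> * high \<epsilon> (real (Suc j) * \<delta>) \<omega>)
      \<le> hiS * qOU_tail q \<epsilon> * expectation (\<lambda>\<omega>. W \<omega> * low \<epsilon> (real j * \<delta>) \<omega>)"
proof -
  let ?s = "real j * \<delta>" and ?t = "real (Suc j) * \<delta>"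
  have t: "?t - ?s = \<delta>" by (simp add: algebra_simps)
  have s0: "0 \<le> ?s" "?s < ?t" using \<delta> by (simp_all add: algebra_simps)
  have Z: "(\<lambda>\<omega>. W \<omega> * low \<epsilon> ?s \<omega>) \<in> borel_measurable (natural_filtration M X ?s)"
    by (intro borel_measurable_times W low_measurable s0) auto
  have Z0: "0 \<le> W \<omega> * low \<epsilon> ?s \<omega>" "W \<omega> * low \<epsilon> ?s \<omega> \<le> K" for \<omega>
    using W0[of \<omega>] low_bounds[of \<epsilon> ?s \<omega>] mult_left_le[of "low \<epsilon> ?s \<omega>" "W \<omega>"] by auto
  have supp: "X ?s \<omega> \<in> {..< - c + \<epsilon>}" if "W \<omega> * low \<epsilon> ?s \<omega> \<noteq> 0" for \<omega>
    using that by (auto simp: low_def indicator_def split: if_splits)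
  have bd: "loS \<le> qOU_ratio q (?t - ?s) x y \<and> qOU_ratio q (?t - ?s) x y \<le> hiS"
    if "x \<in> {..< - c + \<epsilon>}" "x \<in> qOU_states q" "y \<in> {c - \<epsilon><..}" "y \<in> qOU_states q" for x y
    unfolding t using that by (intro short) (auto simp: qOU_states_eq)
  note mb = markov_bounds[where A="{..< - c + \<epsilon>}" and B="{c - \<epsilon><..}", OF s0 _ Z Z0 supp bd]
  show "loS * qOU_tail q \<epsilon> * expectation (\<lambda>\<omega>. W \<omega> * low \<epsilon> ?s \<omega>)
      \<le> expectation (\<lambda>\<omega>. W \<omega> * low \<epsilon> ?s \<omega> * high \<epsilon> ?t \<omega>)"
    using mb(1) unfolding right_tail high_def by simp
  show "expectation (\<lambda>\<omega>. W \<omega> * low \<epsilon> ?s \<omega> * high \<epsilon> ?t \<omega>)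
      \<le> hiS * qOU_tail q \<epsilon> * expectation (\<lambda>\<omega>. W \<omega> * low \<epsilon> ?s \<omega>)"
    using mb(2) unfolding right_tail high_def by simp
qed

text \<open>One tail factor is the stationary probability of starting the step in the lower corner,
  the other comes from the transition to the upper one.\<close>

lemma hit_moment_0_bounds:
  "loS * (qOU_tail q \<epsilon>)\<^sup>2 \<le> hit_moment \<epsilon> \<delta> 0 j" "hit_moment \<epsilon> \<delta> 0 j \<le> hiS * (qOU_tail q \<epsilon>)\<^sup>2"
proof -
  have t0: "0 \<le> real j * \<delta>" using \<delta> by simp
  have e: "expectation (\<lambda>\<omega>. 1 * low \<epsilon> (real j * \<delta>) \<omega>) = qOU_tail q \<epsilon>"
    using marginal_prob[OF t0, of "{..< - c + \<epsilon>}"] by (simp add: low_def qOU_tail_def)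
  have h: "hit_moment \<epsilon> \<delta> 0 j
      = expectation (\<lambda>\<omega>. 1 * low \<epsilon> (real j * \<delta>) \<omega> * high \<epsilon> (real (Suc j) * \<delta>) \<omega>)"
    unfolding hit_moment_def by simp
  show "loS * (qOU_tail q \<epsilon>)\<^sup>2 \<le> hit_moment \<epsilon> \<delta> 0 j"
    using last_step_bounds(1)[of "\<lambda>_. 1" j 1] unfolding h e power2_eq_square by (simp add: mult_ac)
  show "hit_moment \<epsilon> \<delta> 0 j \<le> hiS * (qOU_tail q \<epsilon>)\<^sup>2"
    using last_step_bounds(2)[of "\<lambda>_. 1" j 1] unfolding h e power2_eq_square by (simp add: mult_ac)
qed

text \<open>Conditioning first at j \<delta> and then at (l + 1) \<delta>. The gap leads from the
  upper corner down to the lower one, opposite to the direction in \<open>gap\<close>;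
  \<open>ratio_sym\<close> reverses it. The condition \<open>Suc l < j\<close> makes the gap
  positive.\<close>

lemma pair_bounds:
  fixes k :: nat
  assumes l: "Suc l < j"
    and gap: "\<And>x y. x \<in> {- c..- c + \<epsilon>} \<Longrightarrow> y \<in> {c - \<epsilon>..c} \<Longrightarrow>
      lo \<le> qOU_ratio q (real (j - Suc l) * \<delta>) x y \<and> qOU_ratio q (real (j - Suc l) * \<delta>) x y \<le> hi"
  defines "V \<equiv> expectation (\<lambda>\<omega>.
      low \<epsilon> (real l * \<delta>) \<omega> * high \<epsilon> (real (Suc l) * \<delta>) \<omega> * real (steps \<epsilon> \<delta> l \<omega> choose k)
      * low \<epsilon> (real j * \<delta>) \<omega> * high \<epsilon> (real (Suc j) * \<delta>) \<omega>)"
  shows "loS * (qOU_tail q \<epsilon>)\<^sup>2 * (lo * hit_moment \<epsilon> \<delta> k l) \<le> V"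
    and "V \<le> hiS * (qOU_tail q \<epsilon>)\<^sup>2 * (hi * hit_moment \<epsilon> \<delta> k l)"
proof -
  let ?s = "real (Suc l) * \<delta>" and ?t = "real j * \<delta>"
  let ?W = "\<lambda>\<omega>. low \<epsilon> (real l * \<delta>) \<omega> * high \<epsilon> ?s \<omega> * real (steps \<epsilon> \<delta> l \<omega> choose k)"
  have s0: "0 \<le> ?s" "?s < ?t" using \<delta> l by auto
  have t: "?t - ?s = real (j - Suc l) * \<delta>" using l by (simp add: of_nat_diff algebra_simps)
  have W: "?W \<in> borel_measurable (natural_filtration M X ?s)"
    using \<delta> by (intro hit_weight_measurable) auto
  have supp: "X ?s \<omega> \<in> {c - \<epsilon><..}" if "?W \<omega> \<noteq> 0" for \<omega>
    using that by (auto simp: high_def indicator_def split: if_splits)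
  have bd: "lo \<le> qOU_ratio q (?t - ?s) x y \<and> qOU_ratio q (?t - ?s) x y \<le> hi"
    if "x \<in> {c - \<epsilon><..}" "x \<in> qOU_states q" "y \<in> {..< - c + \<epsilon>}" "y \<in> qOU_states q" for x y
  proof -
    have "0 \<le> real (j - Suc l) * \<delta>" using \<delta> by simp
    from ratio_sym[OF this that(2,4)] show ?thesis
      unfolding t using gap[of y x] that by (auto simp: qOU_states_eq)
  qed
  note mb = markov_bounds[where A="{c - \<epsilon><..}" and B="{..< - c + \<epsilon>}",
      OF s0 _ W hit_weight_bounds supp bd, folded qOU_tail_def]
  have e1: "lo * qOU_tail q \<epsilon> * hit_moment \<epsilon> \<delta> k l \<le> expectation (\<lambda>\<omega>. ?W \<omega> * low \<epsilon> ?t \<omega>)"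
    and e2: "expectation (\<lambda>\<omega>. ?W \<omega> * low \<epsilon> ?t \<omega>) \<le> hi * qOU_tail q \<epsilon> * hit_moment \<epsilon> \<delta> k l"
    using mb unfolding hit_moment_def low_def[of _ ?t] by simp_all
  have W': "?W \<in> borel_measurable (natural_filtration M X ?t)"
  proof -
    have "subalgebra (natural_filtration M X ?t) (natural_filtration M X ?s)"
      unfolding subalgebra_def sets_filtration using s0
      by (auto intro!: sigma_sets_mono' simp del: of_nat_Suc) (metis less_imp_le order_trans)
    then show ?thesis using W by (rule measurable_from_subalg)
  qed
  note ls = last_step_bounds[OF W' hit_weight_bounds]
  have "loS * qOU_tail q \<epsilon> * (lo * qOU_tail q \<epsilon> * hit_moment \<epsilon> \<delta> k l) \<le> V"
    unfolding V_def by (rule order_trans[OF mult_left_mono[OF e1] ls(1)]) (use hiS tail_nonneg in auto)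
  then show "loS * (qOU_tail q \<epsilon>)\<^sup>2 * (lo * hit_moment \<epsilon> \<delta> k l) \<le> V"
    by (simp add: power2_eq_square mult_ac)
  have "V \<le> hiS * qOU_tail q \<epsilon> * (hi * qOU_tail q \<epsilon> * hit_moment \<epsilon> \<delta> k l)"
    unfolding V_def by (rule order_trans[OF ls(2) mult_left_mono[OF e2]]) (use hiS tail_nonneg in auto)
  then show "V \<le> hiS * (qOU_tail q \<epsilon>)\<^sup>2 * (hi * hit_moment \<epsilon> \<delta> k l)"
    by (simp add: power2_eq_square mult_ac)
qed

text \<open>The shared grid point would have to lie in both corners, which are disjoint for
  \<epsilon> \<le> c. This settles the gap of length 0, for which there is no transition
  density.\<close>

lemma adjacent_zero:
  "expectation (\<lambda>\<omega>.
      low \<epsilon> (real l * \<delta>) \<omega> * high \<epsilon> (real (Suc l) * \<delta>) \<omega> * real (steps \<epsilon> \<delta> l \<omega> choose k)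
      * low \<epsilon> (real (Suc l) * \<delta>) \<omega> * high \<epsilon> (real (Suc (Suc l)) * \<delta>) \<omega>) = 0"
proof -
  have "high \<epsilon> t \<omega> = 0 \<or> low \<epsilon> t \<omega> = 0" for t \<omega>
    using \<epsilon> edge_pos by (auto simp: high_def low_def indicator_def)
  then show ?thesis
    by (intro integral_eq_zero_AE AE_I2) (auto simp del: of_nat_Suc)
qed

lemma hit_moment_Suc_upper:
  assumes C: "0 \<le> C" "0 \<le> h"
    and bd: "\<And>\<delta>' x y. 0 < \<delta>' \<Longrightarrow> x \<in> {- c..- c + \<epsilon>} \<Longrightarrow> y \<in> {c - \<epsilon>..c} \<Longrightarrow>
      0 \<le> qOU_ratio q \<delta>' x y \<and> qOU_ratio q \<delta>' x y \<le> C + h"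
    and mix: "\<And>i x y. g \<le> i \<Longrightarrow> 0 < i \<Longrightarrow> x \<in> {- c..- c + \<epsilon>} \<Longrightarrow> y \<in> {c - \<epsilon>..c} \<Longrightarrow> qOU_ratio q (real i * \<delta>) x y \<le> h"
  shows "hit_moment \<epsilon> \<delta> (Suc k) j
    \<le> hiS * (qOU_tail q \<epsilon>)\<^sup>2 * (\<Sum>l<j. (h + (if j - l \<le> g then C else 0)) * hit_moment \<epsilon> \<delta> k l)"
  unfolding hit_moment_Suc[OF less_imp_le[OF \<delta>]] sum_distrib_left
proof (intro sum_mono)
  fix l assume "l \<in> {..<j}"
  then consider "j = Suc l" | "Suc l < j" by fastforce
  then show "expectation (\<lambda>\<omega>.
      low \<epsilon> (real l * \<delta>) \<omega> * high \<epsilon> (real (Suc l) * \<delta>) \<omega> * real (steps \<epsilon> \<delta> l \<omega> choose k)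
      * low \<epsilon> (real j * \<delta>) \<omega> * high \<epsilon> (real (Suc j) * \<delta>) \<omega>)
    \<le> hiS * (qOU_tail q \<epsilon>)\<^sup>2 * ((h + (if j - l \<le> g then C else 0)) * hit_moment \<epsilon> \<delta> k l)"
  proof cases
    case 1
    show ?thesis unfolding 1 adjacent_zero
      using C hiS hit_moment_nonneg by (auto intro!: mult_nonneg_nonneg)
  next
    case 2
    show ?thesis
    proof (rule pair_bounds(2)[OF 2, of 0])
      fix x y assume xy: "x \<in> {- c..- c + \<epsilon>}" "y \<in> {c - \<epsilon>..c}"
      have p: "0 < real (j - Suc l) * \<delta>" using 2 \<delta> by simp
      show "0 \<le> qOU_ratio q (real (j - Suc l) * \<delta>) x y \<and>
          qOU_ratio q (real (j - Suc l) * \<delta>) x y \<le> h + (if j - l \<le> g then C else 0)"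
        \<comment> \<open>The gap has j - Suc l steps, so g < j - l is the same as a gap of at least
          g steps, where the bound h holds.\<close>
        using bd[OF p xy] mix[of "j - Suc l", OF _ _ xy] 2 by (auto simp: add.commute)
    qed
  qed
qed

lemma hit_moment_Suc_lower:
  assumes g: "0 < g"
    and mix: "\<And>i x y. g \<le> i \<Longrightarrow> 0 < i \<Longrightarrow> x \<in> {- c..- c + \<epsilon>} \<Longrightarrow> y \<in> {c - \<epsilon>..c} \<Longrightarrow>
      h \<le> qOU_ratio q (real i * \<delta>) x y \<and> qOU_ratio q (real i * \<delta>) x y \<le> h'"
  shows "loS * (qOU_tail q \<epsilon>)\<^sup>2 * (\<Sum>l<j. if j - l \<le> g then 0 else h * hit_moment \<epsilon> \<delta> k l)
    \<le> hit_moment \<epsilon> \<delta> (Suc k) j"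
  unfolding hit_moment_Suc[OF less_imp_le[OF \<delta>]] sum_distrib_left
proof (intro sum_mono)
  fix l assume "l \<in> {..<j}"
  show "loS * (qOU_tail q \<epsilon>)\<^sup>2 * (if j - l \<le> g then 0 else h * hit_moment \<epsilon> \<delta> k l)
    \<le> expectation (\<lambda>\<omega>.
      low \<epsilon> (real l * \<delta>) \<omega> * high \<epsilon> (real (Suc l) * \<delta>) \<omega> * real (steps \<epsilon> \<delta> l \<omega> choose k)
      * low \<epsilon> (real j * \<delta>) \<omega> * high \<epsilon> (real (Suc j) * \<delta>) \<omega>)"
  proof (cases "j - l \<le> g")
    case True
    show ?thesis using True low_bounds high_bounds
      by (auto intro!: Bochner_Integration.integral_nonneg mult_nonneg_nonneg)
  next
    case False
    then have 2: "Suc l < j" "g \<le> j - Suc l" "0 < j - Suc l" using g by auto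
    show ?thesis using pair_bounds(1)[OF 2(1) mix[OF 2(2,3)], of k] False by simp
  qed
qed

end

end

section \<open>The limit of the binomial moments\<close>

context qOU_process
begin

text \<open>Every gap, short or long, gets the crude bound h. Separating short gaps would add to m a
  shift proportional to k, and the bound would then hold only from an n depending on k on.\<close>

lemma binomial_moments_dominated:
  fixes e \<delta> :: "nat \<Rightarrow> real" and m :: "nat \<Rightarrow> nat"
  assumes e: "filterlim e (at_right 0) sequentially" and \<delta>: "filterlim \<delta> (at_right 0) sequentially"
    and lim: "(\<lambda>n. real (m n) * \<delta> n * (qOU_tail q (e n))\<^sup>2) \<longlonglongrightarrow> A"
  obtains K where "\<forall>\<^sub>F n in sequentially. \<forall>k.
    expectation (\<lambda>\<omega>. real (steps (e n) (\<delta> n) (m n) \<omega> choose k)) \<le> K ^ k / fact k"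
proof -
  obtain d C where d: "0 < d" "d \<le> c" and C: "0 \<le> C"
    and bd: "\<And>\<delta> x y. 0 < \<delta> \<Longrightarrow> x \<in> {- c..- c + d} \<Longrightarrow> y \<in> {c - d..c} \<Longrightarrow>
      0 \<le> qOU_ratio q \<delta> x y \<and> qOU_ratio q \<delta> x y \<le> C"
    by (rule ratio_bounded_at_corner) blast
  obtain d' \<delta>0 where d': "0 < d'" "d' \<le> c" "0 < \<delta>0"
    and short: "\<And>\<delta> x y. 0 < \<delta> \<Longrightarrow> \<delta> < \<delta>0 \<Longrightarrow> x \<in> {- c..- c + d'} \<Longrightarrow> y \<in> {c - d'..c} \<Longrightarrow>
      \<bar>qOU_ratio q \<delta> x y - qOU_jump_rate * \<delta>\<bar> \<le> 1 * \<delta>"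
    by (rule ratio_short_time_at_corner[of 1]) auto
  define h where "h = max 1 C"
  define B where "B = (qOU_jump_rate + 1) * A + 1"
  have evs: "\<forall>\<^sub>F n in sequentially. e n \<in> {0<..<min d d'}" "\<forall>\<^sub>F n in sequentially. \<delta> n \<in> {0<..<\<delta>0}"
    using e \<delta> d d' eventually_at_right_real[of 0 "min d d'"] eventually_at_right_real[of 0 \<delta>0]
    unfolding filterlim_iff by auto
  have "(\<lambda>n. (qOU_jump_rate + 1) * (real (m n) * \<delta> n * (qOU_tail q (e n))\<^sup>2)) \<longlonglongrightarrow> (qOU_jump_rate + 1) * A"
    by (intro tendsto_intros lim)
  then have "\<forall>\<^sub>F n in sequentially. (qOU_jump_rate + 1) * (real (m n) * \<delta> n * (qOU_tail q (e n))\<^sup>2) < B"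
    by (rule order_tendstoD) (simp add: B_def)
  then have "\<forall>\<^sub>F n in sequentially. \<forall>k.
      expectation (\<lambda>\<omega>. real (steps (e n) (\<delta> n) (m n) \<omega> choose k)) \<le> (B * h) ^ k / fact k"
    using evs
  proof eventually_elim
    case (elim n)
    define P where "P = (qOU_jump_rate + 1) * \<delta> n * (qOU_tail q (e n))\<^sup>2"
    have en: "0 < e n" "e n < d" "e n < d'" "0 < \<delta> n" "\<delta> n < \<delta>0" using elim by auto
    have P: "0 \<le> P" using jump_rate_pos en by (simp add: P_def)
    have corner: "0 \<le> qOU_ratio q \<delta>' x y \<and> qOU_ratio q \<delta>' x y \<le> C"
      if "0 < \<delta>'" "x \<in> {- c..- c + e n}" "y \<in> {c - e n..c}" for \<delta>' x y
      using bd[of \<delta>' x y] that en by auto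
    have sh: "0 \<le> qOU_ratio q (\<delta> n) x y \<and> qOU_ratio q (\<delta> n) x y \<le> (qOU_jump_rate + 1) * \<delta> n"
      if "x \<in> {- c..- c + e n}" "y \<in> {c - e n..c}" for x y
      using short[of "\<delta> n" x y] corner[OF en(4) that] that en by (auto simp: algebra_simps)
    have ec: "e n \<le> c" using en d by simp
    have hS: "(0::real) \<le> 0" "0 \<le> (qOU_jump_rate + 1) * \<delta> n" using jump_rate_pos en by auto
    note a0 = hit_moment_0_bounds(2)[OF ec en(4) sh hS]
    \<comment> \<open>The case g = 0, C = 0, with the trivial conditional kept to match
      \<open>renewal_sum_upper_bound\<close>.\<close>
    have aS: "hit_moment (e n) (\<delta> n) (Suc k) j
        \<le> P * (\<Sum>l<j. (h + (if j - l \<le> 0 then 0 else 0)) * hit_moment (e n) (\<delta> n) k l)" for k j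
      unfolding P_def
    proof (rule hit_moment_Suc_upper[OF ec en(4) sh hS])
      fix \<delta>' x y :: real assume "0 < \<delta>'" "x \<in> {- c..- c + e n}" "y \<in> {c - e n..c}"
      then show "0 \<le> qOU_ratio q \<delta>' x y \<and> qOU_ratio q \<delta>' x y \<le> 0 + h"
        using corner[of \<delta>' x y] by (auto simp: h_def)
    next
      fix i :: nat and x y :: real assume "0 < i" "x \<in> {- c..- c + e n}" "y \<in> {c - e n..c}"
      then show "qOU_ratio q (real i * \<delta> n) x y \<le> h"
        using corner[of "real i * \<delta> n" x y] en by (auto simp: h_def)
    qed (auto simp: h_def)
    show ?case
    proof
      fix k
      show "expectation (\<lambda>\<omega>. real (steps (e n) (\<delta> n) (m n) \<omega> choose k)) \<le> (B * h) ^ k / fact k"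
      proof (cases k)
        case 0 then show ?thesis by (simp add: prob_space)
      next
        case (Suc k')
        have "expectation (\<lambda>\<omega>. real (steps (e n) (\<delta> n) (m n) \<omega> choose k))
            \<le> P ^ Suc k' * h ^ k' * (real (m n) + real k' * (real 0 * 0)) ^ Suc k' / fact (Suc k')"
          unfolding Suc binomial_moment_eq[OF less_imp_le[OF en(4)]]
          using P a0 aS unfolding P_def
          by (intro renewal_sum_upper_bound) (auto simp: h_def)
        also have "\<dots> = (P * real (m n)) ^ k * h ^ k' / fact k"
          by (simp add: Suc power_mult_distrib mult_ac)
        also have "\<dots> \<le> B ^ k * h ^ k / fact k"
        proof (intro divide_right_mono mult_mono power_mono)
          show "P * real (m n) \<le> B" using elim(1) by (simp add: P_def mult_ac)
          then have "0 \<le> B" using P by (meson mult_nonneg_nonneg of_nat_0_le_iff order_trans)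
          then show "0 \<le> B ^ k" by simp
          show "h ^ k' \<le> h ^ k" unfolding Suc by (rule power_increasing) (auto simp: h_def)
        qed (use P in \<open>auto simp: h_def\<close>)
        finally show ?thesis by (simp add: power_mult_distrib)
      qed
    qed
  qed
  then show thesis using that by blast
qed

text \<open>For fixed precision \<eta> the renewal bounds enclose the moments, with a gap called
  short if it is below a fixed mixing time L. As n grows the bounds tend to U \<eta> and V \<eta>,
  and these share the limit wanted as \<eta> tends to 0.\<close>

lemma binomial_moments_tendsto:
  fixes e \<delta> :: "nat \<Rightarrow> real" and m :: "nat \<Rightarrow> nat"
  assumes e: "filterlim e (at_right 0) sequentially" and \<delta>: "filterlim \<delta> (at_right 0) sequentially"
    and lim: "(\<lambda>n. real (m n) * \<delta> n * (qOU_tail q (e n))\<^sup>2) \<longlonglongrightarrow> A"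
    and tail0: "(\<lambda>n. qOU_tail q (e n)) \<longlonglongrightarrow> 0"
  shows "(\<lambda>n. expectation (\<lambda>\<omega>. real (steps (e n) (\<delta> n) (m n) \<omega> choose k)))
    \<longlonglongrightarrow> (qOU_jump_rate * A) ^ k / fact k"
proof (cases k)
  case 0 then show ?thesis by (simp add: prob_space)
next
  case (Suc k')
  let ?E = "\<lambda>n. expectation (\<lambda>\<omega>. real (steps (e n) (\<delta> n) (m n) \<omega> choose Suc k'))"
  let ?t = "\<lambda>n. (qOU_tail q (e n))\<^sup>2"
  obtain d1 C where d1: "0 < d1" "d1 \<le> c" and C: "0 \<le> C"
    and bd: "\<And>\<delta> x y. 0 < \<delta> \<Longrightarrow> x \<in> {- c..- c + d1} \<Longrightarrow> y \<in> {c - d1..c} \<Longrightarrow>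
      0 \<le> qOU_ratio q \<delta> x y \<and> qOU_ratio q \<delta> x y \<le> C"
    by (rule ratio_bounded_at_corner) blast
  obtain d2 where d2: "0 < d2" "d2 \<le> c"
    and mixing: "\<And>\<eta>. 0 < \<eta> \<Longrightarrow> \<exists>L>0. \<forall>\<delta>\<ge>L. \<forall>x\<in>{- c..- c + d2}. \<forall>y\<in>{c - d2..c}. \<bar>qOU_ratio q \<delta> x y - 1\<bar> \<le> \<eta>"
    by (rule ratio_tendsto_one_at_corner) blast
  have \<delta>0: "\<delta> \<longlonglongrightarrow> 0" using \<delta> by (rule filterlim_mono) (auto simp: at_within_le_nhds)
  have t0: "?t \<longlonglongrightarrow> 0" using tendsto_power[OF tail0, of 2] by simp
  have main: "\<forall>\<^sub>F n in sequentially. lower n \<le> ?E n \<and> ?E n \<le> upper n"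
    if \<eta>: "0 < \<eta>" "\<eta> < 1" "\<eta> < qOU_jump_rate" and L: "0 < L"
      "\<forall>\<delta>\<ge>L. \<forall>x\<in>{- c..- c + d2}. \<forall>y\<in>{c - d2..c}. \<bar>qOU_ratio q \<delta> x y - 1\<bar> \<le> \<eta>"
      and g: "\<And>n. g n = Suc (nat \<lceil>L / \<delta> n\<rceil>)"
      and upper: "\<And>n. upper n = ((qOU_jump_rate + \<eta>) * \<delta> n * ?t n) ^ Suc k' * (1 + \<eta>) ^ k' * (real (m n) + real k' * (real (g n) * C)) ^ Suc k' / fact (Suc k')"
      and lower: "\<And>n. lower n = ((qOU_jump_rate - \<eta>) * \<delta> n * ?t n) ^ Suc k' * (1 - \<eta>) ^ k' * (max 0 (real (m n) - 1 - real k' * real (Suc (g n)))) ^ Suc k' / fact (Suc k')"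
    for \<eta> L g upper lower
  proof -
    obtain d3 \<delta>0 where d3: "0 < d3" "d3 \<le> c" "0 < \<delta>0"
      and short: "\<And>\<delta> x y. 0 < \<delta> \<Longrightarrow> \<delta> < \<delta>0 \<Longrightarrow> x \<in> {- c..- c + d3} \<Longrightarrow> y \<in> {c - d3..c} \<Longrightarrow>
        \<bar>qOU_ratio q \<delta> x y - qOU_jump_rate * \<delta>\<bar> \<le> \<eta> * \<delta>"
      by (rule ratio_short_time_at_corner[OF \<eta>(1)]) blast
    have "\<forall>\<^sub>F n in sequentially. e n \<in> {0<..<min d1 (min d2 d3)}" "\<forall>\<^sub>F n in sequentially. \<delta> n \<in> {0<..<\<delta>0}"
      using e \<delta> d1 d2 d3 eventually_at_right_real[of 0 "min d1 (min d2 d3)"] eventually_at_right_real[of 0 \<delta>0]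
      unfolding filterlim_iff by auto
    then show ?thesis
    proof eventually_elim
      case (elim n)
      have en: "0 < e n" "e n < d1" "e n < d2" "e n < d3" "0 < \<delta> n" "\<delta> n < \<delta>0" using elim by auto
      have ec: "e n \<le> c" using en d1 by simp
      have sh: "(qOU_jump_rate - \<eta>) * \<delta> n \<le> qOU_ratio q (\<delta> n) x y \<and> qOU_ratio q (\<delta> n) x y \<le> (qOU_jump_rate + \<eta>) * \<delta> n"
        if "x \<in> {- c..- c + e n}" "y \<in> {c - e n..c}" for x y
        using short[of "\<delta> n" x y] that en by (auto simp: algebra_simps abs_le_iff)
      have hS: "0 \<le> (qOU_jump_rate - \<eta>) * \<delta> n" "0 \<le> (qOU_jump_rate + \<eta>) * \<delta> n"
        using \<eta> jump_rate_pos en by auto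
      have mix: "1 - \<eta> \<le> qOU_ratio q (real i * \<delta> n) x y \<and> qOU_ratio q (real i * \<delta> n) x y \<le> 1 + \<eta>"
        if "g n \<le> i" "x \<in> {- c..- c + e n}" "y \<in> {c - e n..c}" for i x y
      proof -
        have "L / \<delta> n \<le> real (nat \<lceil>L / \<delta> n\<rceil>)" by (rule real_nat_ceiling_ge)
        also have "\<dots> \<le> real i" using that(1) unfolding g by (intro of_nat_mono) (rule Suc_leD)
        finally have "L \<le> real i * \<delta> n" using en by (simp add: pos_divide_le_eq)
        moreover have "x \<in> {- c..- c + d2}" "y \<in> {c - d2..c}" using that en by auto
        ultimately have "\<bar>qOU_ratio q (real i * \<delta> n) x y - 1\<bar> \<le> \<eta>" using L(2) by blast
        then show ?thesis by linarith
      qed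
      note a0 = hit_moment_0_bounds[OF ec en(5) sh hS]
      have up: "hit_moment (e n) (\<delta> n) (Suc k) j \<le> (qOU_jump_rate + \<eta>) * \<delta> n * ?t n
          * (\<Sum>l<j. ((1 + \<eta>) + (if j - l \<le> g n then C else 0)) * hit_moment (e n) (\<delta> n) k l)" for k j
      proof (rule hit_moment_Suc_upper[OF ec en(5) sh hS])
        fix \<delta>' x y :: real assume "0 < \<delta>'" "x \<in> {- c..- c + e n}" "y \<in> {c - e n..c}"
        then show "0 \<le> qOU_ratio q \<delta>' x y \<and> qOU_ratio q \<delta>' x y \<le> C + (1 + \<eta>)"
          using bd[of \<delta>' x y] en \<eta> by auto
      qed (use C \<eta> mix in auto)
      have low: "(qOU_jump_rate - \<eta>) * \<delta> n * ?t n
          * (\<Sum>l<j. if j - l \<le> g n then 0 else (1 - \<eta>) * hit_moment (e n) (\<delta> n) k l)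
          \<le> hit_moment (e n) (\<delta> n) (Suc k) j" for k j
        by (rule hit_moment_Suc_lower[OF ec en(5) sh hS]) (use mix in \<open>auto simp: g\<close>)
      have "?E n \<le> upper n"
        unfolding upper binomial_moment_eq[OF less_imp_le[OF en(5)]]
        by (intro renewal_sum_upper_bound up a0) (use hS \<eta> C in auto)
      moreover have "lower n \<le> ?E n"
        unfolding lower binomial_moment_eq[OF less_imp_le[OF en(5)]]
        by (intro renewal_sum_lower_bound low a0) (use hS \<eta> in auto)
      ultimately show ?case by simp
    qed
  qed
  define U where "U \<eta> = ((qOU_jump_rate + \<eta>) * A) ^ Suc k' * (1 + \<eta>) ^ k' / fact (Suc k')" for \<eta>
  define V where "V \<eta> = ((qOU_jump_rate - \<eta>) * A) ^ Suc k' * (1 - \<eta>) ^ k' / fact (Suc k')" for \<eta>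
  \<comment> \<open>A short gap spans about L / \<delta> steps, so its weight is at most (L + 2
    \<delta>) times the squared tail. This vanishes however fast the mesh shrinks compared with the
    level.\<close>
  have gt: "(\<lambda>n. real (Suc (nat \<lceil>L / \<delta> n\<rceil>)) * (\<delta> n * ?t n)) \<longlonglongrightarrow> 0" if L: "0 < L" for L
  proof (rule tendsto_sandwich[OF _ _ tendsto_const])
    have "(\<lambda>n. (L + 2 * \<delta> n) * ?t n) \<longlonglongrightarrow> (L + 2 * 0) * 0" by (intro tendsto_intros \<delta>0 t0)
    then show "(\<lambda>n. (L + 2 * \<delta> n) * ?t n) \<longlonglongrightarrow> 0" by simp
    have ev: "\<forall>\<^sub>F n in sequentially. 0 < \<delta> n"
      using \<delta> unfolding filterlim_at by (auto elim: eventually_mono)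
    show "\<forall>\<^sub>F n in sequentially. 0 \<le> real (Suc (nat \<lceil>L / \<delta> n\<rceil>)) * (\<delta> n * ?t n)"
      using ev by eventually_elim auto
    show "\<forall>\<^sub>F n in sequentially. real (Suc (nat \<lceil>L / \<delta> n\<rceil>)) * (\<delta> n * ?t n) \<le> (L + 2 * \<delta> n) * ?t n"
      using ev
    proof eventually_elim
      case (elim n)
      have "0 < L / \<delta> n" using L elim by simp
      then have "real (nat \<lceil>L / \<delta> n\<rceil>) \<le> L / \<delta> n + 1"
        using of_int_ceiling_le_add_one[of "L / \<delta> n"] by (simp add: of_nat_nat)
      then have "real (Suc (nat \<lceil>L / \<delta> n\<rceil>)) * \<delta> n \<le> (L / \<delta> n + 2) * \<delta> n"
        using elim by (intro mult_right_mono) auto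
      also have "\<dots> = L + 2 * \<delta> n" using elim by (simp add: field_simps)
      finally show ?case unfolding mult.assoc[symmetric] by (intro mult_right_mono) auto
    qed
  qed
  have dt: "(\<lambda>n. \<delta> n * ?t n) \<longlonglongrightarrow> 0" using tendsto_mult[OF \<delta>0 t0] by simp
  have Ulim: "(\<lambda>n. ((qOU_jump_rate + \<eta>) * \<delta> n * ?t n) ^ Suc k' * (1 + \<eta>) ^ k'
      * (real (m n) + real k' * (real (Suc (nat \<lceil>L / \<delta> n\<rceil>)) * C)) ^ Suc k' / fact (Suc k')) \<longlonglongrightarrow> U \<eta>"
    if L: "0 < L" for \<eta> L
  proof -
    have "(\<lambda>n. ((qOU_jump_rate + \<eta>) * (real (m n) * \<delta> n * ?t n
        + real k' * C * (real (Suc (nat \<lceil>L / \<delta> n\<rceil>)) * (\<delta> n * ?t n)))) ^ Suc k' * (1 + \<eta>) ^ k' / fact (Suc k'))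
      \<longlonglongrightarrow> ((qOU_jump_rate + \<eta>) * (A + real k' * C * 0)) ^ Suc k' * (1 + \<eta>) ^ k' / fact (Suc k')"
      by (intro tendsto_intros lim gt[OF L]) auto
    moreover have "((qOU_jump_rate + \<eta>) * (A + real k' * C * 0)) ^ Suc k' * (1 + \<eta>) ^ k' / fact (Suc k') = U \<eta>"
      by (simp add: U_def)
    moreover have "((qOU_jump_rate + \<eta>) * (real (m n) * \<delta> n * ?t n
        + real k' * C * (real (Suc (nat \<lceil>L / \<delta> n\<rceil>)) * (\<delta> n * ?t n)))) ^ Suc k' * (1 + \<eta>) ^ k' / fact (Suc k')
      = ((qOU_jump_rate + \<eta>) * \<delta> n * ?t n) ^ Suc k' * (1 + \<eta>) ^ k'
        * (real (m n) + real k' * (real (Suc (nat \<lceil>L / \<delta> n\<rceil>)) * C)) ^ Suc k' / fact (Suc k')" for n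
    proof -
      have "(qOU_jump_rate + \<eta>) * (real (m n) * \<delta> n * ?t n
          + real k' * C * (real (Suc (nat \<lceil>L / \<delta> n\<rceil>)) * (\<delta> n * ?t n)))
        = ((qOU_jump_rate + \<eta>) * \<delta> n * ?t n) * (real (m n) + real k' * (real (Suc (nat \<lceil>L / \<delta> n\<rceil>)) * C))"
        by (simp add: algebra_simps)
      then show ?thesis by (simp only: power_mult_distrib mult_ac)
    qed
    ultimately show ?thesis by (simp only:)
  qed
  have Vlim: "(\<lambda>n. ((qOU_jump_rate - \<eta>) * \<delta> n * ?t n) ^ Suc k' * (1 - \<eta>) ^ k'
      * (max 0 (real (m n) - 1 - real k' * real (Suc (Suc (nat \<lceil>L / \<delta> n\<rceil>))))) ^ Suc k' / fact (Suc k')) \<longlonglongrightarrow> V \<eta>"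
    if L: "0 < L" and \<eta>: "\<eta> < qOU_jump_rate" for \<eta> L
  proof -
    let ?G = "\<lambda>n. real (Suc (nat \<lceil>L / \<delta> n\<rceil>)) * (\<delta> n * ?t n)"
    let ?s = "\<lambda>n. (qOU_jump_rate - \<eta>) * (real (m n) * \<delta> n * ?t n - \<delta> n * ?t n - real k' * (?G n + \<delta> n * ?t n))"
    have A0: "0 \<le> A"
    proof (rule tendsto_lowerbound[OF lim])
      have "\<forall>\<^sub>F n in sequentially. 0 < \<delta> n"
        using \<delta> unfolding filterlim_at by (auto elim: eventually_mono)
      then show "\<forall>\<^sub>F n in sequentially. 0 \<le> real (m n) * \<delta> n * ?t n" by eventually_elim simp
    qed simp
    have "(\<lambda>n. (max 0 (?s n)) ^ Suc k' * (1 - \<eta>) ^ k' / fact (Suc k'))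
      \<longlonglongrightarrow> (max 0 ((qOU_jump_rate - \<eta>) * (A - 0 - real k' * (0 + 0)))) ^ Suc k' * (1 - \<eta>) ^ k' / fact (Suc k')"
      by (intro tendsto_intros lim gt[OF L] dt) auto
    then have "(\<lambda>n. (max 0 (?s n)) ^ Suc k' * (1 - \<eta>) ^ k' / fact (Suc k')) \<longlonglongrightarrow> V \<eta>"
      using A0 \<eta> by (simp add: V_def max_def)
    moreover have "\<forall>\<^sub>F n in sequentially. (max 0 (?s n)) ^ Suc k' * (1 - \<eta>) ^ k' / fact (Suc k')
      = ((qOU_jump_rate - \<eta>) * \<delta> n * ?t n) ^ Suc k' * (1 - \<eta>) ^ k'
      * (max 0 (real (m n) - 1 - real k' * real (Suc (Suc (nat \<lceil>L / \<delta> n\<rceil>))))) ^ Suc k' / fact (Suc k')"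
    proof -
      have "\<forall>\<^sub>F n in sequentially. 0 < \<delta> n"
        using \<delta> unfolding filterlim_at by (auto elim: eventually_mono)
      then show ?thesis
      proof eventually_elim
        case (elim n)
        let ?p = "(qOU_jump_rate - \<eta>) * \<delta> n * ?t n"
        have p: "0 \<le> ?p" using \<eta> elim by simp
        have "?s n = ?p * (real (m n) - 1 - real k' * real (Suc (Suc (nat \<lceil>L / \<delta> n\<rceil>))))"
          by (simp add: algebra_simps)
        moreover have "max 0 (?p * R) = ?p * max 0 R" for R
          using p by (simp add: max_mult_distrib_left)
        ultimately have "max 0 (?s n) = ?p * max 0 (real (m n) - 1 - real k' * real (Suc (Suc (nat \<lceil>L / \<delta> n\<rceil>))))"
          by (simp only:)
        then show ?case by (simp only: power_mult_distrib mult_ac)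
      qed
    qed
    ultimately show ?thesis by (rule Lim_transform_eventually)
  qed
  have UV: "(U \<longlongrightarrow> (qOU_jump_rate * A) ^ Suc k' / fact (Suc k')) (at_right 0)"
    "(V \<longlongrightarrow> (qOU_jump_rate * A) ^ Suc k' / fact (Suc k')) (at_right 0)"
  proof -
    have "(U \<longlongrightarrow> ((qOU_jump_rate + 0) * A) ^ Suc k' * (1 + 0) ^ k' / fact (Suc k')) (at_right 0)"
      unfolding U_def by (intro tendsto_intros) auto
    then show "(U \<longlongrightarrow> (qOU_jump_rate * A) ^ Suc k' / fact (Suc k')) (at_right 0)" by simp
    have "(V \<longlongrightarrow> ((qOU_jump_rate - 0) * A) ^ Suc k' * (1 - 0) ^ k' / fact (Suc k')) (at_right 0)"
      unfolding V_def by (intro tendsto_intros) auto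
    then show "(V \<longlongrightarrow> (qOU_jump_rate * A) ^ Suc k' / fact (Suc k')) (at_right 0)" by simp
  qed
  have small: "\<forall>\<^sub>F \<eta> in at_right 0. \<eta> \<in> {0<..<min 1 qOU_jump_rate}"
    using jump_rate_pos by (intro eventually_at_right_real) auto
  have "?E \<longlonglongrightarrow> (qOU_jump_rate * A) ^ Suc k' / fact (Suc k')"
  proof (rule order_tendstoI)
    fix u assume "(qOU_jump_rate * A) ^ Suc k' / fact (Suc k') < u"
    from eventually_conj[OF small order_tendstoD(2)[OF UV(1) this]]
    obtain \<eta> where \<eta>: "0 < \<eta>" "\<eta> < 1" "\<eta> < qOU_jump_rate" "U \<eta> < u"
      using eventually_happens'[of "at_right (0::real)"] by force
    obtain L where L: "0 < L" "\<forall>\<delta>\<ge>L. \<forall>x\<in>{- c..- c + d2}. \<forall>y\<in>{c - d2..c}. \<bar>qOU_ratio q \<delta> x y - 1\<bar> \<le> \<eta>"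
      using mixing[OF \<eta>(1)] by blast
    from main[OF \<eta>(1-3) L refl refl refl] order_tendstoD(2)[OF Ulim[OF L(1), of \<eta>] \<eta>(4)]
    show "\<forall>\<^sub>F n in sequentially. ?E n < u" by eventually_elim linarith
  next
    fix l assume "l < (qOU_jump_rate * A) ^ Suc k' / fact (Suc k')"
    from eventually_conj[OF small order_tendstoD(1)[OF UV(2) this]]
    obtain \<eta> where \<eta>: "0 < \<eta>" "\<eta> < 1" "\<eta> < qOU_jump_rate" "l < V \<eta>"
      using eventually_happens'[of "at_right (0::real)"] by force
    obtain L where L: "0 < L" "\<forall>\<delta>\<ge>L. \<forall>x\<in>{- c..- c + d2}. \<forall>y\<in>{c - d2..c}. \<bar>qOU_ratio q \<delta> x y - 1\<bar> \<le> \<eta>"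
      using mixing[OF \<eta>(1)] by blast
    from main[OF \<eta>(1-3) L refl refl refl] order_tendstoD(1)[OF Vlim[OF L(1) \<eta>(3)] \<eta>(4)]
    show "\<forall>\<^sub>F n in sequentially. l < ?E n" by eventually_elim linarith
  qed
  then show ?thesis by (simp only: Suc)
qed

end

section \<open>Passage from the grid to the process\<close>

lemma (in prob_space) char_diff_le:
  assumes [measurable]: "U \<in> borel_measurable M" "V \<in> borel_measurable M"
  shows "norm (char (distr M borel U) t - char (distr M borel V) t) \<le> 2 * prob {\<omega> \<in> space M. U \<omega> \<noteq> V \<omega>}"
proof -
  have int: "integrable M (\<lambda>\<omega>. iexp (t * W \<omega>))" if [measurable]: "W \<in> borel_measurable M" for W :: "'a \<Rightarrow> real"
    by (rule integrable_const_bound[where B=1]) auto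
  have "char (distr M borel W) t = (CLINT \<omega>|M. iexp (t * W \<omega>))"
    if [measurable]: "W \<in> borel_measurable M" for W
    unfolding char_def by (subst integral_distr) auto
  then have "char (distr M borel U) t - char (distr M borel V) t
      = (CLINT \<omega>|M. iexp (t * U \<omega>) - iexp (t * V \<omega>))"
    by (simp only: assms Bochner_Integration.integral_diff[OF int int])
  also have "norm \<dots> \<le> (\<integral>\<omega>. norm (iexp (t * U \<omega>) - iexp (t * V \<omega>)) \<partial>M)"
    by (rule integral_norm_bound)
  also have "\<dots> \<le> (\<integral>\<omega>. 2 * indicator {\<omega> \<in> space M. U \<omega> \<noteq> V \<omega>} \<omega> \<partial>M)"
  proof (rule integral_mono)
    show "integrable M (\<lambda>\<omega>. norm (iexp (t * U \<omega>) - iexp (t * V \<omega>)))"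
      by (intro integrable_norm Bochner_Integration.integrable_diff int assms)
    show "integrable M (\<lambda>\<omega>. 2 * indicator {\<omega> \<in> space M. U \<omega> \<noteq> V \<omega>} \<omega> :: real)"
      by (intro integrable_mult_right integrable_real_indicator) (auto simp: less_top[symmetric])
    fix \<omega> assume "\<omega> \<in> space M"
    then show "norm (iexp (t * U \<omega>) - iexp (t * V \<omega>)) \<le> 2 * indicator {\<omega> \<in> space M. U \<omega> \<noteq> V \<omega>} \<omega>"
      using norm_triangle_ineq4[of "iexp (t * U \<omega>)" "iexp (t * V \<omega>)"] by (auto simp: indicator_def)
  qed
  also have "\<dots> = 2 * prob {\<omega> \<in> space M. U \<omega> \<noteq> V \<omega>}" by simp
  finally show ?thesis .
qed

lemma (in prob_space) prob_eventually_tendsto_0: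
  assumes meas: "\<And>m. {\<omega> \<in> space M. \<not> Q m \<omega>} \<in> events"
    and ev: "AE \<omega> in M. \<forall>\<^sub>F m in sequentially. Q m \<omega>"
  shows "(\<lambda>m. prob {\<omega> \<in> space M. \<not> Q m \<omega>}) \<longlonglongrightarrow> 0"
proof -
  let ?B = "\<lambda>m. {\<omega> \<in> space M. \<not> Q m \<omega>}"
  have "(\<lambda>m. \<integral>\<omega>. indicat_real (?B m) \<omega> \<partial>M) \<longlonglongrightarrow> (\<integral>\<omega>. 0 \<partial>M)"
  proof (rule integral_dominated_convergence[where w="\<lambda>_. 1"])
    show "AE \<omega> in M. (\<lambda>m. indicat_real (?B m) \<omega>) \<longlonglongrightarrow> 0"
      using ev
    proof eventually_elim
      case (elim \<omega>)
      then have "\<forall>\<^sub>F m in sequentially. indicat_real (?B m) \<omega> = 0" by eventually_elim simp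
      then show ?case by (rule tendsto_eventually)
    qed
  qed (use meas in \<open>auto simp: indicator_def\<close>)
  then show ?thesis using meas by simp
qed

text \<open>Finitely many strict inequalities hold with a common margin, so slightly stricter levels
  lose no jump.\<close>

lemma jump_times_slack:
  assumes f: "cadlag f" and ab: "a < b"
  obtains r where "0 < r" "\<And>\<eta>. 0 \<le> \<eta> \<Longrightarrow> \<eta> < r \<Longrightarrow> jump_times f (a - \<eta>) (b + \<eta>) T = jump_times f a b T"
proof -
  let ?J = "jump_times f a b T"
  define r where "r = Min (insert 1 ((\<lambda>t. min (a - Lim (at_left t) f) (f t - b)) ` ?J))"
  have fin: "finite ?J" by (rule finite_jump_times[OF f ab])
  show thesis
  proof (rule that[of r])
    show "0 < r" unfolding r_def using fin by (subst Min_gr_iff) (auto simp: jump_times_def)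
    fix \<eta> assume \<eta>: "0 \<le> \<eta>" "\<eta> < r"
    have "\<eta> < a - Lim (at_left t) f" "\<eta> < f t - b" if "t \<in> ?J" for t
    proof -
      have "r \<le> min (a - Lim (at_left t) f) (f t - b)" unfolding r_def using fin that by (intro Min_le) auto
      then show "\<eta> < a - Lim (at_left t) f" "\<eta> < f t - b" using \<eta> by auto
    qed
    then show "jump_times f (a - \<eta>) (b + \<eta>) T = ?J"
      using \<eta> by (fastforce simp: jump_times_def)
  qed
qed

lemma extreme_jump_count_eq:
  "extreme_jump_count q X 0 T \<epsilon> \<omega> = card (jump_times (\<lambda>t. X t \<omega>) (- qOU_edge q + \<epsilon>) (qOU_edge q - \<epsilon>) T)"
  by (simp add: extreme_jump_count_def jump_times_def qOU_edge_def)

context qOU_process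
begin

lemma steps_mono: "\<epsilon>' \<le> \<epsilon> \<Longrightarrow> steps \<epsilon>' \<delta> m \<omega> \<le> steps \<epsilon> \<delta> m \<omega>"
  unfolding steps_def by (intro step_count_mono) auto

context
  assumes cadlag_paths: "AE \<omega> in M. cadlag (\<lambda>t. X t \<omega>)"
begin

lemma extreme_jump_count_sandwich:
  assumes "0 < \<epsilon>'" "\<epsilon>' < \<epsilon>" "\<epsilon> < c" "0 < T"
  shows "AE \<omega> in M. \<forall>\<^sub>F m in sequentially. steps \<epsilon>' (T / real m) m \<omega> \<le> extreme_jump_count q X 0 T \<epsilon> \<omega>
    \<and> extreme_jump_count q X 0 T \<epsilon> \<omega> \<le> steps \<epsilon> (T / real m) m \<omega>"
  using cadlag_paths
proof eventually_elim
  case (elim \<omega>)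
  show ?case unfolding steps_def extreme_jump_count_eq
    by (intro eventually_conj step_count_le_card_jump_times card_jump_times_le_step_count elim) (use assms in auto)
qed

text \<open>Expresses the count through countably many grid counts, for measurability. At a slightly
  smaller level no jump is lost, which gives one direction; at any smaller level the fine grid count
  does not exceed the true count at \<epsilon>, which gives the other. \<open>Suc (Suc j)\<close>
  keeps the smaller level positive for j = 0.\<close>

lemma extreme_jump_count_ge_iff:
  assumes \<epsilon>: "0 < \<epsilon>" "\<epsilon> < c" and T: "0 < T" and cad: "cadlag (\<lambda>t. X t \<omega>)"
  shows "r \<le> extreme_jump_count q X 0 T \<epsilon> \<omega> \<longleftrightarrow>
    (\<exists>j. \<forall>\<^sub>F m in sequentially. r \<le> steps (\<epsilon> - \<epsilon> / real (Suc (Suc j))) (T / real m) m \<omega>)"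
    (is "_ \<longleftrightarrow> (\<exists>j. ?P j)")
proof
  let ?f = "\<lambda>t. X t \<omega>"
  have j: "0 < \<epsilon> / real (Suc (Suc j))" "\<epsilon> / real (Suc (Suc j)) < \<epsilon>" for j
    using \<epsilon> by (auto simp: pos_divide_less_eq)
  {
    assume r: "r \<le> extreme_jump_count q X 0 T \<epsilon> \<omega>"
    have ab: "- c + \<epsilon> < c - \<epsilon>" using \<epsilon> by simp
    obtain s where s: "0 < s" "\<And>\<eta>. 0 \<le> \<eta> \<Longrightarrow> \<eta> < s \<Longrightarrow>
        jump_times ?f (- c + \<epsilon> - \<eta>) (c - \<epsilon> + \<eta>) T = jump_times ?f (- c + \<epsilon>) (c - \<epsilon>) T"
      using jump_times_slack[OF cad ab] by blast
    obtain j :: nat where "\<epsilon> / s < real j" using reals_Archimedean2 by blast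
    then have "\<epsilon> / s < real (Suc (Suc j))" by simp
    then have js: "\<epsilon> / real (Suc (Suc j)) < s" using s(1) by (simp add: field_simps)
    let ?e = "\<epsilon> - \<epsilon> / real (Suc (Suc j))"
    have "\<forall>\<^sub>F m in sequentially. card (jump_times ?f (- c + ?e) (c - ?e) T) \<le> steps ?e (T / real m) m \<omega>"
      unfolding steps_def
      by (rule card_jump_times_le_step_count[OF cad _ T]) (use j(1)[of j] \<epsilon> in linarith)
    moreover have "card (jump_times ?f (- c + ?e) (c - ?e) T) = extreme_jump_count q X 0 T \<epsilon> \<omega>"
      using s(2)[OF less_imp_le[OF j(1)] js] by (simp add: extreme_jump_count_eq algebra_simps)
    ultimately show "\<exists>j. ?P j" using r by (intro exI[of _ j]) (auto elim: eventually_mono)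
  }
  assume "\<exists>j. ?P j"
  then obtain j where j': "?P j" by blast
  let ?e = "\<epsilon> - \<epsilon> / real (Suc (Suc j))"
  have "\<forall>\<^sub>F m in sequentially. steps ?e (T / real m) m \<omega> \<le> extreme_jump_count q X 0 T \<epsilon> \<omega>"
    unfolding steps_def extreme_jump_count_eq
    by (rule step_count_le_card_jump_times[OF cad _ _ _ T]) (use j(1)[of j] \<epsilon> in linarith)+
  from eventually_conj[OF j' this] show "r \<le> extreme_jump_count q X 0 T \<epsilon> \<omega>"
    by (auto dest!: eventually_happens' [OF sequentially_bot])
qed

text \<open>The description by grid counts is valid on cadlag paths only; in the completion, almost
  sure agreement with a measurable set suffices.\<close>

lemma extreme_jump_count_measurable:
  assumes "0 < \<epsilon>" "\<epsilon> < c" "0 < T"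
  shows "(\<lambda>\<omega>. real (extreme_jump_count q X 0 T \<epsilon> \<omega>)) \<in> borel_measurable (completion M)"
  unfolding borel_measurable_iff_ge
proof
  fix a :: real
  define r where "r = nat \<lceil>a\<rceil>"
  let ?Q = "\<lambda>\<omega>. \<exists>j. \<exists>m0. \<forall>m\<ge>m0. r \<le> steps (\<epsilon> - \<epsilon> / real (Suc (Suc j))) (T / real m) m \<omega>"
  have [measurable]: "steps e (T / real m) m \<in> measurable M (count_space UNIV)" for e m
    using assms by (intro steps_measurable) auto
  have Q: "{\<omega> \<in> space M. ?Q \<omega>} \<in> sets M" by measurable
  have iff: "a \<le> real n \<longleftrightarrow> r \<le> n" for n :: nat unfolding r_def by linarith
  have "AE \<omega> in completion M. cadlag (\<lambda>t. X t \<omega>)" using cadlag_paths by (rule AE_completion)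
  then have "AE \<omega> in completion M. \<omega> \<in> {\<omega> \<in> space M. ?Q \<omega>}
      \<longleftrightarrow> \<omega> \<in> {\<omega> \<in> space (completion M). a \<le> real (extreme_jump_count q X 0 T \<epsilon> \<omega>)}"
  proof eventually_elim
    case (elim \<omega>)
    show ?case
      unfolding iff using extreme_jump_count_ge_iff[OF assms elim, of r]
      by (auto simp: eventually_sequentially)
  qed
  then show "{\<omega> \<in> space (completion M). a \<le> real (extreme_jump_count q X 0 T \<epsilon> \<omega>)} \<in> sets (completion M)"
    by (rule completion.in_sets_AE) (use Q in auto)
qed

text \<open>Where the sandwich holds and the grid counts at \<epsilon>' and \<epsilon> agree, the
  true count equals both. Being integers and monotone in the level, the grid counts differ with
  probability at most the difference of their means. The means are written with
  \<open>choose 1\<close> so that the limit theorem for binomial moments applies.\<close>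

lemma mesh_exists:
  assumes "0 < \<epsilon>'" "\<epsilon>' < \<epsilon>" "\<epsilon> < c" "0 < T" "0 < \<theta>"
  obtains m where "0 < m" "T / real m < \<theta>"
    "measure (completion M) {\<omega> \<in> space M. real (extreme_jump_count q X 0 T \<epsilon> \<omega>) \<noteq> real (steps \<epsilon> (T / real m) m \<omega>)}
      \<le> \<theta> + (expectation (\<lambda>\<omega>. real (steps \<epsilon> (T / real m) m \<omega> choose 1))
           - expectation (\<lambda>\<omega>. real (steps \<epsilon>' (T / real m) m \<omega> choose 1)))"
proof -
  interpret compl: prob_space "completion M"
    by (rule prob_spaceI) (simp add: emeasure_space_1)
  let ?N = "\<lambda>\<omega>. extreme_jump_count q X 0 T \<epsilon> \<omega>"
  let ?D = "\<lambda>e m. steps e (T / real m) m"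
  let ?Q = "\<lambda>m \<omega>. ?D \<epsilon>' m \<omega> \<le> ?N \<omega> \<and> ?N \<omega> \<le> ?D \<epsilon> m \<omega>"
  have DM [measurable]: "?D e m \<in> measurable M (count_space UNIV)" for e m
    using assms by (intro steps_measurable) auto
  have DR [measurable]: "(\<lambda>\<omega>. real (?D e m \<omega>)) \<in> borel_measurable M" for e m
    by (rule measurable_compose[OF DM]) simp
  have DC [measurable]: "(\<lambda>\<omega>. real (?D e m \<omega>)) \<in> borel_measurable (completion M)" for e m
    by (rule measurable_completion[OF DR])
  have NC [measurable]: "(\<lambda>\<omega>. real (?N \<omega>)) \<in> borel_measurable (completion M)"
    by (rule extreme_jump_count_measurable) (use assms in auto)
  have Qeq: "?Q m \<omega> \<longleftrightarrow> real (?D \<epsilon>' m \<omega>) \<le> real (?N \<omega>) \<and> real (?N \<omega>) \<le> real (?D \<epsilon> m \<omega>)" for m \<omega> by simp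
  have Qm: "{\<omega> \<in> space (completion M). \<not> ?Q m \<omega>} \<in> sets (completion M)" for m
    unfolding Qeq by measurable
  have "(\<lambda>m. compl.prob {\<omega> \<in> space (completion M). \<not> ?Q m \<omega>}) \<longlonglongrightarrow> 0"
    by (rule compl.prob_eventually_tendsto_0[OF Qm AE_completion[OF extreme_jump_count_sandwich]]) (use assms in auto)
  then have "\<forall>\<^sub>F m in sequentially. compl.prob {\<omega> \<in> space (completion M). \<not> ?Q m \<omega>} < \<theta>"
    using assms(5) by (rule order_tendstoD)
  moreover have "\<forall>\<^sub>F m in sequentially. T / real m < \<theta>"
    using lim_const_over_n[of T] assms(5) by (rule order_tendstoD)
  ultimately have "\<forall>\<^sub>F m in sequentially. compl.prob {\<omega> \<in> space (completion M). \<not> ?Q m \<omega>} < \<theta> \<and> T / real m < \<theta> \<and> 0 < m"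
    using eventually_gt_at_top[of 0] by eventually_elim auto
  then obtain m where m: "compl.prob {\<omega> \<in> space (completion M). \<not> ?Q m \<omega>} < \<theta>" "T / real m < \<theta>" "0 < m"
    by (auto dest!: eventually_happens' [OF sequentially_bot])
  have mono: "?D \<epsilon>' m \<omega> \<le> ?D \<epsilon> m \<omega>" for \<omega> using assms by (intro steps_mono) auto
  have int: "integrable M (\<lambda>\<omega>. real (?D e m \<omega>))" for e
    by (rule bounded_integrable[where K="real m"]) (auto intro: steps_le)
  let ?A = "{\<omega> \<in> space M. real (?D \<epsilon>' m \<omega>) \<noteq> real (?D \<epsilon> m \<omega>)}"
  have A: "?A \<in> sets M" by measurable
  have "prob ?A = expectation (indicat_real ?A)" using A by simp
  also have "\<dots> \<le> expectation (\<lambda>\<omega>. real (?D \<epsilon> m \<omega>) - real (?D \<epsilon>' m \<omega>))"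
  proof (rule integral_mono)
    show "integrable M (indicat_real ?A)" using A by (simp add: less_top[symmetric])
    fix \<omega>
    show "indicat_real ?A \<omega> \<le> real (?D \<epsilon> m \<omega>) - real (?D \<epsilon>' m \<omega>)"
      using mono[of \<omega>] by (auto simp: indicator_def)
  qed (intro Bochner_Integration.integrable_diff int)
  also have "\<dots> = expectation (\<lambda>\<omega>. real (?D \<epsilon> m \<omega>)) - expectation (\<lambda>\<omega>. real (?D \<epsilon>' m \<omega>))"
    by (intro Bochner_Integration.integral_diff int)
  finally have PA: "prob ?A \<le> expectation (\<lambda>\<omega>. real (?D \<epsilon> m \<omega> choose 1)) - expectation (\<lambda>\<omega>. real (?D \<epsilon>' m \<omega> choose 1))"
    by simp
  have "compl.prob {\<omega> \<in> space M. real (?N \<omega>) \<noteq> real (?D \<epsilon> m \<omega>)}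
      \<le> compl.prob ({\<omega> \<in> space (completion M). \<not> ?Q m \<omega>} \<union> ?A)"
    using A Qm[of m] by (intro compl.finite_measure_mono) auto
  also have "\<dots> \<le> compl.prob {\<omega> \<in> space (completion M). \<not> ?Q m \<omega>} + compl.prob ?A"
    using A Qm[of m] by (intro measure_Un_le) auto
  also have "compl.prob ?A = prob ?A" using A by simp
  finally have "compl.prob {\<omega> \<in> space M. real (?N \<omega>) \<noteq> real (?D \<epsilon> m \<omega>)}
      \<le> \<theta> + (expectation (\<lambda>\<omega>. real (?D \<epsilon> m \<omega> choose 1)) - expectation (\<lambda>\<omega>. real (?D \<epsilon>' m \<omega> choose 1)))"
    using m(1) PA by linarith
  with m show thesis using that by blast
qed

lemma extreme_jump_count_weak_conv:
  fixes e :: "nat \<Rightarrow> real"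
  assumes e: "filterlim e (at_right 0) sequentially" and e0: "\<And>n. 0 < e n" "\<And>n. e n < c"
  shows "weak_conv_m
    (\<lambda>n. distr (completion M) borel (\<lambda>\<omega>. real (extreme_jump_count q X 0 (e n powi (-3)) (e n) \<omega>)))
    (distr (measure_pmf (poisson_pmf (qOU_rate q))) borel real)"
proof -
  interpret compl: prob_space "completion M"
    by (rule prob_spaceI) (simp add: emeasure_space_1)
  let ?T = "\<lambda>n. e n powi (-3)"
  let ?N = "\<lambda>n \<omega>. extreme_jump_count q X 0 (?T n) (e n) \<omega>"
  \<comment> \<open>A strictly smaller level with asymptotically the same corner mass: the grid counts at the
    two levels, which enclose the true count, then agree with high probability.\<close>
  define e' where "e' n = e n * (1 - 1 / real (n + 2))" for n
  \<comment> \<open>One null sequence bounds both the mesh and the probability that the sandwich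
    fails.\<close>
  define \<theta> where "\<theta> n = 1 / real (Suc n)" for n
  have T: "0 < ?T n" for n using e0(1)[of n] by (simp add: power_int_def)
  have e': "0 < e' n" "e' n < e n" for n
  proof -
    have "0 < 1 - 1 / real (n + 2)" "1 - 1 / real (n + 2) < 1" by simp_all
    then show "0 < e' n" "e' n < e n"
      using e0(1)[of n] mult_strict_left_mono[of "1 - 1 / real (n + 2)" 1 "e n"] by (simp_all add: e'_def del: of_nat_add)
  qed
  have \<theta>: "0 < \<theta> n" for n by (simp add: \<theta>_def)
  have \<theta>0: "\<theta> \<longlonglongrightarrow> 0" unfolding \<theta>_def[abs_def] by (rule LIMSEQ_Suc[OF lim_1_over_n])
  define mesh where "mesh n m \<longleftrightarrow> 0 < m \<and> ?T n / real m < \<theta> n \<and>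
      measure (completion M) {\<omega> \<in> space M. real (?N n \<omega>) \<noteq> real (steps (e n) (?T n / real m) m \<omega>)}
      \<le> \<theta> n + (expectation (\<lambda>\<omega>. real (steps (e n) (?T n / real m) m \<omega> choose 1))
           - expectation (\<lambda>\<omega>. real (steps (e' n) (?T n / real m) m \<omega> choose 1)))" for n m
  have "\<exists>m. mesh n m" for n
    by (rule mesh_exists[OF e'(1)[of n] e'(2)[of n] e0(2)[of n] T[of n] \<theta>[of n]]) (unfold mesh_def, blast)
  then obtain m where mesh: "\<And>n. mesh n (m n)" by metis
  note m = mesh[unfolded mesh_def, THEN conjunct1] mesh[unfolded mesh_def, THEN conjunct2, THEN conjunct1]
    mesh[unfolded mesh_def, THEN conjunct2, THEN conjunct2]
  define \<delta> where "\<delta> n = ?T n / real (m n)" for n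
  have \<delta>p: "0 < \<delta> n" for n using T m(1) by (simp add: \<delta>_def)
  have \<delta>0: "\<delta> \<longlonglongrightarrow> 0"
    by (rule tendsto_sandwich[OF _ _ tendsto_const \<theta>0]) (use \<delta>p m(2) in \<open>auto simp: \<delta>_def less_imp_le\<close>)
  have \<delta>: "filterlim \<delta> (at_right 0) sequentially"
    using \<delta>0 \<delta>p by (intro tendsto_imp_filterlim_at_right) auto
  have en: "e \<longlonglongrightarrow> 0" using e by (rule filterlim_mono) (auto simp: at_within_le_nhds)
  have q1: "(\<lambda>n. 1 - 1 / real (n + 2)) \<longlonglongrightarrow> 1 - 0"
    using LIMSEQ_ignore_initial_segment[OF lim_1_over_n, of 2] by (intro tendsto_intros)
  have e'0: "e' \<longlonglongrightarrow> 0" using tendsto_mult[OF en q1] by (simp add: e'_def[abs_def])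
  have e'f: "filterlim e' (at_right 0) sequentially" using e'0 e' by (intro tendsto_imp_filterlim_at_right) auto
  have tail_lim: "(\<lambda>n. qOU_tail q (f n) / f n powr (3 / 2)) \<longlonglongrightarrow> tail_constant"
    if "filterlim f (at_right 0) sequentially" for f
    using filterlim_compose[OF tail_asymp that] .
  have tail0: "(\<lambda>n. qOU_tail q (f n)) \<longlonglongrightarrow> 0"
    if f: "filterlim f (at_right 0) sequentially" "\<And>n. 0 < f n" for f
  proof -
    have "f \<longlonglongrightarrow> 0" using f(1) by (rule filterlim_mono) (auto simp: at_within_le_nhds)
    then have "(\<lambda>n. f n powr (3 / 2)) \<longlonglongrightarrow> 0 powr (3 / 2)"
      using f(2) by (intro tendsto_powr') (auto intro: less_imp_le always_eventually)
    from tendsto_mult[OF tail_lim[OF f(1)] this] f(2) show ?thesis by (simp add: less_imp_neq[symmetric])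
  qed
  \<comment> \<open>m \<delta> is the horizon, e^(-3), and the two corner masses contribute f^3. For
    f = e the quotient is 1, and for f = e' it tends to 1, so both levels have the same limiting
    moments.\<close>
  have mass: "real (m n) * \<delta> n * (qOU_tail q (f n))\<^sup>2 = (qOU_tail q (f n) / f n powr (3 / 2))\<^sup>2 * (f n / e n) ^ 3"
    if "0 < f n" for f :: "nat \<Rightarrow> real" and n
  proof -
    have "(f n powr (3 / 2))\<^sup>2 = f n powr 3" by (simp add: power2_eq_square powr_add[symmetric])
    also have "\<dots> = f n ^ 3" using that powr_realpow[of "f n" 3] by simp
    finally have "(f n powr (3 / 2))\<^sup>2 = f n ^ 3" .
    moreover have "real (m n) * \<delta> n = inverse (e n ^ 3)" using m(1)[of n] by (simp add: \<delta>_def power_int_def power_inverse)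
    ultimately show ?thesis using that e0(1)[of n] by (simp add: power_divide field_simps)
  qed
  have A: "(\<lambda>n. real (m n) * \<delta> n * (qOU_tail q (e n))\<^sup>2) \<longlonglongrightarrow> tail_constant\<^sup>2"
  proof -
    have "(\<lambda>n. (qOU_tail q (e n) / e n powr (3 / 2))\<^sup>2 * (e n / e n) ^ 3) \<longlonglongrightarrow> tail_constant\<^sup>2 * 1 ^ 3"
      using e0(1) by (intro tendsto_intros tail_lim e) (simp add: less_imp_neq[symmetric])
    then show ?thesis using e0(1) by (simp add: mass)
  qed
  have A': "(\<lambda>n. real (m n) * \<delta> n * (qOU_tail q (e' n))\<^sup>2) \<longlonglongrightarrow> tail_constant\<^sup>2"
  proof -
    have quot: "e' n / e n = 1 - 1 / real (n + 2)" for n using e0(1)[of n] by (simp add: e'_def)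
    have "(\<lambda>n. (qOU_tail q (e' n) / e' n powr (3 / 2))\<^sup>2 * (e' n / e n) ^ 3) \<longlonglongrightarrow> tail_constant\<^sup>2 * (1 - 0) ^ 3"
      unfolding quot by (intro tendsto_intros tail_lim e'f q1)
    then show ?thesis using e'(1) by (simp add: mass)
  qed
  have moments: "(\<lambda>n. expectation (\<lambda>\<omega>. real (steps (e n) (\<delta> n) (m n) \<omega> choose k))) \<longlonglongrightarrow> qOU_rate q ^ k / fact k" for k
    unfolding rate_eq by (rule binomial_moments_tendsto[OF e \<delta> A tail0[OF e e0(1)]])
  have moments': "(\<lambda>n. expectation (\<lambda>\<omega>. real (steps (e' n) (\<delta> n) (m n) \<omega> choose k))) \<longlonglongrightarrow> qOU_rate q ^ k / fact k" for k
    unfolding rate_eq by (rule binomial_moments_tendsto[OF e'f \<delta> A' tail0[OF e'f e'(1)]])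
  obtain K where K: "\<forall>\<^sub>F n in sequentially. \<forall>k.
      expectation (\<lambda>\<omega>. real (steps (e n) (\<delta> n) (m n) \<omega> choose k)) \<le> K ^ k / fact k"
    by (rule binomial_moments_dominated[OF e \<delta> A])
  let ?P = "distr (measure_pmf (poisson_pmf (qOU_rate q))) borel real"
  let ?\<mu> = "\<lambda>n. distr (completion M) borel (\<lambda>\<omega>. real (?N n \<omega>))"
  have DM: "steps (e n) (\<delta> n) (m n) \<in> measurable M (count_space UNIV)" for n
    using \<delta>p by (intro steps_measurable less_imp_le)
  have DR: "(\<lambda>\<omega>. real (steps (e n) (\<delta> n) (m n) \<omega>)) \<in> borel_measurable M" for n
    using DM by measurable
  have NC: "(\<lambda>\<omega>. real (?N n \<omega>)) \<in> borel_measurable (completion M)" for n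
    by (intro extreme_jump_count_measurable e0 T)
  have charD: "(\<lambda>n. char (distr M borel (\<lambda>\<omega>. real (steps (e n) (\<delta> n) (m n) \<omega>))) t) \<longlonglongrightarrow> char ?P t" for t
    by (rule char_tendsto_poisson[OF DM steps_le K moments rate_pos])
  have bad: "(\<lambda>n. measure (completion M) {\<omega> \<in> space M. real (?N n \<omega>) \<noteq> real (steps (e n) (\<delta> n) (m n) \<omega>)}) \<longlonglongrightarrow> 0"
  proof (rule tendsto_sandwich[OF _ _ tendsto_const])
    have "(\<lambda>n. \<theta> n + (expectation (\<lambda>\<omega>. real (steps (e n) (\<delta> n) (m n) \<omega> choose 1))
        - expectation (\<lambda>\<omega>. real (steps (e' n) (\<delta> n) (m n) \<omega> choose 1))))
      \<longlonglongrightarrow> 0 + (qOU_rate q ^ 1 / fact 1 - qOU_rate q ^ 1 / fact 1)"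
      by (intro tendsto_intros \<theta>0 moments moments')
    then show "(\<lambda>n. \<theta> n + (expectation (\<lambda>\<omega>. real (steps (e n) (\<delta> n) (m n) \<omega> choose 1))
        - expectation (\<lambda>\<omega>. real (steps (e' n) (\<delta> n) (m n) \<omega> choose 1)))) \<longlonglongrightarrow> 0" by simp
  qed (use m(3) in \<open>auto simp: \<delta>_def\<close>)
  have charN: "(\<lambda>n. char (?\<mu> n) t) \<longlonglongrightarrow> char ?P t" for t
  proof -
    have "(\<lambda>n. char (?\<mu> n) t - char (distr M borel (\<lambda>\<omega>. real (steps (e n) (\<delta> n) (m n) \<omega>))) t) \<longlonglongrightarrow> 0"
    proof (rule Lim_null_comparison)
      show "\<forall>\<^sub>F n in sequentially. norm (char (?\<mu> n) t - char (distr M borel (\<lambda>\<omega>. real (steps (e n) (\<delta> n) (m n) \<omega>))) t)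
          \<le> 2 * measure (completion M) {\<omega> \<in> space M. real (?N n \<omega>) \<noteq> real (steps (e n) (\<delta> n) (m n) \<omega>)}"
        using compl.char_diff_le[OF NC measurable_completion[OF DR]] by (simp add: distr_completion[OF DR])
      show "(\<lambda>n. 2 * measure (completion M) {\<omega> \<in> space M. real (?N n \<omega>) \<noteq> real (steps (e n) (\<delta> n) (m n) \<omega>)}) \<longlonglongrightarrow> 0"
        using tendsto_mult_left[OF bad, of 2] by simp
    qed
    from tendsto_add[OF this charD[of t]] show ?thesis by simp
  qed
  show ?thesis
  proof (rule levy_continuity[OF _ _ charN])
    show "real_distribution (?\<mu> n)" for n
      by (intro compl.real_distribution_distr NC)
    show "real_distribution ?P"
      by (intro prob_space.real_distribution_distr measure_pmf.prob_space_axioms) simp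
  qed
qed

end
end

text \<open>\<open>distr\<close> describes a law only for a measurable function, hence the first
  conjunct. Weak convergence is defined for sequences, hence the quantification over all sequences
  tending to 0 from the right.\<close>

theorem theorem1p1:
  fixes q :: real and M :: "'a measure" and X :: "real \<Rightarrow> 'a \<Rightarrow> real"
  assumes "q \<in> {-1<..<1}"
    and "q_ornstein_uhlenbeck M q X"
    and "AE \<omega> in M. cadlag (\<lambda>t. X t \<omega>)"
  shows "(\<forall>\<^sub>F \<epsilon> in at_right 0.
            (\<lambda>\<omega>. real (extreme_jump_count q X 0 (\<epsilon> powi (-3)) \<epsilon> \<omega>))
              \<in> borel_measurable (completion M)) \<and>
         (\<forall>\<epsilon> :: nat \<Rightarrow> real. filterlim \<epsilon> (at_right 0) sequentially \<longrightarrow>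
            weak_conv_m
              (\<lambda>n. distr (completion M) borel
                 (\<lambda>\<omega>. real (extreme_jump_count q X 0 (\<epsilon> n powi (-3)) (\<epsilon> n) \<omega>)))
              (distr (measure_pmf (poisson_pmf (qOU_rate q))) borel real))"
proof -
  interpret qOU_process M q X
    using assms(1,2) by (simp add: qOU_process_def qOU_parameter_def)
  let ?c = "qOU_edge q"
  have small: "\<forall>\<^sub>F \<epsilon> in at_right 0. \<epsilon> \<in> {0<..<?c}"
    using edge_pos by (rule eventually_at_right_real)
  show ?thesis
  proof (intro conjI allI impI)
    show "\<forall>\<^sub>F \<epsilon> in at_right 0. (\<lambda>\<omega>. real (extreme_jump_count q X 0 (\<epsilon> powi (-3)) \<epsilon> \<omega>))
        \<in> borel_measurable (completion M)"
      using small
    proof eventually_elim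
      case (elim \<epsilon>)
      then show ?case
        by (intro extreme_jump_count_measurable[OF assms(3)]) (auto simp: power_int_def)
    qed
    fix \<epsilon> :: "nat \<Rightarrow> real" assume \<epsilon>: "filterlim \<epsilon> (at_right 0) sequentially"
    \<comment> \<open>The level lies in \<open>{0<..<?c}\<close> only eventually; the finitely many
      exceptions are replaced by the admissible value \<open>?c / 2\<close>, which leaves the limit
      unchanged.\<close>
    define e where "e n = (if \<epsilon> n \<in> {0<..<?c} then \<epsilon> n else ?c / 2)" for n
    let ?\<mu> = "\<lambda>x. distr (completion M) borel (\<lambda>\<omega>. real (extreme_jump_count q X 0 (x powi (-3)) x \<omega>))"
    have ev: "\<forall>\<^sub>F n in sequentially. e n = \<epsilon> n"
      using filterlim_iff[THEN iffD1, OF \<epsilon>, rule_format, OF small] by eventually_elim (simp add: e_def)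
    then have "filterlim e (at_right 0) sequentially"
      using \<epsilon> by (subst filterlim_cong[OF refl refl ev])
    then have conv: "weak_conv_m (\<lambda>n. ?\<mu> (e n)) (distr (measure_pmf (poisson_pmf (qOU_rate q))) borel real)"
      by (rule extreme_jump_count_weak_conv[OF assms(3)]) (use edge_pos in \<open>auto simp: e_def\<close>)
    show "weak_conv_m (\<lambda>n. ?\<mu> (\<epsilon> n)) (distr (measure_pmf (poisson_pmf (qOU_rate q))) borel real)"
      unfolding weak_conv_m_def weak_conv_def
    proof (intro allI impI)
      fix x assume "isCont (cdf (distr (measure_pmf (poisson_pmf (qOU_rate q))) borel real)) x"
      then have "(\<lambda>n. cdf (?\<mu> (e n)) x) \<longlonglongrightarrow> cdf (distr (measure_pmf (poisson_pmf (qOU_rate q))) borel real) x"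
        using conv unfolding weak_conv_m_def weak_conv_def by simp
      then show "(\<lambda>n. cdf (?\<mu> (\<epsilon> n)) x) \<longlonglongrightarrow> cdf (distr (measure_pmf (poisson_pmf (qOU_rate q))) borel real) x"
        by (rule Lim_transform_eventually) (use ev in \<open>eventually_elim, simp\<close>)
    qed
  qed
qed

end
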